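(* Let $N\ge1$ be an integer and let $p$ be a rational prime that is inert in $K$ with $p\nmid N$. Then the Maass space $\mathfrak M_k^*(N)$ is stable under $T_p$: if $F\in\mathfrak M_k^*(N)$, then $F|_kT_p\in\mathfrak M_k^*(N)$.
   Context: $K\subset\mathbb C$ is an imaginary quadratic field of discriminant $-D$ ($D>0$) with ring of integers $\mathfrak o_K$ and inverse different $\mathfrak d_K=\frac1{\sqrt{-D}}\mathfrak o_K$; $k$ is an integer divisible by $|\mathfrak o_K^\times|$; $\mathsf e[x]=e^{2\pi ix}$; $g^*=\bar g^t$; $J_4=\begin{pmatrix} 0 & -I_2 \\ I_2 & 0 \end{pmatrix}$. $\mathsf U(2,2)(\mathbb Z)=\{g\in \mathrm{GL}_4(\mathfrak o_K): g^*J_4g=J_4\}$ and $$\Gamma_{0,2}(N)=\left\{\begin{pmatrix} A & B \\ C & D' \end{pmatrix}\in\mathsf U(2,2)(\mathbb Z): C\equiv0\bmod N\mathfrak o_K\right\}.$$ The hermitian upper half space is $\mathbb H_2=\{Z\in M_2(\mathbb C): -i(Z-\bar Z^t)\text{ is positive definite Hermitian}\}$. For $g=\begin{pmatrix} A & B \\ C & D' \end{pmatrix}\in \mathrm{GL}_4(\mathbb C)$ with $g^*J_4g=\mu J_4$, $\mu>0$, set $gZ=(AZ+B)(CZ+D')^{-1}$ and $(F|_kg)(Z)=\det(CZ+D')^{-k}F(gZ)$. $\mathfrak M_{k,2}(N)$ is the space of holomorphic $F:\mathbb H_2\to\mathbb C$ with $F|_kg=F$ for all $g\in\Gamma_{0,2}(N)$.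 Let $S_2=\left\{\begin{pmatrix} \ell & t \\ \bar t & m \end{pmatrix}:\ell,m\in\mathbb Z,\ t\in\mathfrak d_K\right\}$; each $F\in\mathfrak M_{k,2}(N)$ has a Fourier expansion $F(Z)=\sum_{T\in S_2}c_F(T)\,\mathsf e[\mathrm{Tr}(TZ)]$. For $0\ne T\in S_2$ put $\epsilon(T)=\max\{q\in\mathbb Z_{>0}:\frac1qT\in S_2\}$. The Maass space $\mathfrak M_k^*(N)\subseteq\mathfrak M_{k,2}(N)$ consists of those $F$ for which there is a function $\alpha_F:\mathbb Z_{\ge0}\to\mathbb C$ with $$c_F(T)=\sum_{\substack{d\in\mathbb Z_{>0},\ d\mid\epsilon(T) \\ \gcd(d,N)=1}}d^{k-1}\alpha_F\!\left(\frac{D\det T}{d^2}\right)\qquad\text{for all }T\in S_2,\ T\ge0,\ T\ne0.$$ The Hecke operator $T_p$ is the double coset $\Gamma_{0,2}(N)\begin{pmatrix} I_2 & 0 \\ 0 & pI_2 \end{pmatrix}\Gamma_{0,2}(N)$; it acts by $F|_kT_p=\sum_iF|_kg_i$, where the double coset is the finite disjoint union $\bigsqcup_i\Gamma_{0,2}(N)g_i$. *)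

theory Defs
  imports "HOL-Analysis.Analysis" "HOL-Computational_Algebra.Computational_Algebra"
begin

definition is_subfield :: "complex set \<Rightarrow> bool" where
  "is_subfield K \<longleftrightarrow> 0 \<in> K \<and> 1 \<in> K \<and>
     (\<forall>x\<in>K. \<forall>y\<in>K. x + y \<in> K \<and> x * y \<in> K) \<and> (\<forall>x\<in>K. - x \<in> K \<and> inverse x \<in> K)"

text \<open>As \<open>\<omega>\<close> is not real, \<open>1, \<omega>\<close> is a basis of \<open>K\<close> over the rationals, so \<open>K\<close> has degree 2.\<close>

definition imaginary_quadratic_field :: "complex set \<Rightarrow> bool" where
  "imaginary_quadratic_field K \<longleftrightarrow> is_subfield K \<and>
     (\<exists>\<omega>\<in>K. \<omega> \<notin> \<real> \<and> K = {of_rat a + of_rat b * \<omega> | a b. True})"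

definition ring_of_integers :: "complex set \<Rightarrow> complex set" where
  "ring_of_integers K = {x \<in> K. algebraic_int x}"

definition unit_group :: "complex set \<Rightarrow> complex set" where
  "unit_group K = {u \<in> ring_of_integers K. \<exists>v\<in>ring_of_integers K. u * v = 1}"

text \<open>The discriminant is \<open>det (\<sigma>\<^sub>i(\<omega>\<^sub>j))\<^sup>2\<close> for an integral basis \<open>\<omega>\<^sub>1, \<omega>\<^sub>2\<close>; the two embeddings
  of an imaginary quadratic field are the identity and complex conjugation. Two generators of
  the ring of integers, which has rank 2 as an abelian group, are automatically a basis.\<close>

definition has_discriminant :: "complex set \<Rightarrow> int \<Rightarrow> bool" where
  "has_discriminant K \<Delta> \<longleftrightarrow>
     (\<exists>\<omega>\<^sub>1 \<omega>\<^sub>2. ring_of_integers K = {of_int a * \<omega>\<^sub>1 + of_int b * \<omega>\<^sub>2 | a b. True} \<and>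
        of_int \<Delta> = (\<omega>\<^sub>1 * cnj \<omega>\<^sub>2 - \<omega>\<^sub>2 * cnj \<omega>\<^sub>1)\<^sup>2)"

text \<open>Here \<open>- D\<close> is the discriminant of \<open>K\<close>.\<close>

definition inverse_different :: "complex set \<Rightarrow> nat \<Rightarrow> complex set" where
  "inverse_different K D = {x / (\<i> * of_real (sqrt (real D))) | x. x \<in> ring_of_integers K}"

definition ideal_of_nat :: "complex set \<Rightarrow> nat \<Rightarrow> complex set" where
  "ideal_of_nat K n = {of_nat n * x | x. x \<in> ring_of_integers K}"

definition inert_prime :: "complex set \<Rightarrow> nat \<Rightarrow> bool" where
  "inert_prime K p \<longleftrightarrow> prime p \<and> 1 \<notin> ideal_of_nat K p \<and>
     (\<forall>x\<in>ring_of_integers K. \<forall>y\<in>ring_of_integers K.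
        x * y \<in> ideal_of_nat K p \<longrightarrow> x \<in> ideal_of_nat K p \<or> y \<in> ideal_of_nat K p)"

text \<open>Block matrices are indexed by the disjoint sum type \<open>2 + 2\<close>, which has four elements.\<close>

type_synonym mat2 = "complex^2^2"
type_synonym mat4 = "complex^(2+2)^(2+2)"

definition conj_transpose :: "complex^'n^'m \<Rightarrow> complex^'m^'n" where
  "conj_transpose A = (\<chi> i j. cnj (A $ j $ i))"

definition scale_mat :: "complex \<Rightarrow> complex^'n^'m \<Rightarrow> complex^'n^'m" where
  "scale_mat c A = (\<chi> i j. c * A $ i $ j)"

definition herm_form :: "complex^'n^'n \<Rightarrow> complex^'n \<Rightarrow> complex" where
  "herm_form A v = (\<Sum>i\<in>UNIV. cnj (v $ i) * (A *v v) $ i)"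

text \<open>The form of a Hermitian matrix takes real values, so taking real parts loses nothing.\<close>

definition pos_def_hermitian :: "complex^'n^'n \<Rightarrow> bool" where
  "pos_def_hermitian A \<longleftrightarrow> conj_transpose A = A \<and> (\<forall>v. v \<noteq> 0 \<longrightarrow> 0 < Re (herm_form A v))"

definition pos_semidef_hermitian :: "complex^'n^'n \<Rightarrow> bool" where
  "pos_semidef_hermitian A \<longleftrightarrow> conj_transpose A = A \<and> (\<forall>v. 0 \<le> Re (herm_form A v))"

definition block_mat :: "mat2 \<Rightarrow> mat2 \<Rightarrow> mat2 \<Rightarrow> mat2 \<Rightarrow> mat4" where
  "block_mat A B C E = (\<chi> i j. case i of
       Inl a \<Rightarrow> (case j of Inl b \<Rightarrow> A $ a $ b | Inr b \<Rightarrow> B $ a $ b)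
     | Inr a \<Rightarrow> (case j of Inl b \<Rightarrow> C $ a $ b | Inr b \<Rightarrow> E $ a $ b))"

definition block_A :: "mat4 \<Rightarrow> mat2" where "block_A g = (\<chi> i j. g $ Inl i $ Inl j)"
definition block_B :: "mat4 \<Rightarrow> mat2" where "block_B g = (\<chi> i j. g $ Inl i $ Inr j)"
definition block_C :: "mat4 \<Rightarrow> mat2" where "block_C g = (\<chi> i j. g $ Inr i $ Inl j)"
definition block_D :: "mat4 \<Rightarrow> mat2" where "block_D g = (\<chi> i j. g $ Inr i $ Inr j)"

definition J4 :: mat4 where
  "J4 = block_mat 0 (- mat 1) (mat 1) 0"

definition GL4 :: "complex set \<Rightarrow> mat4 set" where
  "GL4 R = {g. (\<forall>i j. g $ i $ j \<in> R) \<and>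
     (\<exists>h. (\<forall>i j. h $ i $ j \<in> R) \<and> g ** h = mat 1 \<and> h ** g = mat 1)}"

definition U22 :: "complex set \<Rightarrow> mat4 set" where
  "U22 K = {g \<in> GL4 (ring_of_integers K). conj_transpose g ** J4 ** g = J4}"

definition Gamma0 :: "complex set \<Rightarrow> nat \<Rightarrow> mat4 set" where
  "Gamma0 K N = {g \<in> U22 K. \<forall>i j. block_C g $ i $ j \<in> ideal_of_nat K N}"

definition H2 :: "mat2 set" where
  "H2 = {Z. pos_def_hermitian (scale_mat (- \<i>) (Z - conj_transpose Z))}"

definition automorphy :: "mat4 \<Rightarrow> mat2 \<Rightarrow> mat2" where
  "automorphy g Z = block_C g ** Z + block_D g"

definition moebius :: "mat4 \<Rightarrow> mat2 \<Rightarrow> mat2" where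
  "moebius g Z = (block_A g ** Z + block_B g) ** matrix_inv (automorphy g Z)"

definition slash :: "int \<Rightarrow> (mat2 \<Rightarrow> complex) \<Rightarrow> mat4 \<Rightarrow> mat2 \<Rightarrow> complex" where
  "slash k F g Z = det (automorphy g Z) powi (- k) * F (moebius g Z)"

text \<open>Holomorphy in the four matrix entries: the total derivative exists and is complex linear.\<close>

definition holomorphic_on_H2 :: "(mat2 \<Rightarrow> complex) \<Rightarrow> bool" where
  "holomorphic_on_H2 F \<longleftrightarrow>
     (\<forall>Z\<in>H2. \<exists>L. (F has_derivative L) (at Z) \<and> (\<forall>c W. L (scale_mat c W) = c * L W))"

text \<open>Functions on \<^term>\<open>H2\<close> are represented by total functions; the values outside \<^term>\<open>H2\<close>
  are irrelevant in all definitions.\<close>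

definition modular_forms :: "complex set \<Rightarrow> int \<Rightarrow> nat \<Rightarrow> (mat2 \<Rightarrow> complex) set" where
  "modular_forms K k N = {F. holomorphic_on_H2 F \<and>
     (\<forall>g\<in>Gamma0 K N. \<forall>Z\<in>H2. slash k F g Z = F Z)}"

definition S2 :: "complex set \<Rightarrow> nat \<Rightarrow> mat2 set" where
  "S2 K D = {T. T $ 1 $ 1 \<in> \<int> \<and> T $ 2 $ 2 \<in> \<int> \<and>
     T $ 1 $ 2 \<in> inverse_different K D \<and> T $ 2 $ 1 = cnj (T $ 1 $ 2)}"

text \<open>The family \<open>c\<close> is the family of Fourier coefficients of \<open>F\<close>. On \<^term>\<open>S2 K D\<close> it is determined
  by \<open>F\<close>, since \<open>has_sum\<close> means absolute convergence here, and the characters are distinct.\<close>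

definition has_fourier_expansion ::
    "complex set \<Rightarrow> nat \<Rightarrow> (mat2 \<Rightarrow> complex) \<Rightarrow> (mat2 \<Rightarrow> complex) \<Rightarrow> bool" where
  "has_fourier_expansion K D F c \<longleftrightarrow>
     (\<forall>Z\<in>H2. ((\<lambda>T. c T * exp (2 * of_real pi * \<i> * trace (T ** Z))) has_sum F Z) (S2 K D))"

definition herm_content :: "complex set \<Rightarrow> nat \<Rightarrow> mat2 \<Rightarrow> nat" where
  "herm_content K D T = Max {q. q > 0 \<and> scale_mat (1 / of_nat q) T \<in> S2 K D}"

text \<open>For positive semidefinite \<open>T\<close> in \<^term>\<open>S2 K D\<close> and \<open>d\<close> dividing its content, the complex number
  \<open>D det T / d\<^sup>2\<close> is a nonnegative integer; \<open>Re\<close>, floor and \<open>nat\<close> only convert its type.\<close>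

definition maass_space :: "complex set \<Rightarrow> nat \<Rightarrow> int \<Rightarrow> nat \<Rightarrow> (mat2 \<Rightarrow> complex) set" where
  "maass_space K D k N = {F \<in> modular_forms K k N.
     \<exists>c. has_fourier_expansion K D F c \<and>
       (\<exists>\<alpha> :: nat \<Rightarrow> complex. \<forall>T\<in>S2 K D. pos_semidef_hermitian T \<and> T \<noteq> 0 \<longrightarrow>
          c T = (\<Sum>d | d > 0 \<and> d dvd herm_content K D T \<and> coprime d N.
             of_nat d powi (k - 1) * \<alpha> (nat \<lfloor>Re (of_nat D * det T / (of_nat d)\<^sup>2)\<rfloor>)))}"

definition double_coset :: "mat4 set \<Rightarrow> mat4 \<Rightarrow> mat4 set" where
  "double_coset G g = {a ** g ** b | a b. a \<in> G \<and> b \<in> G}"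

definition cosets_in_double_coset :: "mat4 set \<Rightarrow> mat4 \<Rightarrow> mat4 set set" where
  "cosets_in_double_coset G g = {{a ** h | a. a \<in> G} | h. h \<in> double_coset G g}"

text \<open>The sum runs over the cosets \<open>\<Gamma>h\<close> contained in the double coset, of which there are
  finitely many. For a modular form the summand does not depend on the representative chosen.\<close>

definition hecke_T ::
    "complex set \<Rightarrow> int \<Rightarrow> nat \<Rightarrow> nat \<Rightarrow> (mat2 \<Rightarrow> complex) \<Rightarrow> mat2 \<Rightarrow> complex" where
  "hecke_T K k N p F Z =
     (\<Sum>X\<in>cosets_in_double_coset (Gamma0 K N) (block_mat (mat 1) 0 0 (mat (of_nat p))).
        slash k F (SOME h. h \<in> X) Z)"

end

theory Submission
  imports Defs
begin

text \<open>Write \<open>\<O> = \<int> + \<int>\<omega>\<close> for the ring of integers and \<open>\<delta> = \<omega> - \<omega>*\<close> for the square root of \<open>-D\<close> in the upper half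
plane. Since \<open>p\<close> is inert, \<open>\<O>/p\<close> is a field with \<open>p\<^sup>2\<close> elements, and every invertibility statement below takes
place there. A hermitian index is the matrix with diagonal \<open>l, m\<close> and upper right entry \<open>s/\<delta>\<close>, \<open>s \<in> \<O>\<close>.

\<^bold>\<open>Cosets.\<close> The left coset of \<open>diag(1,1,p,p) \<gamma>\<close> depends only on the upper block row \<open>(A B)\<close> of \<open>\<gamma>\<close> modulo \<open>p\<close>, up to
row operations: it is a Lagrangian subspace of a hermitian space of dimension 4 over \<open>\<O>/p\<close>. The rank 2, 1 or 0 of \<open>A\<close>
modulo \<open>p\<close> sorts these subspaces into three families of explicit block upper triangular representatives
(\<open>compat_exists\<close>). In rank 1 the kernel of \<open>A\<close> is a point of the projective line over \<open>\<O>/p\<close>, and each such point is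
lifted to an explicit matrix \<open>U\<close> of determinant 1. Because \<open>p\<close> does not divide \<open>N\<close>, every representative does lie in
the double coset (\<open>rep_compat_exists\<close>).

\<^bold>\<open>Fourier coefficients.\<close> Triangular representatives act by \<open>Z \<mapsto> (AZ + B)E\<inverse>\<close>. Summing over \<open>B\<close> is a sum of additive
characters, which keeps exactly the indices that stay integral after division. Hence the image has the coefficients
\<open>p\<^bsup>4-2k\<^esup> c(pT) + p\<^bsup>1-k\<^esup> (\<Sum>\<^sub>U c(T\<^sub>U)) + c(T/p)\<close>, where \<open>T\<^sub>U = diag(p,1) U T U* diag(p,1) / p\<close> and \<open>c\<close> is read as
0 at nonintegral arguments (\<open>fourier_hecke\<close>).

\<^bold>\<open>Maass relation.\<close> All \<open>T\<^sub>U\<close> have the determinant of \<open>T\<close>, and the part of the content prime to \<open>p\<close> is the same for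
\<open>T\<close>, \<open>pT\<close>, \<open>T/p\<close> and \<open>T\<^sub>U\<close>. So one only has to count for how many \<open>U\<close> a power \<open>p\<^sup>i\<close> divides \<open>T\<^sub>U\<close>. Let
\<open>T = p\<^sup>e T\<^sub>0\<close> with \<open>T\<^sub>0\<close> primitive at \<open>p\<close>, and \<open>n\<^sub>0 = D det T\<^sub>0\<close>. For \<open>i < e\<close> the count is \<open>p\<^sup>2 + 1\<close>. For \<open>i = e\<close> it
is the number of isotropic points of \<open>T\<^sub>0\<close> modulo \<open>p\<close>, which is \<open>p + 1\<close> or 1 according to whether \<open>p\<close> divides \<open>n\<^sub>0\<close>
(\<open>card_isotropic\<close>); this comes down to the fact that the norm from \<open>\<O>/p\<close> takes every nonzero value \<open>p + 1\<close>
times. For \<open>i = e + 1\<close> it is 1 or 0 according to whether \<open>p\<^sup>2\<close> divides \<open>n\<^sub>0\<close> (\<open>card_deep_lines\<close>). With these counts the sum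
rearranges into a Maass sum for the function
\<open>\<alpha>'(n) = p\<^bsup>4-2k\<^esup> \<alpha>(p\<^sup>2n) + p\<^bsup>1-k\<^esup> (p\<^sup>2 + 1 + [p \<nmid> n] p) \<alpha>(n) + [p\<^sup>2 | n] \<alpha>(n/p\<^sup>2)\<close> (\<open>hecke_coeff_maass\<close>).\<close>

section \<open>The ring of integers of an imaginary quadratic field\<close>

text \<open>Splitting \<open>P(X) = E(X\<^sup>2) + X R(X\<^sup>2)\<close> prepares the passage from a monic equation of \<open>x\<close> to one of \<open>x\<^sup>2\<close>.\<close>

lemma even_odd_parts:
  fixes P :: "complex poly"
  shows "\<exists>E R. (\<forall>x. poly P x = poly E (x\<^sup>2) + x * poly R (x\<^sup>2)) \<and>
      (\<forall>i. coeff E i = coeff P (2 * i)) \<and> (\<forall>i. coeff R i = coeff P (2 * i + 1))"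
proof (induction P)
  case 0
  show ?case by (intro exI[of _ 0]) auto
next
  case (pCons a P)
  then obtain E R where
    IH: "\<And>x. poly P x = poly E (x\<^sup>2) + x * poly R (x\<^sup>2)"
    and cE: "\<And>i. coeff E i = coeff P (2 * i)" and cR: "\<And>i. coeff R i = coeff P (2 * i + 1)"
    by metis
  show ?case
  proof (rule exI[of _ "pCons a R"], rule exI[of _ E], intro conjI allI)
    fix x :: complex
    show "poly (pCons a P) x = poly (pCons a R) (x\<^sup>2) + x * poly E (x\<^sup>2)"
      by (simp add: IH algebra_simps power2_eq_square)
    fix i
    show "coeff (pCons a R) i = coeff (pCons a P) (2 * i)"
      by (cases i) (auto simp: cR)
    show "coeff E i = coeff (pCons a P) (2 * i + 1)"
      by (simp add: cE)
  qed
qed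

text \<open>From \<open>E(x\<^sup>2) = - x R(x\<^sup>2)\<close> one gets \<open>E(y)\<^sup>2 = y R(y)\<^sup>2\<close> at \<open>y = x\<^sup>2\<close>. The two sides have degrees of different parity,
and the leading coefficient of the one of larger degree is the square of that of the monic polynomial \<open>P\<close>. This single
closure property is enough to see that the norm of a generator of the ring of integers is an integer.\<close>

lemma algebraic_int_power2:
  fixes x :: complex
  assumes "algebraic_int x"
  shows "algebraic_int (x\<^sup>2)"
proof -
  obtain P :: "complex poly" where P: "lead_coeff P = 1" "\<And>i. coeff P i \<in> \<int>" "poly P x = 0"
    using assms by (auto simp: algebraic_int.simps)
  obtain E R where
    id: "\<And>x. poly P x = poly E (x\<^sup>2) + x * poly R (x\<^sup>2)"
    and cE: "\<And>i. coeff E i = coeff P (2 * i)" and cR: "\<And>i. coeff R i = coeff P (2 * i + 1)"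
    using even_odd_parts[of P] by metis
  have Eint: "coeff (E * E) i \<in> \<int>" and Rint: "coeff (pCons 0 (R * R)) i \<in> \<int>" for i
    by (auto simp: coeff_mult coeff_pCons cE cR P(2) intro!: Ints_sum Ints_mult split: nat.splits)
  have "poly E (x\<^sup>2) = - (x * poly R (x\<^sup>2))"
    using P(3) id[of x] by (simp add: eq_neg_iff_add_eq_0)
  then have root: "poly (E * E) (x\<^sup>2) = poly (pCons 0 (R * R)) (x\<^sup>2)"
    by (simp add: power2_eq_square)
  have big: "coeff P i = 0" if "i > degree P" for i
    using that by (rule coeff_eq_0)
  show ?thesis
  proof (cases "even (degree P)")
    case True
    then obtain m where m: "degree P = 2 * m" by blast
    have "coeff E m = 1" using P(1) m by (simp add: cE)
    moreover have dE: "degree E \<le> m" using big m by (intro degree_le) (auto simp: cE)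
    ultimately have E: "degree E = m" "lead_coeff E = 1"
      by (metis le_antisym le_degree zero_neq_one)+
    have EE: "degree (E * E) = 2 * m" "lead_coeff (E * E) = 1"
      using E by (auto simp: degree_mult_eq lead_coeff_mult simp del: coeff_mult_degree_sum)
        (metis degree_mult_eq leading_coeff_0_iff mult_2 zero_neq_one)
    have "degree (pCons 0 (R * R)) < degree (E * E) \<or> pCons 0 (R * R) = 0"
    proof (cases "R = 0")
      case False
      have "coeff R (degree R) \<noteq> 0" using False by simp
      then have "2 * degree R + 1 \<le> 2 * m" using big[of "2 * degree R + 1"] m
        by (metis cR not_le)
      then have "Suc (degree R + degree R) < 2 * m" by presburger
      then show ?thesis using False EE by (simp add: degree_mult_eq)
    qed auto
    then have "lead_coeff (E * E + - pCons 0 (R * R)) = 1"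
    proof
      assume "degree (pCons 0 (R * R)) < degree (E * E)"
      then have "lead_coeff (- pCons 0 (R * R) + E * E) = lead_coeff (E * E)"
        by (intro lead_coeff_add_le) (simp only: degree_minus)
      then show ?thesis using EE by (simp only: add.commute)
    qed (use EE in simp)
    moreover have "coeff (E * E + - pCons 0 (R * R)) i \<in> \<int>" for i
      unfolding coeff_add coeff_minus by (intro Ints_add Ints_minus Eint Rint)
    moreover have "poly (E * E + - pCons 0 (R * R)) (x\<^sup>2) = 0"
      using root by simp
    ultimately show ?thesis
      by (blast intro: algebraic_int.intros)
  next
    case False
    then obtain m where m: "degree P = 2 * m + 1" by (rule oddE)
    have "coeff R m = 1" using P(1) m by (simp add: cR)
    moreover have "degree R \<le> m" using big m by (intro degree_le) (auto simp: cR)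
    ultimately have R: "degree R = m" "lead_coeff R = 1" "R \<noteq> 0"
      by (metis le_antisym le_degree zero_neq_one coeff_0)+
    have RR: "degree (pCons 0 (R * R)) = 2 * m + 1" "lead_coeff (pCons 0 (R * R)) = 1"
      using R by (auto simp: degree_mult_eq)
        (metis coeff_mult_degree_sum mult_1)
    have "degree E \<le> m" using big m by (intro degree_le) (auto simp: cE)
    then have "degree (E * E) \<le> 2 * m" using degree_mult_le[of E E] by simp
    then have "lead_coeff (- (E * E) + pCons 0 (R * R)) = lead_coeff (pCons 0 (R * R))"
      using RR(1) by (intro lead_coeff_add_le) (simp only: degree_minus)
    then have "lead_coeff (- (E * E) + pCons 0 (R * R)) = 1" using RR by simp
    moreover have "coeff (- (E * E) + pCons 0 (R * R)) i \<in> \<int>" for i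
      unfolding coeff_add coeff_minus by (intro Ints_add Ints_minus Eint Rint)
    moreover have "poly (- (E * E) + pCons 0 (R * R)) (x\<^sup>2) = 0"
      using root by simp
    ultimately show ?thesis
      by (blast intro: algebraic_int.intros)
  qed
qed

text \<open>The data of an imaginary quadratic order in coordinates: trace \<open>\<tau>\<close> and norm \<open>\<nu>\<close> of a generator \<open>\<omega>\<close>, normalised by
its position in the upper half plane.\<close>

locale imag_quad =
  fixes \<omega> :: complex and \<tau> \<nu> :: int and D :: nat
  assumes omega_sq: "\<omega> * \<omega> = of_int \<tau> * \<omega> - of_int \<nu>"
    and cnj_omega: "cnj \<omega> = of_int \<tau> - \<omega>"
    and disc: "\<omega> - cnj \<omega> = \<i> * of_real (sqrt (real D))"
    and D_pos: "D > 0"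
begin

definition \<O> :: "complex set" where
  "\<O> = {of_int a + of_int b * \<omega> | a b. True}"

definition \<delta> :: complex where
  "\<delta> = \<i> * of_real (sqrt (real D))"

definition I :: "nat \<Rightarrow> complex set" where
  "I q = {of_nat q * x | x. x \<in> \<O>}"

lemma O_E:
  assumes "x \<in> \<O>"
  obtains a b where "x = of_int a + of_int b * \<omega>"
  using assms by (auto simp: \<O>_def)

lemma O_coord [intro, simp]: "of_int a + of_int b * \<omega> \<in> \<O>"
  by (auto simp: \<O>_def)

lemma O_add [intro, simp]: "x \<in> \<O> \<Longrightarrow> y \<in> \<O> \<Longrightarrow> x + y \<in> \<O>"
proof (elim O_E)
  fix a b c d
  assume "x = of_int a + of_int b * \<omega>" "y = of_int c + of_int d * \<omega>"
  then have "x + y = of_int (a + c) + of_int (b + d) * \<omega>" by (simp add: algebra_simps)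
  then show ?thesis by (simp only: O_coord)
qed

lemma O_minus [intro, simp]: "x \<in> \<O> \<Longrightarrow> - x \<in> \<O>"
proof (elim O_E)
  fix a b
  assume "x = of_int a + of_int b * \<omega>"
  then have "- x = of_int (- a) + of_int (- b) * \<omega>" by (simp add: algebra_simps)
  then show ?thesis by (simp only: O_coord)
qed

lemma O_diff [intro, simp]: "x \<in> \<O> \<Longrightarrow> y \<in> \<O> \<Longrightarrow> x - y \<in> \<O>"
  using O_add[of x "- y"] by simp

lemma O_of_int [intro, simp]: "of_int a \<in> \<O>"
  using O_coord[of a 0] by simp

lemma O_of_nat [intro, simp]: "of_nat a \<in> \<O>"
  using O_of_int[of "int a"] by simp

lemma O_0 [intro, simp]: "0 \<in> \<O>" and O_1 [intro, simp]: "1 \<in> \<O>"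
  using O_of_int[of 0] O_of_int[of 1] by simp_all

lemma O_mult [intro, simp]: "x \<in> \<O> \<Longrightarrow> y \<in> \<O> \<Longrightarrow> x * y \<in> \<O>"
proof (elim O_E)
  fix a b c d
  assume xy: "x = of_int a + of_int b * \<omega>" "y = of_int c + of_int d * \<omega>"
  have "x * y = of_int a * of_int c + of_int (a * d + b * c) * \<omega> + of_int (b * d) * (\<omega> * \<omega>)"
    by (simp add: xy algebra_simps)
  also have "\<dots> = of_int (a * c - b * d * \<nu>) + of_int (a * d + b * c + b * d * \<tau>) * \<omega>"
    by (simp add: omega_sq algebra_simps)
  finally show ?thesis by (simp only: O_coord)
qed

lemma O_cnj [intro, simp]: "x \<in> \<O> \<Longrightarrow> cnj x \<in> \<O>"
proof (elim O_E)
  fix a b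
  assume "x = of_int a + of_int b * \<omega>"
  then have "cnj x = of_int (a + b * \<tau>) + of_int (- b) * \<omega>"
    by (simp add: cnj_omega algebra_simps)
  then show ?thesis by (simp only: O_coord)
qed

lemma omega_minus_cnj: "\<omega> - cnj \<omega> = \<delta>"
  by (simp add: disc \<delta>_def)

lemma delta_ne [simp]: "\<delta> \<noteq> 0"
  using D_pos by (simp add: \<delta>_def)

lemma delta_sq: "\<delta> * \<delta> = - of_nat D"
  by (simp add: \<delta>_def algebra_simps) (simp flip: of_real_mult)

lemma cnj_delta [simp]: "cnj \<delta> = - \<delta>"
  by (simp add: \<delta>_def)

lemma delta_O [intro, simp]: "\<delta> \<in> \<O>"
proof -
  have "\<delta> = of_int (- \<tau>) + of_int 2 * \<omega>"
    using omega_minus_cnj by (simp add: cnj_omega)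
  then show ?thesis by (metis O_coord)
qed

lemma cnj_coord: "cnj (of_int a + of_int b * \<omega>) = of_int a + of_int b * \<omega> - of_int b * \<delta>"
proof -
  have "cnj \<omega> = \<omega> - \<delta>" by (simp flip: omega_minus_cnj)
  then show ?thesis by (simp add: right_diff_distrib)
qed

lemma coord_unique:
  assumes "of_int a + of_int b * \<omega> = of_int c + of_int d * \<omega>"
  shows "a = c" "b = d"
proof -
  have "cnj (of_int a + of_int b * \<omega>) = cnj (of_int c + of_int d * \<omega>)" using assms by simp
  then have "of_int b * \<delta> = of_int d * \<delta>" using assms unfolding cnj_coord by simp
  then show "b = d" by simp
  then show "a = c" using assms by simp
qed

text \<open>The trace form against the inverse different picks out the \<open>\<omega>\<close>-coordinate; this is why \<open>\<O>/\<delta>\<close> is dual to \<open>\<O>\<close>.\<close>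

lemma trace_delta_coord:
  "(of_int a + of_int b * \<omega>) / \<delta> + cnj ((of_int a + of_int b * \<omega>) / \<delta>) = of_int b"
  by (simp only: complex_cnj_divide cnj_coord cnj_delta) (simp add: field_simps)

lemma O_real:
  assumes "x \<in> \<O>" "cnj x = x"
  shows "x \<in> \<int>"
proof -
  obtain a b where x: "x = of_int a + of_int b * \<omega>" using assms(1) by (rule O_E)
  then have "b = 0" using assms(2) by (simp only: cnj_coord) simp
  then show ?thesis by (simp add: x)
qed

lemma O_norm: "x \<in> \<O> \<Longrightarrow> x * cnj x \<in> \<int>"
  by (rule O_real) auto

lemma O_trace_delta: "x \<in> \<O> \<Longrightarrow> x / \<delta> + cnj (x / \<delta>) \<in> \<int>"
  by (elim O_E) (simp only: trace_delta_coord Ints_of_int)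

lemma coord_in_I: "of_int a + of_int b * \<omega> \<in> I q \<longleftrightarrow> int q dvd a \<and> int q dvd b"
proof
  assume "of_int a + of_int b * \<omega> \<in> I q"
  then obtain c d where "of_int a + of_int b * \<omega> = of_nat q * (of_int c + of_int d * \<omega>)"
    by (auto simp: I_def elim!: O_E)
  then have "of_int a + of_int b * \<omega> = of_int (q * c) + of_int (q * d) * \<omega>"
    by (simp add: algebra_simps)
  from coord_unique[OF this] show "int q dvd a \<and> int q dvd b" by auto
next
  assume "int q dvd a \<and> int q dvd b"
  then obtain c d where "a = int q * c" "b = int q * d" by (auto elim!: dvdE)
  then have "of_int a + of_int b * \<omega> = of_nat q * (of_int c + of_int d * \<omega>)"
    by (simp add: algebra_simps)
  then show "of_int a + of_int b * \<omega> \<in> I q" unfolding I_def by blast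
qed

lemma int_in_I: "of_int a \<in> I q \<longleftrightarrow> int q dvd a"
  using coord_in_I[of a 0 q] by simp

lemma I_subset: "x \<in> I q \<Longrightarrow> x \<in> \<O>"
  by (auto simp: I_def)

lemma I_0 [intro, simp]: "0 \<in> I q"
  using int_in_I[of 0 q] by simp

lemma I_add [intro]: "x \<in> I q \<Longrightarrow> y \<in> I q \<Longrightarrow> x + y \<in> I q"
  unfolding I_def by clarsimp (metis O_add distrib_left)

lemma I_minus [intro]: "x \<in> I q \<Longrightarrow> - x \<in> I q"
  unfolding I_def by clarsimp (metis O_minus mult_minus_right)

lemma I_minus_iff [simp]: "- x \<in> I q \<longleftrightarrow> x \<in> I q"
  using I_minus[of x q] I_minus[of "- x" q] by auto

lemma I_diff [intro]: "x \<in> I q \<Longrightarrow> y \<in> I q \<Longrightarrow> x - y \<in> I q"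
  using I_add[of x q "- y"] by auto

lemma I_mult1 [intro]: "x \<in> \<O> \<Longrightarrow> y \<in> I q \<Longrightarrow> x * y \<in> I q"
  unfolding I_def by clarsimp (metis O_mult mult.left_commute)

lemma I_mult2 [intro]: "x \<in> I q \<Longrightarrow> y \<in> \<O> \<Longrightarrow> x * y \<in> I q"
  using I_mult1[of y x q] by (simp add: mult.commute)

lemma I_cnj [intro]: "x \<in> I q \<Longrightarrow> cnj x \<in> I q"
  unfolding I_def by clarsimp (metis O_cnj)

lemma I_cnj_iff [simp]: "cnj x \<in> I q \<longleftrightarrow> x \<in> I q"
  using I_cnj[of x q] I_cnj[of "cnj x" q] by auto

lemma I_of_nat [intro, simp]: "x \<in> \<O> \<Longrightarrow> of_nat q * x \<in> I q"
  by (auto simp: I_def)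

lemma I_scale_iff: "n > 0 \<Longrightarrow> of_nat n * x \<in> I (n * m) \<longleftrightarrow> x \<in> I m"
  unfolding I_def by (auto simp: mult.assoc)

lemma I_1 [simp]: "I 1 = \<O>" "I (Suc 0) = \<O>"
  by (auto simp: I_def)

lemma I_dvd: "x \<in> I n \<Longrightarrow> m dvd n \<Longrightarrow> x \<in> I m"
  unfolding I_def by (elim dvdE) (auto simp: mult.assoc)

lemma I_cancel:
  assumes "of_nat n * x \<in> I m" "coprime m n" "x \<in> \<O>"
  shows "x \<in> I m"
proof -
  obtain a b where x: "x = of_int a + of_int b * \<omega>"
    using assms(3) by (rule O_E)
  then have "of_nat n * x = of_int (int n * a) + of_int (int n * b) * \<omega>"
    by (simp add: algebra_simps)
  then show ?thesis using assms(1,2) unfolding x coord_in_I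
    by (metis coprime_dvd_mult_right_iff coprime_int_iff coord_in_I)
qed

end

lemma quadratic_field_cnj:
  assumes "imaginary_quadratic_field K" "x \<in> K"
  shows "cnj x \<in> K"
proof -
  obtain \<theta> where th: "\<theta> \<in> K" "\<theta> \<notin> \<real>" and K: "K = {of_rat a + of_rat b * \<theta> | a b. True}"
    and sub: "is_subfield K"
    using assms(1) by (auto simp: imaginary_quadratic_field_def)
  have "\<theta> * \<theta> \<in> K" using sub th by (auto simp: is_subfield_def)
  then obtain a b where ab: "\<theta> * \<theta> = of_rat a + of_rat b * \<theta>" unfolding K by blast
  have real: "cnj (of_rat r) = of_rat r" for r
    by (cases r) (simp add: of_rat_rat)
  have ab': "cnj \<theta> * cnj \<theta> = of_rat a + of_rat b * cnj \<theta>"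
    using arg_cong[OF ab, of cnj] by (simp add: real)
  have "(\<theta> - cnj \<theta>) * (\<theta> + cnj \<theta> - of_rat b) = 0"
    using ab ab' by (simp add: algebra_simps)
  then have "\<theta> - cnj \<theta> = 0 \<or> \<theta> + cnj \<theta> - of_rat b = 0" by (simp only: mult_eq_0_iff)
  moreover have "\<theta> - cnj \<theta> \<noteq> 0" using th(2) by (simp add: Reals_cnj_iff)
  ultimately have "\<theta> + cnj \<theta> - of_rat b = 0" by blast
  then have c: "cnj \<theta> = of_rat b - \<theta>" by (simp add: eq_diff_eq add.commute)
  obtain r s where "x = of_rat r + of_rat s * \<theta>" using assms(2) K by blast
  then have "cnj x = of_rat (r + s * b) + of_rat (- s) * \<theta>"
    by (simp add: real c of_rat_add of_rat_mult of_rat_minus algebra_simps)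
  then show ?thesis unfolding K by blast
qed

text \<open>As 1 lies in the lattice \<open>\<int>w\<^sub>1 + \<int>w\<^sub>2\<close> and no proper fraction \<open>1/g\<close> is an algebraic integer, 1 is a primitive vector
and extends to a basis \<open>1, \<eta>\<close>. A unimodular change of basis preserves the discriminant, so \<open>\<eta> - \<eta>*\<close> is a square root of
\<open>-D\<close>, and a sign makes it the one in the upper half plane. Trace and norm of \<open>\<omega>\<close> are integers because \<open>\<omega>*\<close> and
\<open>\<omega>\<^sup>2\<close> are again algebraic integers in \<open>K\<close>, hence in the lattice, and conjugation pins down their coordinates.\<close>

lemma ring_of_integers_basis:
  assumes K: "imaginary_quadratic_field K" and D: "D > 0"
    and disc: "has_discriminant K (- int D)"
  obtains \<omega> \<tau> \<nu> where "imag_quad \<omega> \<tau> \<nu> D"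
    "ring_of_integers K = {of_int a + of_int b * \<omega> | a b. True}"
proof -
  let ?R = "ring_of_integers K"
  obtain w1 w2 where R: "?R = {of_int a * w1 + of_int b * w2 | a b. True}"
    and dw: "of_int (- int D) = (w1 * cnj w2 - w2 * cnj w1)\<^sup>2"
    using disc by (auto simp: has_discriminant_def)
  have sub: "is_subfield K" using K by (simp add: imaginary_quadratic_field_def)
  have "1 \<in> ?R" using sub by (auto simp: ring_of_integers_def is_subfield_def intro: int_imp_algebraic_int)
  then obtain a b where ab: "1 = of_int a * w1 + of_int b * w2" unfolding R by blast
  \<comment> \<open>otherwise \<open>1/g\<close> would be a rational algebraic integer in the lattice\<close>
  have g1: "gcd a b = 1"
  proof -
    let ?g = "gcd a b"
    have g0: "?g \<noteq> 0" using ab by auto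
    obtain a' b' where a': "a = ?g * a'" "b = ?g * b'" by (meson dvdE gcd_dvd1 gcd_dvd2)
    have "(of_int ?g :: complex) * (of_int a' * w1 + of_int b' * w2) = of_int (?g * a') * w1 + of_int (?g * b') * w2"
      by (simp add: algebra_simps)
    also have "\<dots> = 1" using ab by (simp only: a'[symmetric])
    finally have eq: "1 / of_int ?g = of_int a' * w1 + of_int b' * w2"
      using g0 by (simp add: field_simps)
    have "1 / of_int ?g \<in> ?R" unfolding eq R by blast
    then have "1 / (of_int ?g :: complex) \<in> \<int>"
      by (intro rational_algebraic_int_is_int) (auto simp: ring_of_integers_def)
    then obtain z where "1 / (of_int ?g :: complex) = of_int z" by (rule Ints_cases)
    then have "(of_int (z * ?g) :: complex) = of_int 1" using g0 by (simp add: field_simps)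
    then have "z * ?g = 1" by (simp only: of_int_eq_iff)
    then have "?g dvd 1" by (metis dvd_triv_right)
    then show ?thesis by simp
  qed
  obtain u v where "u * a + v * b = gcd a b" using bezout_int by blast
  then have uv: "u * a + v * b = 1" using g1 by simp
  \<comment> \<open>with \<open>1 = a w\<^sub>1 + b w\<^sub>2\<close> this makes the change of basis unimodular\<close>
  define \<eta> where "\<eta> = of_int (- v) * w1 + of_int u * w2"
  have uvc: "of_int u * of_int a + of_int v * of_int b = (1::complex)"
    using arg_cong[OF uv, of "of_int :: int \<Rightarrow> complex"] by simp
  have w1: "w1 = of_int u - of_int b * \<eta>"
  proof -
    have "of_int u * (of_int a * w1 + of_int b * w2) - of_int b * \<eta> = (of_int u * of_int a + of_int v * of_int b) * w1"
      by (simp add: \<eta>_def algebra_simps)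
    then show ?thesis using uvc ab by simp
  qed
  have w2: "w2 = of_int v + of_int a * \<eta>"
  proof -
    have "of_int v * (of_int a * w1 + of_int b * w2) + of_int a * \<eta> = (of_int u * of_int a + of_int v * of_int b) * w2"
      by (simp add: \<eta>_def algebra_simps)
    then show ?thesis using uvc ab by simp
  qed
  have R1: "?R = {of_int a + of_int b * \<eta> | a b. True}"
  proof (intro equalityI subsetI)
    fix x assume "x \<in> ?R"
    then obtain c d where "x = of_int c * w1 + of_int d * w2" unfolding R by blast
    then have "x = of_int (c * u + d * v) + of_int (d * a - c * b) * \<eta>"
      by (simp add: w1 w2 algebra_simps)
    then show "x \<in> {of_int a + of_int b * \<eta> | a b. True}" by blast
  next
    fix x assume "x \<in> {of_int a + of_int b * \<eta> | a b. True}"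
    then obtain c d where "x = of_int c * 1 + of_int d * \<eta>" by auto
    then have "x = of_int c * (of_int a * w1 + of_int b * w2) + of_int d * \<eta>" using ab by simp
    then have "x = of_int (c * a - d * v) * w1 + of_int (c * b + d * u) * w2"
      by (simp add: \<eta>_def algebra_simps)
    then show "x \<in> ?R" unfolding R by blast
  qed
  have "w1 * cnj w2 - w2 * cnj w1 = (of_int u * of_int a + of_int v * of_int b) * (cnj \<eta> - \<eta>)"
    by (simp add: w1 w2 algebra_simps)
  then have "(\<eta> - cnj \<eta>)\<^sup>2 = - of_nat D"
    using dw uvc by (simp add: power2_commute)
  also have "\<dots> = (\<i> * of_real (sqrt (real D)))\<^sup>2"
    by (simp add: power_mult_distrib flip: of_real_power)
  finally have "\<eta> - cnj \<eta> = \<i> * of_real (sqrt (real D)) \<or> \<eta> - cnj \<eta> = - (\<i> * of_real (sqrt (real D)))"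
    by (simp only: power2_eq_iff)
  then have pm: "\<eta> - cnj \<eta> = \<i> * of_real (sqrt (real D)) \<or> - \<eta> - cnj (- \<eta>) = \<i> * of_real (sqrt (real D))"
  proof
    assume "\<eta> - cnj \<eta> = - (\<i> * of_real (sqrt (real D)))"
    moreover have "- \<eta> - cnj (- \<eta>) = - (\<eta> - cnj \<eta>)" by simp
    ultimately show ?thesis by (simp only: minus_minus simp_thms)
  qed simp
  define \<omega> where "\<omega> = (if \<eta> - cnj \<eta> = \<i> * of_real (sqrt (real D)) then \<eta> else - \<eta>)"
  have dom: "\<omega> - cnj \<omega> = \<i> * of_real (sqrt (real D))" using pm by (auto simp: \<omega>_def)
  have R2: "?R = {of_int a + of_int b * \<omega> | a b. True}"
  proof (cases "\<omega> = \<eta>")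
    case False
    then have "\<omega> = - \<eta>" by (auto simp: \<omega>_def split: if_splits)
    moreover have "{of_int a + of_int b * \<eta> | a b. True} = {of_int a + of_int b * (- \<eta>) | a b. True}"
    proof (intro equalityI subsetI)
      fix x assume "x \<in> {of_int a + of_int b * \<eta> | a b. True}"
      then obtain a b where "x = of_int a + of_int b * \<eta>" by blast
      then have "x = of_int a + of_int (- b) * (- \<eta>)" by simp
      then show "x \<in> {of_int a + of_int b * (- \<eta>) | a b. True}" by blast
    next
      fix x assume "x \<in> {of_int a + of_int b * (- \<eta>) | a b. True}"
      then obtain a b where "x = of_int a + of_int b * (- \<eta>)" by blast
      then have "x = of_int a + of_int (- b) * \<eta>" by simp
      then show "x \<in> {of_int a + of_int b * \<eta> | a b. True}" by blast
    qed
    ultimately show ?thesis using R1 by (simp only:)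
  qed (use R1 in simp)
  have ne: "\<omega> - cnj \<omega> \<noteq> 0" using D dom by simp
  have om: "\<omega> \<in> ?R" unfolding R2 by (rule CollectI, rule exI[of _ 0], rule exI[of _ 1]) simp
  then have omK: "\<omega> \<in> K" "algebraic_int \<omega>" by (auto simp: ring_of_integers_def)
  have "cnj \<omega> \<in> ?R" using omK quadratic_field_cnj[OF K] by (auto simp: ring_of_integers_def)
  then obtain a b where "cnj \<omega> = of_int a + of_int b * \<omega>" unfolding R2 by blast
  then have tr: "\<omega> + cnj \<omega> = of_int a + of_int (b + 1) * \<omega>" by (simp add: algebra_simps)
  have "cnj (\<omega> + cnj \<omega>) = \<omega> + cnj \<omega>" by simp
  then have "of_int (b + 1) * (\<omega> - cnj \<omega>) = 0" unfolding tr by (simp add: algebra_simps)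
  then have "of_int (b + 1) = (0::complex)" using ne by (metis mult_eq_0_iff)
  then have cn: "cnj \<omega> = of_int a - \<omega>" using tr by (simp add: algebra_simps)
  have "\<omega> * \<omega> \<in> ?R"
    using omK sub algebraic_int_power2[of \<omega>] by (auto simp: ring_of_integers_def is_subfield_def power2_eq_square)
  then obtain e f where ef: "\<omega> * \<omega> = of_int e + of_int f * \<omega>" unfolding R2 by blast
  have "cnj \<omega> * cnj \<omega> = of_int e + of_int f * cnj \<omega>"
    using arg_cong[OF ef, of cnj] by simp
  then have "(\<omega> - cnj \<omega>) * (\<omega> + cnj \<omega> - of_int f) = 0" using ef by (simp add: algebra_simps)
  then have "\<omega> + cnj \<omega> - of_int f = 0" using ne by (metis mult_eq_0_iff)
  then have "of_int f = (of_int a :: complex)" using cn by (simp add: algebra_simps)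
  then have "imag_quad \<omega> a (- e) D"
    by unfold_locales (use ef cn dom D in \<open>auto simp: algebra_simps\<close>)
  then show ?thesis using R2 by (rule that)
qed

section \<open>The residue field of an inert prime\<close>

context imag_quad
begin

text \<open>On \<open>\<O>\<close> the floor and the real part only convert types.\<close>

definition nrm :: "complex \<Rightarrow> int" where
  "nrm x = \<lfloor>Re (x * cnj x)\<rfloor>"

definition trd :: "complex \<Rightarrow> int" where
  "trd x = \<lfloor>Re (x / \<delta> + cnj (x / \<delta>))\<rfloor>"

lemma of_int_nrm: "x \<in> \<O> \<Longrightarrow> of_int (nrm x) = x * cnj x"
  using O_norm[of x] unfolding nrm_def
  by (metis Ints_cases Re_complex_of_real floor_of_int of_real_of_int_eq)

lemma of_int_trd: "x \<in> \<O> \<Longrightarrow> of_int (trd x) = x / \<delta> + cnj (x / \<delta>)"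
  using O_trace_delta[of x] unfolding trd_def by (metis Ints_cases Re_complex_of_real floor_of_int of_real_of_int_eq)

lemma trd_coord: "trd (of_int a + of_int b * \<omega>) = b"
  unfolding trd_def trace_delta_coord by simp

lemma nrm_mult: "x \<in> \<O> \<Longrightarrow> y \<in> \<O> \<Longrightarrow> nrm (x * y) = nrm x * nrm y"
  by (subst of_int_eq_iff[where 'a = complex, symmetric]) (simp add: of_int_nrm mult_ac)

lemma nrm_int: "nrm (of_int a) = a * a"
  by (subst of_int_eq_iff[where 'a = complex, symmetric]) (simp add: of_int_nrm)

lemma trd_int_mult: "x \<in> \<O> \<Longrightarrow> trd (of_int a * x) = a * trd x"
  by (subst of_int_eq_iff[where 'a = complex, symmetric]) (simp add: of_int_trd algebra_simps)

lemma trd_of_nat_mult: "x \<in> \<O> \<Longrightarrow> trd (of_nat a * x) = int a * trd x"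
  using trd_int_mult[of x "int a"] by simp

lemma trd_diff: "x \<in> \<O> \<Longrightarrow> y \<in> \<O> \<Longrightarrow> trd (x - y) = trd x - trd y"
  by (subst of_int_eq_iff[where 'a = complex, symmetric]) (simp add: of_int_trd diff_divide_distrib)

lemma dvd_trd: "x \<in> I q \<Longrightarrow> int q dvd trd x"
  by (auto simp: I_def trd_of_nat_mult)

lemma D_eq: "int D = 4 * \<nu> - \<tau> * \<tau>"
proof -
  have d: "\<delta> = of_int 2 * \<omega> - of_int \<tau>"
    using omega_minus_cnj by (simp add: cnj_omega)
  have "\<delta> * \<delta> = 4 * (\<omega> * \<omega>) - 4 * of_int \<tau> * \<omega> + of_int (\<tau> * \<tau>)"
    unfolding d by (simp add: algebra_simps)
  also have "\<dots> = of_int (\<tau> * \<tau> - 4 * \<nu>)" by (simp add: omega_sq algebra_simps)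
  finally have "(of_int (- int D) :: complex) = of_int (\<tau> * \<tau> - 4 * \<nu>)" by (simp add: delta_sq)
  then show ?thesis by (simp only: of_int_eq_iff)
qed

lemma nrm_coord: "nrm (of_int a + of_int b * \<omega>) = a * a + a * b * \<tau> + b * b * \<nu>"
proof -
  have nu: "\<omega> * cnj \<omega> = of_int \<nu>" by (simp add: cnj_omega right_diff_distrib omega_sq mult.commute)
  have tr: "\<omega> + cnj \<omega> = of_int \<tau>" by (simp add: cnj_omega)
  have "(of_int a + of_int b * \<omega>) * cnj (of_int a + of_int b * \<omega>) =
      of_int (a * a) + of_int (a * b) * (\<omega> + cnj \<omega>) + of_int (b * b) * (\<omega> * cnj \<omega>)"
    by (simp add: algebra_simps)
  also have "\<dots> = of_int (a * a + a * b * \<tau> + b * b * \<nu>)" unfolding nu tr by simp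
  finally have "(of_int (nrm (of_int a + of_int b * \<omega>)) :: complex) = of_int (a * a + a * b * \<tau> + b * b * \<nu>)"
    by (subst of_int_nrm) auto
  then show ?thesis by (simp only: of_int_eq_iff)
qed

end

locale inert_quad = imag_quad +
  fixes p :: nat
  assumes p_prime: "prime p"
    and p_inert: "\<And>x y. x \<in> \<O> \<Longrightarrow> y \<in> \<O> \<Longrightarrow> x * y \<in> I p \<Longrightarrow> x \<in> I p \<or> y \<in> I p"
begin

lemma p_pos: "p > 0" using p_prime by (simp add: prime_gt_0_nat)
lemma p_gt_1: "p > 1" using p_prime by (rule prime_gt_1_nat)

lemma one_notin: "1 \<notin> I p"
  using int_in_I[of 1 p] p_gt_1 by simp

lemma int_coprime_p: "\<not> int p dvd a \<Longrightarrow> coprime a (int p)"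
  using p_prime prime_imp_coprime[of "int p" a] by (simp add: coprime_commute)

lemma p_dvd_mult: "int p dvd a * b \<longleftrightarrow> int p dvd a \<or> int p dvd b"
  using p_prime by (simp add: prime_dvd_mult_iff)

lemma mult_in_I: "x \<in> \<O> \<Longrightarrow> y \<in> \<O> \<Longrightarrow> x * y \<in> I p \<longleftrightarrow> x \<in> I p \<or> y \<in> I p"
  using p_inert[of x y] I_mult1[of x y p] I_mult2[of x p y] by blast

text \<open>Inert primes are unramified. If \<open>p\<close> divided \<open>\<delta> = 2\<omega> - \<tau>\<close>, then \<open>p = 2\<close> and \<open>\<tau>\<close> is even; \<open>\<beta> = \<omega> - \<tau>/2\<close> then has
an integral square, so \<open>\<beta>\<^sup>2\<close> or \<open>(\<beta> + 1)\<^sup>2\<close> is divisible by 2 without \<open>\<beta>\<close> or \<open>\<beta> + 1\<close> being so.\<close>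

lemma delta_notin: "\<delta> \<notin> I p"
proof
  assume "\<delta> \<in> I p"
  moreover have "\<delta> = of_int (- \<tau>) + of_int 2 * \<omega>"
    using omega_minus_cnj by (simp add: cnj_omega)
  ultimately have d: "int p dvd \<tau>" "int p dvd 2" using coord_in_I[of "- \<tau>" 2 p] by simp_all
  then have "p dvd 2" by presburger
  then have p2: "p = 2" using p_gt_1 by (simp add: dvd_imp_le le_antisym Suc_leI)
  then obtain h where h: "\<tau> = 2 * h" using d by auto
  define \<beta> where "\<beta> = of_int (- h) + of_int 1 * \<omega>"
  have b: "\<beta> \<in> \<O>" unfolding \<beta>_def by (rule O_coord)
  have sq: "\<beta> * \<beta> = of_int (h * h - \<nu>)"
    by (simp add: \<beta>_def algebra_simps omega_sq h)
  show False
  proof (cases "even (h * h - \<nu>)")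
    case True
    then have "\<beta> * \<beta> \<in> I p" unfolding sq by (simp add: int_in_I p2 del: of_int_diff of_int_mult)
    then have "\<beta> \<in> I p" using b mult_in_I[of \<beta> \<beta>] by simp
    then show False unfolding \<beta>_def coord_in_I p2 by simp
  next
    case False
    have "(\<beta> + 1) * (\<beta> + 1) = of_int (h * h - \<nu> + 1) + of_nat 2 * \<beta>"
      using sq by (simp add: algebra_simps)
    moreover have "of_int (h * h - \<nu> + 1) \<in> I p" using False unfolding int_in_I p2 by simp
    moreover have "of_nat 2 * \<beta> \<in> I p" unfolding p2 using b by (rule I_of_nat)
    ultimately have "(\<beta> + 1) * (\<beta> + 1) \<in> I p" by (simp only: I_add)
    then have "\<beta> + 1 \<in> I p" using mult_in_I[of "\<beta> + 1" "\<beta> + 1"] b by (simp only: O_add O_1 simp_thms)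
    moreover have "\<beta> + 1 = of_int (1 - h) + of_int 1 * \<omega>" by (simp add: \<beta>_def)
    ultimately show False using coord_in_I[of "1 - h" 1 p] p2 by simp
  qed
qed

lemma p_not_dvd_D: "\<not> int p dvd int D"
proof
  assume "int p dvd int D"
  then have "of_int (- int D) \<in> I p" by (subst int_in_I) simp
  then have "\<delta> * \<delta> \<in> I p" by (simp add: delta_sq)
  then show False using mult_in_I[of \<delta> \<delta>] delta_notin by simp
qed

lemma dvd_nrm: "x \<in> \<O> \<Longrightarrow> int p dvd nrm x \<longleftrightarrow> x \<in> I p"
  using int_in_I[of "nrm x" p] mult_in_I[of x "cnj x"] by (simp add: of_int_nrm)

text \<open>The inverse of \<open>x\<close> is its conjugate times an inverse of the integer \<open>x x*\<close>.\<close>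

lemma inverse_mod_p:
  assumes "x \<in> \<O>" "x \<notin> I p"
  obtains y where "y \<in> \<O>" "x * y - 1 \<in> I p"
proof -
  have "coprime (nrm x) (int p)" using assms dvd_nrm int_coprime_p by blast
  then obtain u v where uv: "u * nrm x + v * int p = 1" using bezout_int[of "nrm x" "int p"] by (auto simp: coprime_iff_gcd_eq_1)
  have "x * (of_int u * cnj x) - 1 = of_int (u * nrm x - 1)"
    using of_int_nrm[OF assms(1)] by (simp add: mult_ac)
  also have "u * nrm x - 1 = - v * int p" using uv by simp
  finally have "x * (of_int u * cnj x) - 1 \<in> I p" by (simp only: int_in_I) simp
  then show ?thesis using assms(1) by (intro that[of "of_int u * cnj x"]) auto
qed

text \<open>As \<open>y - y* = b \<delta>\<close> for the \<open>\<omega>\<close>-coordinate \<open>b\<close> and \<open>\<delta>\<close> is a unit modulo \<open>p\<close>, elements of \<open>\<O>/p\<close> fixed by conjugation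
are rational.\<close>

lemma real_mod_p:
  assumes "y \<in> \<O>" "y - cnj y \<in> I p"
  obtains a :: int where "y - of_int a \<in> I p"
proof -
  obtain a b where y: "y = of_int a + of_int b * \<omega>" using assms(1) by (rule O_E)
  then have "y - cnj y = of_int b * \<delta>" by (simp only: cnj_coord) simp
  then have "of_int b \<in> I p" using assms(2) delta_notin mult_in_I[of "of_int b" \<delta>] by auto
  then have "y - of_int a \<in> I p" using y I_mult2[of "of_int b" p \<omega>] O_coord[of 0 1] by simp
  then show ?thesis by (rule that)
qed

definition residues :: "complex set" where
  "residues = (\<lambda>(a, b). of_int a + of_int b * \<omega>) ` ({0..<int p} \<times> {0..<int p})"

lemma inj_coord: "inj_on (\<lambda>(a, b). of_int a + of_int b * \<omega>) A"
  by (auto simp: inj_on_def dest: coord_unique)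

lemma card_residues: "card residues = p * p"
  unfolding residues_def by (subst card_image[OF inj_coord]) simp

lemma finite_residues [simp]: "finite residues"
  unfolding residues_def by simp

lemma residues_O: "x \<in> residues \<Longrightarrow> x \<in> \<O>"
  by (auto simp: residues_def)

lemma residues_unique: "x \<in> residues \<Longrightarrow> y \<in> residues \<Longrightarrow> x - y \<in> I p \<Longrightarrow> x = y"
proof -
  assume "x \<in> residues" "y \<in> residues" and xy: "x - y \<in> I p"
  then obtain a b c d where x: "x = of_int a + of_int b * \<omega>" and y: "y = of_int c + of_int d * \<omega>"
    and r: "0 \<le> a" "a < p" "0 \<le> b" "b < p" "0 \<le> c" "c < p" "0 \<le> d" "d < p"
    by (auto simp: residues_def)
  have "x - y = of_int (a - c) + of_int (b - d) * \<omega>" by (simp add: x y algebra_simps)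
  then have "int p dvd a - c" "int p dvd b - d" using xy coord_in_I[of "a - c" "b - d" p] by simp_all
  then have "a mod int p = c mod int p" "b mod int p = d mod int p" by (simp_all add: mod_eq_dvd_iff)
  then show "x = y" using r by (simp add: x y)
qed

lemma residues_rep:
  assumes "x \<in> \<O>"
  obtains r where "r \<in> residues" "x - r \<in> I p"
proof -
  obtain a b where x: "x = of_int a + of_int b * \<omega>" using assms by (rule O_E)
  let ?r = "of_int (a mod int p) + of_int (b mod int p) * \<omega>"
  have "?r \<in> residues" unfolding residues_def using p_pos by (intro image_eqI[of _ _ "(a mod int p, b mod int p)"]) auto
  moreover have "x - ?r = of_int (a - a mod int p) + of_int (b - b mod int p) * \<omega>"
    by (simp add: x algebra_simps)
  then have "x - ?r \<in> I p" by (simp only: coord_in_I) (simp add: minus_mod_eq_mult_div)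
  ultimately show ?thesis by (rule that)
qed

lemma zero_residues: "0 \<in> residues"
  unfolding residues_def using p_pos by (intro image_eqI[of _ _ "(0, 0)"]) auto

text \<open>A map that is injective modulo \<open>p\<close> permutes the finite set of residues, so substituting it does not change a
count.\<close>

lemma card_residues_transport:
  assumes \<phi>: "\<And>x. x \<in> \<O> \<Longrightarrow> \<phi> x \<in> \<O>"
    and inj: "\<And>x y. x \<in> \<O> \<Longrightarrow> y \<in> \<O> \<Longrightarrow> \<phi> x - \<phi> y \<in> I p \<Longrightarrow> x - y \<in> I p"
    and P: "\<And>x y. x \<in> \<O> \<Longrightarrow> y \<in> \<O> \<Longrightarrow> x - y \<in> I p \<Longrightarrow> P x \<Longrightarrow> P y"
  shows "card {x \<in> residues. P (\<phi> x)} = card {x \<in> residues. P x}"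
proof -
  define red where "red x = (SOME r. r \<in> residues \<and> x - r \<in> I p)" for x
  have red: "red x \<in> residues \<and> x - red x \<in> I p" if "x \<in> \<O>" for x
    unfolding red_def by (rule someI_ex) (use residues_rep[OF that] in blast)
  have inj_red: "inj_on (\<lambda>x. red (\<phi> x)) residues"
  proof (rule inj_onI)
    fix x y assume xy: "x \<in> residues" "y \<in> residues" "red (\<phi> x) = red (\<phi> y)"
    have "\<phi> x - red (\<phi> x) \<in> I p" "\<phi> y - red (\<phi> y) \<in> I p"
      using red[OF \<phi>[OF residues_O[OF xy(1)]]] red[OF \<phi>[OF residues_O[OF xy(2)]]] by (simp_all only: simp_thms)
    then have "(\<phi> x - red (\<phi> x)) - (\<phi> y - red (\<phi> y)) \<in> I p" by (rule I_diff)
    moreover have "(\<phi> x - red (\<phi> x)) - (\<phi> y - red (\<phi> y)) = \<phi> x - \<phi> y" unfolding xy(3) by algebra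
    ultimately have "\<phi> x - \<phi> y \<in> I p" by (simp only:)
    then have "x - y \<in> I p" by (rule inj[OF residues_O[OF xy(1)] residues_O[OF xy(2)]])
    then show "x = y" by (rule residues_unique[OF xy(1,2)])
  qed
  have "(\<lambda>x. red (\<phi> x)) ` residues = residues"
    by (rule endo_inj_surj) (use red \<phi> residues_O inj_red in auto)
  then have bij: "bij_betw (\<lambda>x. red (\<phi> x)) residues residues" using inj_red by (simp add: bij_betw_def)
  have P_red: "P (red (\<phi> x)) \<longleftrightarrow> P (\<phi> x)" if "x \<in> residues" for x
  proof -
    have *: "\<phi> x \<in> \<O>" using \<phi> residues_O that by blast
    then have "\<phi> x - red (\<phi> x) \<in> I p" "red (\<phi> x) \<in> \<O>" using red residues_O by auto
    then show ?thesis using P * I_minus[of "\<phi> x - red (\<phi> x)" p] by (metis minus_diff_eq)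
  qed
  have "bij_betw (\<lambda>x. red (\<phi> x)) {x \<in> residues. P (\<phi> x)} {x \<in> residues. P x}"
  proof (rule bij_betw_subset[OF bij])
    show "(\<lambda>x. red (\<phi> x)) ` {x \<in> residues. P (\<phi> x)} = {x \<in> residues. P x}"
    proof (intro equalityI subsetI)
      fix y assume "y \<in> {x \<in> residues. P x}"
      moreover then obtain x where "x \<in> residues" "y = red (\<phi> x)" using bij by (auto simp: bij_betw_def)
      ultimately show "y \<in> (\<lambda>x. red (\<phi> x)) ` {x \<in> residues. P (\<phi> x)}" using P_red by auto
    qed (use P_red bij in \<open>auto simp: bij_betw_def\<close>)
  qed auto
  then show ?thesis by (rule bij_betw_same_card)
qed

text \<open>Substituting \<open>x := s* x\<close> turns the linear form into \<open>nrm s\<close> times the \<open>\<omega>\<close>-coordinate, which is free to solve.\<close>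

lemma card_trd_linear:
  assumes "s \<in> \<O>" "s \<notin> I p"
  shows "card {x \<in> residues. int p dvd trd (s * x) + m} = p"
proof -
  have ns: "\<not> int p dvd nrm s" using assms dvd_nrm by blast
  have "card {x \<in> residues. int p dvd trd (s * x) + m} = card {x \<in> residues. int p dvd trd (s * (cnj s * x)) + m}"
  proof (rule card_residues_transport[of "\<lambda>x. cnj s * x" "\<lambda>x. int p dvd trd (s * x) + m", symmetric])
    fix x y assume xy: "x \<in> \<O>" "y \<in> \<O>" and "cnj s * x - cnj s * y \<in> I p"
    then have "cnj s * (x - y) \<in> I p" by (simp add: algebra_simps)
    then show "x - y \<in> I p" using xy assms mult_in_I[of "cnj s" "x - y"] by simp
  next
    fix x y assume xy: "x \<in> \<O>" "y \<in> \<O>" "x - y \<in> I p" "int p dvd trd (s * x) + m"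
    have "int p dvd trd (s * (x - y))" using xy assms by (intro dvd_trd) blast
    then have "int p dvd trd (s * x) - trd (s * y)" using xy assms by (simp add: trd_diff right_diff_distrib)
    then have "int p dvd (trd (s * x) + m) - (trd (s * x) - trd (s * y))" using xy(4) by (rule dvd_diff[rotated])
    then show "int p dvd trd (s * y) + m" by (simp add: add.commute)
  qed (use assms in auto)
  also have "{x \<in> residues. int p dvd trd (s * (cnj s * x)) + m} =
      (\<lambda>(a, b). of_int a + of_int b * \<omega>) ` ({0..<int p} \<times> {b \<in> {0..<int p}. int p dvd nrm s * b + m})"
  proof -
    have "trd (s * (cnj s * (of_int a + of_int b * \<omega>))) = nrm s * b" for a b
    proof -
      have "s * (cnj s * (of_int a + of_int b * \<omega>)) = of_int (nrm s) * (of_int a + of_int b * \<omega>)"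
        using assms by (simp add: of_int_nrm mult.assoc)
      then show ?thesis by (simp only: trd_int_mult O_coord trd_coord)
    qed
    then show ?thesis unfolding residues_def by auto
  qed
  also have "card \<dots> = p * card {b \<in> {0..<int p}. int p dvd nrm s * b + m}"
    by (subst card_image[OF inj_coord]) (simp add: card_cartesian_product)
  also have "card {b \<in> {0..<int p}. int p dvd nrm s * b + m} = 1"
  proof -
    have "coprime (nrm s) (int p)" using ns int_coprime_p by blast
    then obtain u v where uv: "u * nrm s + v * int p = 1"
      using bezout_int[of "nrm s" "int p"] by (auto simp: coprime_iff_gcd_eq_1)
    define b0 where "b0 = (- (u * m)) mod int p"
    have "{b \<in> {0..<int p}. int p dvd nrm s * b + m} = {b0}"
    proof (intro equalityI subsetI)
      fix b assume b: "b \<in> {b \<in> {0..<int p}. int p dvd nrm s * b + m}"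
      then have "int p dvd u * (nrm s * b + m) + int p * (v * b)" by simp
      also have "u * (nrm s * b + m) + int p * (v * b) = (u * nrm s + v * int p) * b + u * m" by (simp add: algebra_simps)
      finally have "int p dvd b - (- (u * m))" by (simp add: uv)
      then have "b mod int p = b0" by (simp add: b0_def mod_eq_dvd_iff)
      then show "b \<in> {b0}" using b by simp
    next
      fix b assume "b \<in> {b0}"
      then have b: "b = b0" by simp
      have "int p dvd (- (u * m)) mod int p - (- (u * m))" by (rule mod_eq_dvd_iff[THEN iffD1]) simp
      then have "int p dvd nrm s * (b - (- (u * m)))" unfolding b b0_def by (rule dvd_mult)
      then have "int p dvd nrm s * (b - (- (u * m))) + int p * (v * m)" by simp
      also have "nrm s * (b - (- (u * m))) + int p * (v * m) = nrm s * b + (u * nrm s + v * int p) * m" by (simp add: algebra_simps)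
      finally show "b \<in> {b \<in> {0..<int p}. int p dvd nrm s * b + m}" using p_pos by (simp add: uv b b0_def)
    qed
    then show ?thesis by simp
  qed
  finally show ?thesis by simp
qed

text \<open>Pigeonhole: the \<open>(p+1)/2\<close> squares and the \<open>(p+1)/2\<close> values \<open>c - D b\<^sup>2\<close> cannot be disjoint modulo \<open>p\<close>.\<close>

lemma nrm_surj_odd:
  assumes "odd p"
  shows "\<exists>u b. int p dvd u * u + int D * (b * b) - c"
proof -
  obtain h where h: "p = 2 * h + 1" using assms by (rule oddE)
  have sq: "a = b" if "a \<in> {0..int h}" "b \<in> {0..int h}" "int p dvd a * a - b * b" for a b
  proof -
    have "a * a - b * b = (a - b) * (a + b)" by (simp add: algebra_simps)
    then have "int p dvd a - b \<or> int p dvd a + b" using that p_dvd_mult by metis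
    then show ?thesis
    proof
      assume "int p dvd a - b"
      then have "\<bar>a - b\<bar> < int p \<Longrightarrow> a - b = 0" using dvd_imp_le_int[of "a - b" "int p"] by force
      then show ?thesis using that h by auto
    next
      assume "int p dvd a + b"
      moreover have "a + b < int p" using that h by auto
      ultimately have "\<not> a + b > 0" using zdvd_imp_le[of "int p" "a + b"] by linarith
      then show ?thesis using that by simp
    qed
  qed
  define A where "A = (\<lambda>u. (u * u) mod int p) ` {0..int h}"
  define B where "B = (\<lambda>b. (c - int D * (b * b)) mod int p) ` {0..int h}"
  have "inj_on (\<lambda>u. (u * u) mod int p) {0..int h}"
    by (intro inj_onI sq) (auto simp: mod_eq_dvd_iff)
  then have cA: "card A = h + 1" unfolding A_def by (subst card_image) auto
  have "inj_on (\<lambda>b. (c - int D * (b * b)) mod int p) {0..int h}"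
  proof (intro inj_onI)
    fix a b assume ab: "a \<in> {0..int h}" "b \<in> {0..int h}"
      "(c - int D * (a * a)) mod int p = (c - int D * (b * b)) mod int p"
    then have "int p dvd (c - int D * (a * a)) - (c - int D * (b * b))" by (simp only: mod_eq_dvd_iff)
    then have "int p dvd int D * (b * b - a * a)" by (simp add: algebra_simps)
    then have "int p dvd b * b - a * a" using p_not_dvd_D p_dvd_mult by blast
    then have "b = a" using sq ab by blast
    then show "a = b" by simp
  qed
  then have cB: "card B = h + 1" unfolding B_def by (subst card_image) auto
  have "A \<union> B \<subseteq> {0..<int p}" using p_pos by (auto simp: A_def B_def)
  then have "card (A \<union> B) \<le> p" using card_mono[of "{0..<int p}" "A \<union> B"] by simp
  moreover have "card (A \<union> B) = card A + card B" if "A \<inter> B = {}"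
    using that by (intro card_Un_disjoint) (auto simp: A_def B_def)
  ultimately have "A \<inter> B \<noteq> {}" using cA cB h by force
  then obtain u b where "(u * u) mod int p = (c - int D * (b * b)) mod int p"
    by (auto simp: A_def B_def)
  then have "int p dvd u * u - (c - int D * (b * b))" by (simp only: mod_eq_dvd_iff)
  then show ?thesis by (intro exI[of _ u] exI[of _ b]) (simp add: algebra_simps)
qed

text \<open>For odd \<open>p\<close> complete the square: \<open>4 nrm(a + b\<omega>) = (2a + \<tau>b)\<^sup>2 + D b\<^sup>2\<close>. For \<open>p = 2\<close> the values at 0 and 1 suffice.\<close>

lemma nrm_surj:
  shows "\<exists>x\<in>\<O>. int p dvd nrm x - c"
proof (cases "odd p")
  case True
  then obtain u b where ub: "int p dvd u * u + int D * (b * b) - 4 * c"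
    using nrm_surj_odd by blast
  have "coprime 2 (int p)" using True by (simp add: coprime_commute prime_imp_coprime)
  then obtain r t where rt: "r * 2 + t * int p = 1"
    using bezout_int[of 2 "int p"] by (auto simp: coprime_iff_gcd_eq_1)
  define a where "a = r * (u - \<tau> * b)"
  \<comment> \<open>\<open>r\<close> inverts 2 modulo \<open>p\<close>, so \<open>w\<close> is congruent to \<open>u\<close>; and \<open>w\<^sup>2 + D b\<^sup>2\<close> is 4 times a norm\<close>
  define w where "w = 2 * a + \<tau> * b"
  have "u - w = (r * 2 + t * int p) * (u - \<tau> * b) - 2 * a" by (simp add: rt w_def)
  also have "\<dots> = int p * (t * (u - \<tau> * b))" by (simp add: a_def algebra_simps)
  finally have "int p dvd u - w" by simp
  then have "int p dvd (u - w) * (u + w)" by (rule dvd_mult2)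
  with ub have "int p dvd (u * u + int D * (b * b) - 4 * c) - (u - w) * (u + w)" by (rule dvd_diff)
  also have "(u * u + int D * (b * b) - 4 * c) - (u - w) * (u + w) = 2 * (2 * (nrm (of_int a + of_int b * \<omega>) - c))"
    unfolding D_eq nrm_coord w_def by (simp add: algebra_simps)
  finally have "int p dvd 2 \<or> int p dvd nrm (of_int a + of_int b * \<omega>) - c" using p_dvd_mult by blast
  moreover have "\<not> int p dvd 2" using True p_gt_1 zdvd_imp_le[of "int p" 2] by (cases "p = 2") auto
  ultimately show ?thesis using O_coord by blast
next
  case False
  then have p: "p = 2" using p_prime prime_odd_nat p_gt_1 by force
  show ?thesis
  proof (cases "even c")
    case True
    then show ?thesis using p nrm_int[of 0] by (intro bexI[of _ 0]) auto
  next
    case False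
    then show ?thesis using p nrm_int[of 1] by (intro bexI[of _ 1]) auto
  qed
qed

lemma nrm_cong: "x \<in> \<O> \<Longrightarrow> y \<in> \<O> \<Longrightarrow> x - y \<in> I p \<Longrightarrow> int p dvd nrm x - nrm y"
proof -
  assume *: "x \<in> \<O>" "y \<in> \<O>" "x - y \<in> I p"
  have "of_int (nrm x - nrm y) = (x - y) * cnj x + y * cnj (x - y)"
    using * by (simp add: of_int_nrm algebra_simps)
  also have "\<dots> \<in> I p" using * by (intro I_add I_mult1 I_mult2 I_cnj) auto
  finally show ?thesis by (simp only: int_in_I)
qed

lemma card_nrm_fibre_zero: "card {x \<in> residues. int p dvd nrm x} = 1"
proof -
  have "{x \<in> residues. int p dvd nrm x} = {0}"
  proof (intro equalityI subsetI)
    fix x assume x: "x \<in> {x \<in> residues. int p dvd nrm x}"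
    then have "x - 0 \<in> I p" using dvd_nrm residues_O by auto
    then show "x \<in> {0}" using residues_unique[of x 0] x zero_residues by auto
  qed (use zero_residues in \<open>auto simp: nrm_def\<close>)
  then show ?thesis by simp
qed

text \<open>Multiplication by an element of norm \<open>c\<close> maps the fibre over 1 onto the fibre over \<open>c\<close>. So the \<open>p - 1\<close> nonzero fibres
have equal size, and together they fill the \<open>p\<^sup>2 - 1\<close> nonzero residues.\<close>

lemma card_nrm_fibre:
  assumes c: "\<not> int p dvd c"
  shows "card {x \<in> residues. int p dvd nrm x - c} = p + 1"
proof -
  define F where "F c = {x \<in> residues. int p dvd nrm x - c}" for c
  have same: "card (F c) = card (F 1)" if c: "\<not> int p dvd c" for c
  proof -
    obtain y where y: "y \<in> \<O>" "int p dvd nrm y - c" using nrm_surj by blast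
    have ny: "\<not> int p dvd nrm y"
    proof
      assume "int p dvd nrm y"
      then have "int p dvd nrm y - (nrm y - c)" using y(2) by (rule dvd_diff)
      then show False using c by simp
    qed
    then have yI: "y \<notin> I p" using dvd_nrm y by blast
    have "card (F c) = card {x \<in> residues. int p dvd nrm (y * x) - c}"
      unfolding F_def
    proof (rule card_residues_transport[of "\<lambda>x. y * x" "\<lambda>x. int p dvd nrm x - c", symmetric])
      fix x z assume xz: "x \<in> \<O>" "z \<in> \<O>" and "y * x - y * z \<in> I p"
      then have "y * (x - z) \<in> I p" by (simp add: algebra_simps)
      then show "x - z \<in> I p" using xz y yI mult_in_I[of y "x - z"] by simp
    next
      fix x z assume xz: "x \<in> \<O>" "z \<in> \<O>" "x - z \<in> I p" "int p dvd nrm x - c"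
      then have "int p dvd (nrm x - c) - (nrm x - nrm z)" by (intro dvd_diff[of _ "nrm x - c"] nrm_cong)
      then show "int p dvd nrm z - c" by simp
    qed (use y in auto)
    also have "{x \<in> residues. int p dvd nrm (y * x) - c} = F 1"
      unfolding F_def
    proof (intro Collect_cong conj_cong refl)
      fix x assume "x \<in> residues"
      then have eq: "nrm (y * x) - c = (nrm y - c) + nrm y * (nrm x - 1)"
        using y residues_O nrm_mult by (simp add: algebra_simps)
      have "int p dvd nrm (y * x) - c \<longleftrightarrow> int p dvd nrm y * (nrm x - 1)"
        unfolding eq using y(2) by (rule dvd_add_right_iff)
      then show "int p dvd nrm (y * x) - c \<longleftrightarrow> int p dvd nrm x - 1" using ny p_dvd_mult by simp
    qed
    finally show ?thesis .
  qed
  have "residues = (\<Union>c\<in>{0..<int p}. F c)"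
  proof (intro equalityI subsetI)
    fix x assume "x \<in> residues"
    then have "x \<in> F (nrm x mod int p)" by (auto simp: F_def minus_mod_eq_mult_div)
    then show "x \<in> (\<Union>c\<in>{0..<int p}. F c)" using p_pos by auto
  qed (auto simp: F_def)
  then have "p * p = card (\<Union>c\<in>{0..<int p}. F c)" using card_residues by simp
  also have "\<dots> = (\<Sum>c\<in>{0..<int p}. card (F c))"
  proof (intro card_UN_disjoint ballI impI)
    fix i j assume ij: "i \<in> {0..<int p}" "j \<in> {0..<int p}" "i \<noteq> j"
    show "F i \<inter> F j = {}"
    proof (rule ccontr)
      assume "F i \<inter> F j \<noteq> {}"
      then obtain x where "int p dvd nrm x - i" "int p dvd nrm x - j" by (auto simp: F_def)
      then have "int p dvd (nrm x - j) - (nrm x - i)" by (intro dvd_diff[of _ "nrm x - j"])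
      then have "i mod int p = j mod int p" by (simp add: mod_eq_dvd_iff)
      then show False using ij by simp
    qed
  qed (auto simp: F_def)
  also have "{0..<int p} = insert 0 {1..<int p}" using p_pos by auto
  also have "(\<Sum>c\<in>insert 0 {1..<int p}. card (F c)) = card (F 0) + (\<Sum>c\<in>{1..<int p}. card (F c))"
    by (subst sum.insert) auto
  also have "card (F 0) = 1" using card_nrm_fibre_zero by (simp add: F_def)
  also have "(\<Sum>c\<in>{1..<int p}. card (F c)) = (\<Sum>c\<in>{1..<int p}. card (F 1))"
    by (intro sum.cong refl same) (auto dest: zdvd_imp_le)
  finally have "p * p = 1 + nat (int p - 1) * card (F 1)" by simp
  moreover have "nat (int p - 1) = p - 1" by linarith
  ultimately have "p * p = 1 + (p - 1) * card (F 1)" by (simp only:)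
  moreover have "p * p = 1 + (p - 1) * (p + 1)" using p_gt_1 by (cases p) auto
  ultimately have "(p - 1) * card (F 1) = (p - 1) * (p + 1)" by simp
  moreover have "p - 1 \<noteq> 0" using p_gt_1 by simp
  ultimately have "card (F 1) = p + 1" by (simp only: mult_cancel1 simp_thms)
  then show ?thesis using same[OF c] by (simp add: F_def)
qed

text \<open>Isotropic points of the form with entries \<open>l\<close>, \<open>s/\<delta>\<close>, \<open>m\<close> on the projective line over \<open>\<O>/p\<close>: the residue \<open>x\<close> stands
for the vector \<open>(x, 1)\<close>, and the second summand for \<open>(1, 0)\<close>. If \<open>p\<close> divides \<open>l\<close>, the condition is linear in \<open>x\<close>. Otherwise
multiply it by \<open>D l\<close> and complete the square: it says that \<open>l\<delta>x - s*\<close> has norm \<open>-n\<close> for the determinant \<open>n\<close>.\<close>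

lemma card_isotropic:
  fixes l m :: int
  assumes s: "s \<in> \<O>" and prim: "\<not> (int p dvd l \<and> s \<in> I p \<and> int p dvd m)"
  shows "card {x \<in> residues. int p dvd l * nrm x + trd (s * x) + m} + (if int p dvd l then 1 else 0) =
    (if int p dvd int D * l * m - nrm s then 1 else p + 1)"
proof (cases "int p dvd l")
  case True
  have eq: "int p dvd l * nrm x + trd (s * x) + m \<longleftrightarrow> int p dvd trd (s * x) + m" for x
    using True by (simp add: add.assoc dvd_add_right_iff)
  have n: "int p dvd int D * l * m - nrm s \<longleftrightarrow> s \<in> I p"
    using True s dvd_nrm[OF s] by (simp add: dvd_diff_right_iff)
  show ?thesis
  proof (cases "s \<in> I p")
    case True
    then have m: "\<not> int p dvd m" using prim \<open>int p dvd l\<close> by blast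
    have "int p dvd trd (s * x)" if "x \<in> residues" for x
      using that True residues_O by (intro dvd_trd) blast
    then have "{x \<in> residues. int p dvd trd (s * x) + m} = {}" using m by (auto simp: dvd_add_right_iff)
    then show ?thesis unfolding eq n using True \<open>int p dvd l\<close> by simp
  next
    case False
    then show ?thesis unfolding eq n using card_trd_linear[OF s False] \<open>int p dvd l\<close> by simp
  qed
next
  case False
  define n where "n = int D * l * m - nrm s"
  have lO: "of_int l * \<delta> \<in> \<O>" by auto
  have lI: "of_int l * \<delta> \<notin> I p" using False delta_notin mult_in_I[of "of_int l" \<delta>] int_in_I by auto
  have key: "int D * l * (l * nrm x + trd (s * x) + m) = nrm (of_int l * \<delta> * x - cnj s) + n" if "x \<in> \<O>" for x
  proof -
    have d: "of_nat D = - (\<delta> * \<delta>)" by (simp add: delta_sq)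
    have "(of_int (int D * l * (l * nrm x + trd (s * x) + m)) :: complex) = of_int (nrm (of_int l * \<delta> * x - cnj s) + n)"
      using that s unfolding n_def
      by (simp add: of_int_nrm of_int_trd d field_simps)
    then show ?thesis by (simp only: of_int_eq_iff)
  qed
  have "{x \<in> residues. int p dvd l * nrm x + trd (s * x) + m} = {x \<in> residues. int p dvd nrm (of_int l * \<delta> * x - cnj s) + n}"
  proof (intro Collect_cong conj_cong refl)
    fix x assume "x \<in> residues"
    then show "int p dvd l * nrm x + trd (s * x) + m \<longleftrightarrow> int p dvd nrm (of_int l * \<delta> * x - cnj s) + n"
      using key[of x] False p_not_dvd_D residues_O p_dvd_mult by metis
  qed
  also have "card \<dots> = card {x \<in> residues. int p dvd nrm x + n}"
  proof (rule card_residues_transport[of "\<lambda>x. of_int l * \<delta> * x - cnj s" "\<lambda>x. int p dvd nrm x + n"])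
    fix x z assume xz: "x \<in> \<O>" "z \<in> \<O>" and "of_int l * \<delta> * x - cnj s - (of_int l * \<delta> * z - cnj s) \<in> I p"
    then have "of_int l * \<delta> * (x - z) \<in> I p" by (simp add: algebra_simps)
    then show "x - z \<in> I p" using xz lO lI mult_in_I[of "of_int l * \<delta>" "x - z"] by simp
  next
    fix x z assume xz: "x \<in> \<O>" "z \<in> \<O>" "x - z \<in> I p" "int p dvd nrm x + n"
    then have "int p dvd (nrm x + n) - (nrm x - nrm z)" by (intro dvd_diff[of _ "nrm x + n"] nrm_cong)
    then show "int p dvd nrm z + n" by (simp add: add.commute)
  qed (use s in auto)
  also have "\<dots> = (if int p dvd n then 1 else p + 1)"
  proof (cases "int p dvd n")
    case True
    then show ?thesis using card_nrm_fibre_zero by (simp add: dvd_add_left_iff)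
  next
    case False
    then show ?thesis using card_nrm_fibre[of "- n"] by simp
  qed
  finally show ?thesis using False by (simp add: n_def)
qed

end

section \<open>Block matrices and conjugate transposes\<close>

abbreviation ct :: "complex^'n^'m \<Rightarrow> complex^'m^'n" where
  "ct \<equiv> conj_transpose"

text \<open>Every two by two matrix has this form, so identities reduce to identities between four entries.\<close>

definition m2 :: "complex \<Rightarrow> complex \<Rightarrow> complex \<Rightarrow> complex \<Rightarrow> mat2" where
  "m2 a b c d = vector [vector [a, b], vector [c, d]]"

lemma m2_nth [simp]:
  "m2 a b c d $ 1 $ 1 = a" "m2 a b c d $ 1 $ 2 = b" "m2 a b c d $ 2 $ 1 = c" "m2 a b c d $ 2 $ 2 = d"
  by (simp_all add: m2_def)

lemma m2_eta: "A = m2 (A $ 1 $ 1) (A $ 1 $ 2) (A $ 2 $ 1) (A $ 2 $ 2)"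
  by (simp add: vec_eq_iff forall_2)

lemma m2_cases: obtains a b c d where "A = m2 a b c d"
  using m2_eta by blast

lemma m2_eq_iff [simp]: "m2 a b c d = m2 a' b' c' d' \<longleftrightarrow> a = a' \<and> b = b' \<and> c = c' \<and> d = d'"
  by (auto simp: vec_eq_iff forall_2)

lemma m2_mult: "m2 a b c d ** m2 a' b' c' d' =
    m2 (a * a' + b * c') (a * b' + b * d') (c * a' + d * c') (c * b' + d * d')"
  by (simp add: vec_eq_iff forall_2 matrix_matrix_mult_def sum_2)

lemma m2_add: "m2 a b c d + m2 a' b' c' d' = m2 (a + a') (b + b') (c + c') (d + d')"
  by (simp add: vec_eq_iff forall_2)

lemma m2_diff: "m2 a b c d - m2 a' b' c' d' = m2 (a - a') (b - b') (c - c') (d - d')"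
  by (simp add: vec_eq_iff forall_2)

lemma m2_minus: "- m2 a b c d = m2 (- a) (- b) (- c) (- d)"
  by (simp add: vec_eq_iff forall_2)

lemma m2_ct: "ct (m2 a b c d) = m2 (cnj a) (cnj c) (cnj b) (cnj d)"
  by (simp add: vec_eq_iff forall_2 conj_transpose_def)

lemma m2_scale: "scale_mat x (m2 a b c d) = m2 (x * a) (x * b) (x * c) (x * d)"
  by (simp add: vec_eq_iff forall_2 scale_mat_def)

lemma m2_det: "det (m2 a b c d) = a * d - b * c"
  by (simp add: det_2)

lemma m2_trace: "trace (m2 a b c d) = a + d"
  by (simp add: trace_def sum_2)

lemma m2_mat: "mat x = m2 x 0 0 x"
  by (simp add: vec_eq_iff forall_2 mat_def)

lemma m2_zero: "0 = m2 0 0 0 0"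
  by (simp add: vec_eq_iff forall_2)

lemmas m2_simps = m2_mult m2_add m2_diff m2_minus m2_ct m2_scale m2_det m2_trace

lemma ct_ct [simp]: "ct (ct A) = A"
  by (simp add: conj_transpose_def vec_eq_iff)

lemma ct_mult: "ct (A ** B) = ct B ** ct A"
  by (simp add: conj_transpose_def vec_eq_iff matrix_matrix_mult_def mult.commute)

lemma ct_add: "ct (A + B) = ct A + ct B"
  by (simp add: conj_transpose_def vec_eq_iff)

lemma ct_diff: "ct (A - B) = ct A - ct B"
  by (simp add: conj_transpose_def vec_eq_iff)

lemma ct_zero [simp]: "ct 0 = 0"
  by (simp add: conj_transpose_def vec_eq_iff)

lemma ct_mat [simp]: "ct (mat x) = mat (cnj x)"
  by (simp add: conj_transpose_def mat_def vec_eq_iff)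

lemma ct_scale: "ct (scale_mat c A) = scale_mat (cnj c) (ct A)"
  by (simp add: conj_transpose_def scale_mat_def vec_eq_iff)

lemma scale_mult_left: "scale_mat c A ** B = scale_mat c (A ** B)"
  by (simp add: scale_mat_def vec_eq_iff matrix_matrix_mult_def sum_distrib_left mult.assoc)

lemma scale_mult_right: "A ** scale_mat c B = scale_mat c (A ** B)"
  by (simp add: scale_mat_def vec_eq_iff matrix_matrix_mult_def sum_distrib_left mult_ac)

lemma scale_scale [simp]: "scale_mat a (scale_mat b A) = scale_mat (a * b) A"
  by (simp add: scale_mat_def vec_eq_iff mult.assoc)

lemma scale_1 [simp]: "scale_mat 1 A = A"
  by (simp add: scale_mat_def vec_eq_iff)

lemma scaleR_scale_mat: "c *\<^sub>R A = scale_mat (of_real c) (A :: complex^'a^'b)"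
  by (simp add: scale_mat_def vec_eq_iff scaleR_conv_of_real[where 'a = complex])

lemma scale_mat1: "scale_mat c (mat 1) = mat c"
  by (simp add: scale_mat_def mat_def vec_eq_iff)

lemma mat_mult_left: "mat c ** A = scale_mat c A"
  using scale_mult_left[of c "mat 1" A] by (simp add: scale_mat1)

lemma mat_mult_right: "A ** mat c = scale_mat c A"
  using scale_mult_right[of A c "mat 1"] by (simp add: scale_mat1)

lemma scale_diff: "scale_mat c (A - B) = scale_mat c A - scale_mat c B"
  by (simp add: scale_mat_def vec_eq_iff right_diff_distrib)

lemma mult_diff_left: "(A - B) ** C = A ** C - B ** (C :: complex^'a^'b)"
  by (simp add: vec_eq_iff matrix_matrix_mult_def sum_subtractf left_diff_distrib)

lemma mult_diff_right: "C ** (A - B) = C ** A - C ** (B :: complex^'a^'b)"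
  by (simp add: vec_eq_iff matrix_matrix_mult_def sum_subtractf right_diff_distrib)

lemma mult_add_left: "(A + B) ** C = A ** C + B ** (C :: complex^'a^'b)"
  by (simp add: vec_eq_iff matrix_matrix_mult_def sum.distrib distrib_right)

lemma mult_add_right: "C ** (A + B) = C ** A + C ** (B :: complex^'a^'b)"
  by (simp add: vec_eq_iff matrix_matrix_mult_def sum.distrib distrib_left)

lemma mult_minus_left: "(- A) ** B = - (A ** (B :: complex^'a^'b))"
  by (simp add: vec_eq_iff matrix_matrix_mult_def sum_negf)

lemma mult_minus_right: "A ** (- B) = - (A ** (B :: complex^'a^'b))"
  by (simp add: vec_eq_iff matrix_matrix_mult_def sum_negf)

lemma all_plus: "(\<forall>i::'a + 'b. P i) \<longleftrightarrow> (\<forall>i. P (Inl i)) \<and> (\<forall>i. P (Inr i))"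
  by (metis sum.exhaust)

lemma sum_plus: "(\<Sum>i\<in>(UNIV::('a::finite + 'b::finite) set). f i) = (\<Sum>i\<in>UNIV. f (Inl i)) + (\<Sum>i\<in>UNIV. f (Inr i))"
  using sum.Plus[of "UNIV :: 'a set" "UNIV :: 'b set" f] by (simp add: UNIV_Plus_UNIV comp_def)

lemma block_nth [simp]:
  "block_mat A B C E $ Inl i $ Inl j = A $ i $ j" "block_mat A B C E $ Inl i $ Inr j = B $ i $ j"
  "block_mat A B C E $ Inr i $ Inl j = C $ i $ j" "block_mat A B C E $ Inr i $ Inr j = E $ i $ j"
  by (simp_all add: block_mat_def)

lemma block_sel [simp]:
  "block_A (block_mat A B C E) = A" "block_B (block_mat A B C E) = B"
  "block_C (block_mat A B C E) = C" "block_D (block_mat A B C E) = E"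
  by (simp_all add: block_A_def block_B_def block_C_def block_D_def vec_eq_iff)

lemma block_eta: "g = block_mat (block_A g) (block_B g) (block_C g) (block_D g)"
  by (simp add: vec_eq_iff all_plus block_A_def block_B_def block_C_def block_D_def)

lemma block_cases: obtains A B C E where "g = block_mat A B C E"
  using block_eta by blast

lemma block_eq_iff [simp]: "block_mat A B C E = block_mat A' B' C' E' \<longleftrightarrow> A = A' \<and> B = B' \<and> C = C' \<and> E = E'"
  by (auto simp: vec_eq_iff all_plus)

lemma block_mult: "block_mat A B C E ** block_mat A' B' C' E' =
   block_mat (A ** A' + B ** C') (A ** B' + B ** E') (C ** A' + E ** C') (C ** B' + E ** E')"
  by (simp add: vec_eq_iff all_plus matrix_matrix_mult_def sum_plus)

lemma block_ct: "ct (block_mat A B C E) =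
   block_mat (ct A) (ct C) (ct B) (ct E)"
  by (simp add: vec_eq_iff all_plus conj_transpose_def)

lemma block_scale: "scale_mat c (block_mat A B C E) =
   block_mat (scale_mat c A) (scale_mat c B) (scale_mat c C) (scale_mat c E)"
  by (simp add: vec_eq_iff all_plus scale_mat_def)

lemma block_mat1: "mat x = block_mat (mat x) 0 0 (mat x)"
  by (simp add: vec_eq_iff all_plus mat_def)

text \<open>Unitary similitudes with multiplier \<open>\<mu>\<close>.\<close>

definition sim :: "complex \<Rightarrow> mat4 \<Rightarrow> bool" where
  "sim \<mu> g \<longleftrightarrow> ct g ** J4 ** g = scale_mat \<mu> J4"

lemma sim_mult:
  assumes "sim a g" "sim b h"
  shows "sim (a * b) (g ** h)"
proof -
  have "ct (g ** h) ** J4 ** (g ** h) = ct h ** (ct g ** J4 ** g) ** h"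
    by (simp add: ct_mult matrix_mul_assoc)
  then show ?thesis using assms
    by (simp add: sim_def scale_mult_left scale_mult_right)
qed

lemma sim_block:
  assumes "\<mu> \<in> \<real>"
  shows "sim \<mu> (block_mat A B C E) \<longleftrightarrow>
    ct A ** C = ct C ** A \<and> ct B ** E = ct E ** B \<and>
    ct A ** E - ct C ** B = mat \<mu>"
proof -
  have mu: "cnj \<mu> = \<mu>" using assms by (simp add: Reals_cnj_iff)
  have eq: "ct E ** A - ct B ** C = mat \<mu>"
    if "ct A ** E - ct C ** B = mat \<mu>"
    using arg_cong[OF that, of ct] by (simp add: ct_diff ct_mult mu)
  have s: "scale_mat \<mu> 0 = (0::mat2)" "scale_mat \<mu> (- mat 1) = (- mat \<mu> :: mat2)"
    by (simp_all add: scale_mat_def vec_eq_iff mat_def)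
  have "ct (block_mat A B C E) ** J4 ** block_mat A B C E =
     block_mat (ct C ** A - ct A ** C) (ct C ** B - ct A ** E)
       (ct E ** A - ct B ** C) (ct E ** B - ct B ** E)"
    by (simp add: J4_def block_ct block_mult mult_minus_right mult_minus_left)
  then show ?thesis unfolding sim_def J4_def block_scale s scale_mat1 using eq
    by (auto simp: algebra_simps)
qed

text \<open>The matrix \<open>J\<inverse> g* J\<close>, which for a similitude is the multiplier times the inverse of \<open>g\<close>.\<close>

definition adjJ :: "mat4 \<Rightarrow> mat4" where
  "adjJ g = block_mat (ct (block_D g)) (- ct (block_B g))
      (- ct (block_C g)) (ct (block_A g))"

lemma adjJ_mult:
  assumes "sim \<mu> g" "\<mu> \<in> \<real>"
  shows "adjJ g ** g = mat \<mu>"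
proof -
  obtain A B C E where g: "g = block_mat A B C E" by (rule block_cases)
  have mu: "cnj \<mu> = \<mu>" using assms by (simp add: Reals_cnj_iff)
  have h: "ct A ** C = ct C ** A" "ct B ** E = ct E ** B"
    "ct A ** E - ct C ** B = mat \<mu>"
    using assms sim_block by (simp_all add: g)
  have "ct E ** A - ct B ** C = mat \<mu>"
    using arg_cong[OF h(3), of ct] by (simp add: ct_diff ct_mult mu)
  then show ?thesis using h
    by (simp add: g adjJ_def block_mult mult_minus_left block_mat1[of \<mu>])
qed

lemma mult_adjJ:
  assumes "sim \<mu> g" "\<mu> \<in> \<real>" "\<mu> \<noteq> 0"
  shows "g ** adjJ g = mat \<mu>"
proof -
  have "scale_mat (1 / \<mu>) (adjJ g) ** g = mat 1"
    using adjJ_mult[OF assms(1,2)] assms(3)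
    by (simp add: scale_mult_left) (simp add: scale_mat_def mat_def vec_eq_iff)
  then have "g ** scale_mat (1 / \<mu>) (adjJ g) = mat 1" by (simp add: matrix_left_right_inverse)
  then have "scale_mat \<mu> (g ** scale_mat (1 / \<mu>) (adjJ g)) = scale_mat \<mu> (mat 1)" by simp
  then show ?thesis using assms(3) by (simp add: scale_mult_right scale_mat1)
qed

text \<open>The column relations of a similitude say \<open>adjJ g ** g = \<mu>\<close>; a one-sided inverse is two-sided, which gives these row
relations.\<close>

lemma sim_rows:
  assumes "sim \<mu> (block_mat A B C E)" "\<mu> \<in> \<real>" "\<mu> \<noteq> 0"
  shows "A ** ct B = B ** ct A" "C ** ct E = E ** ct C"
    "A ** ct E - B ** ct C = mat \<mu>"
  using mult_adjJ[OF assms]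
  by (simp_all add: adjJ_def block_mult mult_minus_right block_mat1[of \<mu>] algebra_simps)

lemma sim_adjJ:
  assumes "sim \<mu> g" "\<mu> \<in> \<real>" "\<mu> \<noteq> 0"
  shows "sim \<mu> (adjJ g)"
proof -
  obtain A B C E where g: "g = block_mat A B C E" by (rule block_cases)
  have mu: "cnj \<mu> = \<mu>" using assms by (simp add: Reals_cnj_iff)
  have h: "A ** ct B = B ** ct A" "C ** ct E = E ** ct C"
    "A ** ct E - B ** ct C = mat \<mu>"
    using sim_rows assms unfolding g by blast+
  have "E ** ct A - C ** ct B = mat \<mu>"
    using arg_cong[OF h(3), of ct] by (simp add: ct_diff ct_mult mu)
  moreover have "ct (- X) = - ct X" for X :: mat2
    by (simp add: conj_transpose_def vec_eq_iff)
  ultimately show ?thesis using h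
    by (simp add: g adjJ_def sim_block[OF assms(2)] mult_minus_left mult_minus_right)
qed

lemma sim_scale:
  assumes "sim \<mu> g" "c \<in> \<real>"
  shows "sim (c * c * \<mu>) (scale_mat c g)"
  using assms by (simp add: sim_def ct_scale scale_mult_left scale_mult_right Reals_cnj_iff mult_ac)

section \<open>Similitudes acting on the hermitian half space\<close>

lemma herm_form_congruence:
  fixes A M :: mat2
  shows "herm_form (ct M ** A ** M) v = herm_form A (M *v v)"
proof -
  obtain a b c d where A: "A = m2 a b c d" by (rule m2_cases)
  obtain a' b' c' d' where M: "M = m2 a' b' c' d'" by (rule m2_cases)
  show ?thesis
    by (simp add: A M m2_simps herm_form_def matrix_vector_mult_def sum_2 algebra_simps)
qed

lemma herm_form_scale: "herm_form (scale_mat c A) v = c * herm_form (A::mat2) v"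
  by (simp add: herm_form_def scale_mat_def matrix_vector_mult_def sum_2 algebra_simps)

lemma herm_form_ker: "M *v v = 0 \<Longrightarrow> herm_form (ct P ** M - ct M ** P) v = 0" for M P :: mat2
proof -
  assume *: "M *v v = 0"
  have ct0: "herm_form (X ** M) v = 0" for X :: mat2
    using * by (simp add: herm_form_def matrix_vector_mul_assoc[symmetric])
  have "herm_form (ct M ** P) v = (\<Sum>i\<in>UNIV. cnj ((M *v v) $ i) * (P *v v) $ i)"
  proof -
    obtain a b c d where P: "P = m2 a b c d" by (rule m2_cases)
    obtain a' b' c' d' where M: "M = m2 a' b' c' d'" by (rule m2_cases)
    show ?thesis
      by (simp add: P M m2_simps herm_form_def matrix_vector_mult_def sum_2 algebra_simps)
  qed
  also have "\<dots> = 0" using * by simp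
  finally have ct1: "herm_form (ct M ** P) v = 0" .
  have "herm_form (X - Y) v = herm_form X v - herm_form Y v" for X Y :: mat2
    by (simp add: herm_form_def matrix_vector_mult_def sum_2 algebra_simps)
  then show ?thesis using ct0 ct1 by simp
qed

text \<open>Evaluate the form of \<open>J\<close> on the columns of \<open>(Z; 1)\<close> before and after applying \<open>g\<close>. From this follow both the invertibility of
\<open>CZ + E\<close> and the positivity of the imaginary part of \<open>gZ\<close>.\<close>

lemma sim_numerator:
  assumes "sim (of_real \<mu>) g"
  shows "ct (automorphy g Z) ** (block_A g ** Z + block_B g)
      - ct (block_A g ** Z + block_B g) ** automorphy g Z = scale_mat (of_real \<mu>) (Z - ct Z)"
proof -
  obtain A B C E where g: "g = block_mat A B C E" by (rule block_cases)
  have h: "ct A ** C = ct C ** A" "ct B ** E = ct E ** B"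
    "ct A ** E - ct C ** B = mat (of_real \<mu>)"
    using assms sim_block[of "of_real \<mu>"] by (simp_all add: g)
  have h4: "ct E ** A - ct B ** C = mat (of_real \<mu>)"
    using arg_cong[OF h(3), of ct] by (simp add: ct_diff ct_mult)
  have "ct (C ** Z + E) ** (A ** Z + B) - ct (A ** Z + B) ** (C ** Z + E) =
     ct Z ** (ct C ** A - ct A ** C) ** Z
     - ct Z ** (ct A ** E - ct C ** B)
     + (ct E ** A - ct B ** C) ** Z + (ct E ** B - ct B ** E)"
    by (simp add: ct_add ct_mult mult_add_left mult_add_right mult_diff_left mult_diff_right matrix_mul_assoc algebra_simps)
  also have "\<dots> = scale_mat (of_real \<mu>) (Z - ct Z)"
    using h h4 by (simp add: mat_mult_left mat_mult_right scale_diff)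
  finally show ?thesis by (simp add: g automorphy_def)
qed

text \<open>A kernel vector of \<open>CZ + E\<close> would make the imaginary part of \<open>Z\<close> vanish on it.\<close>

lemma automorphy_invertible:
  assumes "sim (of_real \<mu>) g" "\<mu> > 0" "Z \<in> H2"
  shows "invertible (automorphy g Z)"
proof -
  have "v = 0" if v: "automorphy g Z *v v = 0" for v
  proof (rule ccontr)
    assume "v \<noteq> 0"
    then have pos: "0 < Re (herm_form (scale_mat (- \<i>) (Z - ct Z)) v)"
      using assms(3) by (simp add: H2_def pos_def_hermitian_def)
    let ?P = "block_A g ** Z + block_B g" and ?M = "automorphy g Z"
    have "herm_form (ct ?P ** ?M - ct ?M ** ?P) v = 0"
      using v by (rule herm_form_ker)
    moreover have "ct ?P ** ?M - ct ?M ** ?P = scale_mat (- of_real \<mu>) (Z - ct Z)"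
      using sim_numerator[OF assms(1), of Z] by (simp add: scale_mat_def vec_eq_iff algebra_simps)
    ultimately have "herm_form (Z - ct Z) v = 0" using assms(2) by (simp add: herm_form_scale)
    then show False using pos by (simp add: herm_form_scale)
  qed
  then have "\<exists>B. B ** automorphy g Z = mat 1" by (simp add: matrix_left_invertible_ker)
  then show ?thesis by (auto simp: invertible_def matrix_left_right_inverse)
qed

lemma matrix_inv_eqs:
  assumes "invertible (M::mat2)"
  shows "M ** matrix_inv M = mat 1" "matrix_inv M ** M = mat 1"
  using someI_ex[of "\<lambda>A'. M ** A' = mat 1 \<and> A' ** M = mat 1"] assms
  unfolding invertible_def matrix_inv_def by blast+

lemma moebius_mult_automorphy:
  assumes "invertible (automorphy g Z)"
  shows "moebius g Z ** automorphy g Z = block_A g ** Z + block_B g"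
  by (simp add: moebius_def matrix_inv_eqs[OF assms] flip: matrix_mul_assoc)

lemma moebius_eqI:
  assumes "invertible (automorphy g Z)" "W ** automorphy g Z = block_A g ** Z + block_B g"
  shows "moebius g Z = W"
  unfolding moebius_def assms(2)[symmetric]
  by (simp add: matrix_inv_eqs[OF assms(1)] flip: matrix_mul_assoc)

lemma moebius_in_H2:
  assumes "sim (of_real \<mu>) g" "\<mu> > 0" "Z \<in> H2"
  shows "moebius g Z \<in> H2"
proof -
  define M where "M = automorphy g Z"
  define N where "N = matrix_inv M"
  define W where "W = moebius g Z"
  have inv: "invertible M" unfolding M_def by (rule automorphy_invertible[OF assms])
  have WM: "W ** M = block_A g ** Z + block_B g"
    unfolding W_def M_def by (rule moebius_mult_automorphy) (use inv M_def in simp)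
  have MN: "M ** N = mat 1" "N ** M = mat 1" using matrix_inv_eqs[OF inv] by (simp_all add: N_def)
  have "ct M ** (W - ct W) ** M = scale_mat (of_real \<mu>) (Z - ct Z)"
    using sim_numerator[OF assms(1), of Z] unfolding M_def[symmetric] WM[symmetric]
    by (simp add: ct_mult mult_diff_left mult_diff_right matrix_mul_assoc)
  then have "ct N ** (ct M ** (W - ct W) ** M) ** N =
      ct N ** scale_mat (of_real \<mu>) (Z - ct Z) ** N" by simp
  also have "ct N ** (ct M ** (W - ct W) ** M) ** N =
      ct (M ** N) ** (W - ct W) ** (M ** N)"
    by (simp add: ct_mult matrix_mul_assoc)
  finally have eq: "W - ct W = scale_mat (of_real \<mu>) (ct N ** (Z - ct Z) ** N)"
    by (simp add: MN scale_mult_left scale_mult_right)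
  have herm: "ct (scale_mat (- \<i>) (X - ct X)) = scale_mat (- \<i>) (X - ct X)" for X :: mat2
    by (simp add: conj_transpose_def scale_mat_def vec_eq_iff algebra_simps)
  have "0 < Re (herm_form (scale_mat (- \<i>) (W - ct W)) v)" if "v \<noteq> 0" for v
  proof -
    have "N *v v \<noteq> 0"
    proof
      assume "N *v v = 0"
      then have "M *v (N *v v) = 0" by simp
      then show False using that MN by (simp add: matrix_vector_mul_assoc)
    qed
    then have "0 < Re (herm_form (scale_mat (- \<i>) (Z - ct Z)) (N *v v))"
      using assms(3) by (simp add: H2_def pos_def_hermitian_def)
    then have "0 < \<mu> * Re (herm_form (scale_mat (- \<i>) (Z - ct Z)) (N *v v))" using assms(2) by simp
    also have "\<dots> = Re (of_real \<mu> * herm_form (scale_mat (- \<i>) (Z - ct Z)) (N *v v))" by simp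
    also have "of_real \<mu> * herm_form (scale_mat (- \<i>) (Z - ct Z)) (N *v v) =
        herm_form (scale_mat (- \<i>) (W - ct W)) v"
      unfolding eq by (simp add: herm_form_scale herm_form_congruence)
    finally show ?thesis .
  qed
  then show ?thesis using herm by (simp add: H2_def pos_def_hermitian_def W_def)
qed

lemma automorphy_cocycle:
  assumes "invertible (automorphy h Z)"
  shows "automorphy (g ** h) Z = automorphy g (moebius h Z) ** automorphy h Z"
    and "block_A (g ** h) ** Z + block_B (g ** h) =
      (block_A g ** moebius h Z + block_B g) ** automorphy h Z"
proof -
  obtain A B C E where g: "g = block_mat A B C E" by (rule block_cases)
  obtain A' B' C' E' where h: "h = block_mat A' B' C' E'" by (rule block_cases)
  have "(X ** moebius h Z + Y) ** automorphy h Z = X ** (A' ** Z + B') + Y ** (C' ** Z + E')" for X Y :: mat2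
    using moebius_mult_automorphy[OF assms]
    by (simp add: mult_add_left automorphy_def h flip: matrix_mul_assoc)
  then show "automorphy (g ** h) Z = automorphy g (moebius h Z) ** automorphy h Z"
    "block_A (g ** h) ** Z + block_B (g ** h) = (block_A g ** moebius h Z + block_B g) ** automorphy h Z"
    by (simp_all add: g h automorphy_def[of "block_mat _ _ _ _ "] block_mult mult_add_left mult_add_right matrix_mul_assoc add_ac)
qed

lemma slash_slash:
  assumes g: "sim (of_real \<mu>) g" "\<mu> > 0" and h: "sim (of_real \<nu>) h" "\<nu> > 0" and Z: "Z \<in> H2"
  shows "slash k F (g ** h) Z = slash k (slash k F g) h Z"
proof -
  have ih: "invertible (automorphy h Z)" using automorphy_invertible h Z by blast
  have hZ: "moebius h Z \<in> H2" using moebius_in_H2 h Z by blast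
  then have ig: "invertible (automorphy g (moebius h Z))" using automorphy_invertible g by blast
  have igh: "invertible (automorphy (g ** h) Z)"
    unfolding automorphy_cocycle[OF ih] using ig ih by (rule invertible_mult)
  have "moebius (g ** h) Z = moebius g (moebius h Z)"
  proof (rule moebius_eqI[OF igh])
    show "moebius g (moebius h Z) ** automorphy (g ** h) Z = block_A (g ** h) ** Z + block_B (g ** h)"
      unfolding automorphy_cocycle[OF ih] matrix_mul_assoc moebius_mult_automorphy[OF ig] ..
  qed
  then show ?thesis
    by (simp add: slash_def automorphy_cocycle[OF ih] det_mul power_int_mult_distrib mult_ac)
qed

lemma Re_herm_form_m2:
  "Re (herm_form (m2 (of_real a) b (cnj b) (of_real d)) v) =
    a * (cmod (v $ 1))\<^sup>2 + d * (cmod (v $ 2))\<^sup>2 + 2 * Re (cnj (v $ 1) * b * v $ 2)"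
  unfolding cmod_power2 unfolding power2_eq_square
  by (simp add: herm_form_def matrix_vector_mult_def sum_2 algebra_simps)

lemma Re_herm_form_complete_square:
  "a * Re (herm_form (m2 (of_real a) b (cnj b) (of_real d)) v) =
    (cmod (of_real a * v $ 1 + b * v $ 2))\<^sup>2 + (a * d - (cmod b)\<^sup>2) * (cmod (v $ 2))\<^sup>2"
  unfolding Re_herm_form_m2 cmod_power2 unfolding power2_eq_square by (simp add: algebra_simps)

text \<open>Sylvester's criterion, in the form that makes openness of the half space evident.\<close>

lemma pos_def_iff:
  "pos_def_hermitian (m2 (of_real a) b (cnj b) (of_real d)) \<longleftrightarrow> 0 < a \<and> 0 < a * d - (cmod b)\<^sup>2"
proof
  assume *: "pos_def_hermitian (m2 (of_real a) b (cnj b) (of_real d))"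
  define Y where "Y = m2 (of_real a) b (cnj b) (of_real d)"
  have pos: "v \<noteq> 0 \<Longrightarrow> 0 < Re (herm_form Y v)" for v using * by (simp add: pos_def_hermitian_def Y_def)
  have "(vector [1, 0] :: complex^2) \<noteq> 0" by (simp add: vec_eq_iff forall_2)
  from pos[OF this] have a: "0 < a" by (simp add: Y_def Re_herm_form_m2)
  have "(vector [- b, of_real a] :: complex^2) \<noteq> 0" using a by (simp add: vec_eq_iff forall_2)
  from pos[OF this] have "0 < a * Re (herm_form Y (vector [- b, of_real a]))" using a by simp
  also have "\<dots> = (a * d - (cmod b)\<^sup>2) * (a\<^sup>2)"
    unfolding Y_def Re_herm_form_complete_square by simp
  finally show "0 < a \<and> 0 < a * d - (cmod b)\<^sup>2" using a by (simp add: zero_less_mult_iff)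
next
  assume *: "0 < a \<and> 0 < a * d - (cmod b)\<^sup>2"
  show "pos_def_hermitian (m2 (of_real a) b (cnj b) (of_real d))"
    unfolding pos_def_hermitian_def
  proof (intro conjI allI impI)
    fix v :: "complex^2" assume v: "v \<noteq> 0"
    have "0 < (cmod (of_real a * v $ 1 + b * v $ 2))\<^sup>2 + (a * d - (cmod b)\<^sup>2) * (cmod (v $ 2))\<^sup>2"
    proof (cases "v $ 2 = 0")
      case True
      then have "v $ 1 \<noteq> 0" using v by (auto simp: vec_eq_iff forall_2)
      then show ?thesis using True * by simp
    next
      case False
      then have "0 < (a * d - (cmod b)\<^sup>2) * (cmod (v $ 2))\<^sup>2" using * by simp
      then show ?thesis by (simp add: add_nonneg_pos)
    qed
    then have "0 < a * Re (herm_form (m2 (of_real a) b (cnj b) (of_real d)) v)"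
      by (simp only: Re_herm_form_complete_square)
    then show "0 < Re (herm_form (m2 (of_real a) b (cnj b) (of_real d)) v)" using * by (simp add: zero_less_mult_iff)
  qed (simp add: m2_ct)
qed

lemma H2_iff:
  "Z \<in> H2 \<longleftrightarrow> 0 < 2 * Im (Z $ 1 $ 1) \<and>
     0 < 2 * Im (Z $ 1 $ 1) * (2 * Im (Z $ 2 $ 2)) - (cmod (Z $ 1 $ 2 - cnj (Z $ 2 $ 1)))\<^sup>2"
proof -
  obtain a b c d where Z: "Z = m2 a b c d" by (rule m2_cases)
  have "scale_mat (- \<i>) (Z - ct Z) =
     m2 (of_real (2 * Im a)) (- \<i> * (b - cnj c)) (cnj (- \<i> * (b - cnj c))) (of_real (2 * Im d))"
    unfolding Z by (simp add: m2_simps) (simp add: complex_eq_iff)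
  then have "Z \<in> H2 \<longleftrightarrow> pos_def_hermitian (m2 (of_real (2 * Im a)) (- \<i> * (b - cnj c)) (cnj (- \<i> * (b - cnj c))) (of_real (2 * Im d)))"
    by (simp add: H2_def)
  then show ?thesis unfolding pos_def_iff by (simp add: Z norm_mult)
qed

lemma open_H2: "open H2"
proof -
  have eq: "H2 = {Z. 0 < 2 * Im (Z $ 1 $ 1)} \<inter>
     {Z. 0 < 2 * Im (Z $ 1 $ 1) * (2 * Im (Z $ 2 $ 2)) - (cmod (Z $ 1 $ 2 - cnj (Z $ 2 $ 1)))\<^sup>2}"
    using H2_iff by auto
  show ?thesis
    by (subst eq) (intro open_Int open_Collect_less continuous_intros)
qed

text \<open>For vanishing lower left block the automorphy factor is constant and the action is affine in \<open>Z\<close>.\<close>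

lemma holomorphic_slash_upper:
  assumes F: "holomorphic_on_H2 F" and r: "sim (of_real \<mu>) r" "\<mu> > 0" "block_C r = 0"
  shows "holomorphic_on_H2 (slash k F r)"
  unfolding holomorphic_on_H2_def
proof
  fix Z :: mat2 assume Z: "Z \<in> H2"
  define E where "E = matrix_inv (block_D r)"
  have aut: "automorphy r W = block_D r" for W by (simp add: automorphy_def r(3))
  define M where "M W = block_A r ** W ** E" for W :: mat2
  have moe: "moebius r W = M W + block_B r ** E" for W
    by (simp add: moebius_def aut M_def E_def mult_add_left)
  have "linear M"
    by (intro linearI)
      (auto simp: M_def mult_add_left mult_add_right scaleR_scale_mat scale_mult_left scale_mult_right)
  then have M: "bounded_linear M" by (simp add: linear_conv_bounded_linear)
  have "moebius r Z \<in> H2" by (rule moebius_in_H2[OF r(1,2) Z])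
  then obtain L where L: "(F has_derivative L) (at (moebius r Z))" and cl: "\<And>c W. L (scale_mat c W) = c * L W"
    using F unfolding holomorphic_on_H2_def by blast
  have "(moebius r has_derivative M) (at Z)"
  proof -
    have "moebius r = (\<lambda>W. M W + block_B r ** E)" using moe by (rule ext)
    moreover have "((\<lambda>W. M W + block_B r ** E) has_derivative (\<lambda>W. M W + 0)) (at Z)"
      by (intro has_derivative_add bounded_linear_imp_has_derivative[OF M] has_derivative_const)
    ultimately show ?thesis by simp
  qed
  then have "((\<lambda>W. F (moebius r W)) has_derivative (\<lambda>W. L (M W))) (at Z)"
    by (rule has_derivative_compose[where g = F]) (rule L)
  then have "((\<lambda>W. det (block_D r) powi (- k) * F (moebius r W)) has_derivative
      (\<lambda>W. det (block_D r) powi (- k) * L (M W))) (at Z)"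
    by (rule has_derivative_mult_right)
  moreover have "slash k F r = (\<lambda>W. det (block_D r) powi (- k) * F (moebius r W))"
    by (simp add: slash_def aut fun_eq_iff)
  moreover have "M (scale_mat c W) = scale_mat c (M W)" for c W
    by (simp add: M_def scale_mult_left scale_mult_right)
  ultimately show "\<exists>L. (slash k F r has_derivative L) (at Z) \<and> (\<forall>c W. L (scale_mat c W) = c * L W)"
    using cl by (intro exI[of _ "\<lambda>W. det (block_D r) powi (- k) * L (M W)"]) (auto simp: mult_ac)
qed

section \<open>Left cosets in the Hecke double coset\<close>

context imag_quad
begin

definition int_mat :: "mat2 \<Rightarrow> bool" where "int_mat A \<longleftrightarrow> (\<forall>i j. A $ i $ j \<in> \<O>)"
definition dvd_mat :: "nat \<Rightarrow> mat2 \<Rightarrow> bool" where "dvd_mat q A \<longleftrightarrow> (\<forall>i j. A $ i $ j \<in> I q)"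

lemma int_mat_m2 [simp]: "int_mat (m2 a b c d) \<longleftrightarrow> a \<in> \<O> \<and> b \<in> \<O> \<and> c \<in> \<O> \<and> d \<in> \<O>"
  by (auto simp: int_mat_def forall_2)

lemma dvd_mat_m2 [simp]: "dvd_mat q (m2 a b c d) \<longleftrightarrow> a \<in> I q \<and> b \<in> I q \<and> c \<in> I q \<and> d \<in> I q"
  by (auto simp: dvd_mat_def forall_2)

lemma dvd_mat_int_mat: "dvd_mat q A \<Longrightarrow> int_mat A"
  unfolding int_mat_def dvd_mat_def using I_subset by blast

lemma dvd_mat_add [intro]: "dvd_mat q A \<Longrightarrow> dvd_mat q B \<Longrightarrow> dvd_mat q (A + B)"
  by (auto simp: dvd_mat_def)
lemma dvd_mat_diff [intro]: "dvd_mat q A \<Longrightarrow> dvd_mat q B \<Longrightarrow> dvd_mat q (A - B)"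
  by (auto simp: dvd_mat_def)
lemma dvd_mat_minus [intro]: "dvd_mat q A \<Longrightarrow> dvd_mat q (- A)"
  by (auto simp: dvd_mat_def)
lemma dvd_mat_ct [intro]: "dvd_mat q A \<Longrightarrow> dvd_mat q (ct A)"
  by (simp add: dvd_mat_def conj_transpose_def)
lemma dvd_mat_mult1 [intro]: "int_mat A \<Longrightarrow> dvd_mat q B \<Longrightarrow> dvd_mat q (A ** B)"
  by (simp add: dvd_mat_def int_mat_def matrix_matrix_mult_def sum_2 I_add I_mult1)
lemma dvd_mat_mult2 [intro]: "dvd_mat q A \<Longrightarrow> int_mat B \<Longrightarrow> dvd_mat q (A ** B)"
  by (simp add: dvd_mat_def int_mat_def matrix_matrix_mult_def sum_2 I_add I_mult2)
lemma dvd_mat_zero [intro, simp]: "dvd_mat q 0"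
  by (simp add: dvd_mat_def)
lemma int_mat_add [intro]: "int_mat A \<Longrightarrow> int_mat B \<Longrightarrow> int_mat (A + B)"
  by (auto simp: int_mat_def)
lemma int_mat_diff [intro]: "int_mat A \<Longrightarrow> int_mat B \<Longrightarrow> int_mat (A - B)"
  by (auto simp: int_mat_def)
lemma int_mat_minus [intro]: "int_mat A \<Longrightarrow> int_mat (- A)"
  by (auto simp: int_mat_def)
lemma int_mat_ct [intro]: "int_mat A \<Longrightarrow> int_mat (ct A)"
  by (auto simp: int_mat_def conj_transpose_def)
lemma int_mat_mult [intro]: "int_mat A \<Longrightarrow> int_mat B \<Longrightarrow> int_mat (A ** B)"
  by (auto simp: int_mat_def matrix_matrix_mult_def sum_2)
lemma int_mat_zero [intro, simp]: "int_mat 0"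
  by (simp add: int_mat_def)
lemma int_mat_mat [intro, simp]: "x \<in> \<O> \<Longrightarrow> int_mat (mat x)"
  by (simp add: int_mat_def mat_def)
lemma dvd_mat_scale: "int_mat A \<Longrightarrow> dvd_mat q (scale_mat (of_nat q) A)"
  by (simp add: dvd_mat_def int_mat_def scale_mat_def)
lemma dvd_mat_scaleE:
  assumes "dvd_mat q A" "q > 0" shows "int_mat (scale_mat (1 / of_nat q) A)"
proof -
  have "1 / of_nat q * x \<in> \<O>" if "x \<in> I q" for x
    using that assms(2) by (auto simp: I_def)
  then show ?thesis using assms(1) by (simp add: dvd_mat_def int_mat_def scale_mat_def)
qed

text \<open>The congruence subgroup in block form. Integrality of the inverse is automatic, since \<open>adjJ\<close> is the inverse.\<close>

definition GammaN :: "nat \<Rightarrow> mat4 set" where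
  "GammaN N = {g. int_mat (block_A g) \<and> int_mat (block_B g) \<and> dvd_mat N (block_C g) \<and> int_mat (block_D g) \<and> sim 1 g}"

lemma GammaN_block: "block_mat A B C E \<in> GammaN N \<longleftrightarrow> int_mat A \<and> int_mat B \<and> dvd_mat N C \<and> int_mat E \<and> sim 1 (block_mat A B C E)"
  by (simp add: GammaN_def)

lemma GammaN_mult:
  assumes "g \<in> GammaN N" "h \<in> GammaN N"
  shows "g ** h \<in> GammaN N"
proof -
  obtain A B C E where g: "g = block_mat A B C E" by (rule block_cases)
  obtain A' B' C' E' where h: "h = block_mat A' B' C' E'" by (rule block_cases)
  have "sim (1 * 1) (g ** h)" by (rule sim_mult) (use assms in \<open>auto simp: GammaN_def\<close>)
  moreover have O: "int_mat A" "int_mat B" "dvd_mat N C" "int_mat E" "int_mat A'" "int_mat B'" "dvd_mat N C'" "int_mat E'" "int_mat C" "int_mat C'"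
    using assms dvd_mat_int_mat by (auto simp: g h GammaN_block)
  moreover have "dvd_mat N (C ** A' + E ** C')" using O by (intro dvd_mat_add dvd_mat_mult2[of N C A'] dvd_mat_mult1[of E N C'])
  moreover have "int_mat (A ** A' + B ** C')" "int_mat (A ** B' + B ** E')" "int_mat (C ** B' + E ** E')"
    using O by (simp_all add: int_mat_add int_mat_mult)
  ultimately show ?thesis unfolding g h block_mult GammaN_block by simp
qed

lemma GammaN_adjJ:
  assumes "g \<in> GammaN N"
  shows "adjJ g \<in> GammaN N" "adjJ g ** g = mat 1" "g ** adjJ g = mat 1"
proof -
  obtain A B C E where g: "g = block_mat A B C E" by (rule block_cases)
  have s: "sim 1 g" using assms by (simp add: GammaN_def)
  show "adjJ g ** g = mat 1" "g ** adjJ g = mat 1" using adjJ_mult[OF s] mult_adjJ[OF s] by auto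
  show "adjJ g \<in> GammaN N"
    using assms sim_adjJ[OF s] by (auto simp: g adjJ_def GammaN_block)
qed

lemma GammaN_one: "mat 1 \<in> GammaN N"
  by (simp add: GammaN_def block_mat1[of 1]) (simp add: sim_block)

end

text \<open>The level is prime to \<open>p\<close>. This puts all representatives into the double coset, and it lets every power of \<open>p\<close>
dividing the content occur in the Maass relation.\<close>

locale hecke_setup = inert_quad +
  fixes N :: nat
  assumes p_ndvd_N: "\<not> p dvd N"
begin

definition hecke_mat :: mat4 where "hecke_mat = block_mat (mat 1) 0 0 (mat (of_nat p))"

text \<open>For a point of the projective line over \<open>\<O>/p\<close>, a matrix of determinant 1 over \<open>\<O>\<close> whose lower row is a vector on that
line: \<open>(x, 1)\<close> for \<open>Some x\<close> and \<open>(1, 0)\<close> for \<open>None\<close>.\<close>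

definition Uo :: "complex option \<Rightarrow> mat2" where
  "Uo u = (case u of None \<Rightarrow> m2 0 (-1) 1 0 | Some x \<Rightarrow> m2 1 0 x 1)"

text \<open>The inverse conjugate transpose of \<open>Uo u\<close>, so that \<open>diag(Uc u, Uo u)\<close> is unitary.\<close>

definition Uc :: "complex option \<Rightarrow> mat2" where
  "Uc u = (case u of None \<Rightarrow> m2 0 (-1) 1 0 | Some x \<Rightarrow> m2 1 (- cnj x) 0 1)"

definition lines :: "complex option set" where "lines = insert None (Some ` residues)"

text \<open>One representative in each class of integral hermitian matrices modulo \<open>p\<close>.\<close>

definition Herm :: "mat2 set" where
  "Herm = (\<lambda>((a, c), x). m2 (of_int a) x (cnj x) (of_int c)) ` (({0..<int p} \<times> {0..<int p}) \<times> residues)"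

definition rep_idx :: "(mat2 + complex option \<times> int + unit) set" where
  "rep_idx = Herm <+> (lines \<times> {0..<int p}) <+> {()}"

text \<open>The three families are indexed by the rank 2, 1, 0 of the upper left block modulo \<open>p\<close> of the corresponding element of
the group. In the middle one the point of the projective line is, up to conjugation, the kernel of that block.\<close>

fun coset_rep :: "mat2 + complex option \<times> int + unit \<Rightarrow> mat4" where
  "coset_rep (Inl S) = block_mat (mat 1) S 0 (mat (of_nat p))"
| "coset_rep (Inr (Inl (u, b))) = block_mat (m2 1 0 0 (of_nat p) ** Uc u) (m2 (of_int b) 0 0 0 ** Uo u) 0 (m2 (of_nat p) 0 0 1 ** Uo u)"
| "coset_rep (Inr (Inr _)) = block_mat (mat (of_nat p)) 0 0 (mat 1)"

lemma finite_rep_idx: "finite rep_idx"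
  by (auto simp: rep_idx_def Herm_def lines_def)

lemma Uo_Uc: "ct (Uo u) ** Uc u = mat 1" "ct (Uc u) ** Uo u = mat 1"
    "Uc u ** ct (Uo u) = mat 1" "Uo u ** ct (Uc u) = mat 1"
  by (cases u; simp add: Uo_def Uc_def m2_simps m2_mat[of 1])+

lemma Uo_O: "u \<in> lines \<Longrightarrow> int_mat (Uo u)" and Uc_O: "u \<in> lines \<Longrightarrow> int_mat (Uc u)"
  by (auto simp: lines_def Uo_def Uc_def residues_O)

lemma mU_GammaN: "u \<in> lines \<Longrightarrow> block_mat (Uc u) 0 0 (Uo u) \<in> GammaN N"
  using Uo_O[of u] Uc_O[of u] by (simp add: GammaN_block sim_block Uo_Uc)

definition hrep :: "mat4 \<Rightarrow> bool" where
  "hrep r \<longleftrightarrow> int_mat (block_A r) \<and> int_mat (block_B r) \<and> block_C r = 0 \<and> int_mat (block_D r) \<and> sim (of_nat p) r"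

lemma sim_hecke_mat: "sim (of_nat p) hecke_mat"
  by (simp add: hecke_mat_def sim_block)

lemma hrep_rep:
  assumes "i \<in> rep_idx"
  shows "hrep (coset_rep i)"
proof -
  consider S where "i = Inl S" "S \<in> Herm" | u b where "i = Inr (Inl (u, b))" "u \<in> lines" | "i = Inr (Inr ())"
    using assms by (auto simp: rep_idx_def)
  then show ?thesis
  proof cases
    case 1
    then show ?thesis by (auto simp: hrep_def sim_block Herm_def m2_simps m2_mat residues_O)
  next
    case 2
    let ?A = "m2 1 0 0 (of_nat p)" and ?B = "m2 (of_int b) 0 0 0" and ?E = "m2 (of_nat p) 0 0 1"
    have "?A ** Uc u = ?A ** Uc u" by simp
    have "sim (of_nat p) (block_mat ?A ?B 0 ?E)"
      by (simp add: sim_block m2_simps m2_mat)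
    then have "sim (of_nat p * 1) (block_mat ?A ?B 0 ?E ** block_mat (Uc u) 0 0 (Uo u))"
      by (rule sim_mult) (use mU_GammaN[OF 2(2)] in \<open>simp add: GammaN_def\<close>)
    then show ?thesis using 2 Uo_O[of u] Uc_O[of u] by (auto simp: hrep_def block_mult intro!: int_mat_mult)
  next
    case 3
    then show ?thesis by (auto simp: hrep_def sim_block m2_mat m2_simps)
  qed
qed

text \<open>Integrality of the upper blocks of \<open>hecke_mat ** b ** r\<inverse>\<close>; equivalently, \<open>hecke_mat ** b\<close> and \<open>r\<close> have
the same Lagrangian subspace modulo \<open>p\<close>.\<close>

definition compat :: "mat4 \<Rightarrow> mat4 \<Rightarrow> bool" where
  "compat b r \<longleftrightarrow> dvd_mat p (block_A b ** ct (block_D r)) \<and>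
     dvd_mat p (block_A b ** ct (block_B r) - block_B b ** ct (block_A r))"

text \<open>The quotient \<open>hecke_mat ** b ** r\<inverse>\<close> is a similitude with multiplier 1. Its lower blocks are integral, with the
lower left one divisible by \<open>N\<close>, because the lower blocks of \<open>hecke_mat ** b\<close> carry a factor \<open>p\<close> that cancels the
denominator of \<open>r\<inverse>\<close>.\<close>

lemma compat_factor:
  assumes b: "b \<in> GammaN N" and r: "hrep r" and c: "compat b r"
  obtains \<sigma> where "\<sigma> \<in> GammaN N" "hecke_mat ** b = \<sigma> ** r"
proof -
  obtain A B C E where b': "b = block_mat A B C E" by (rule block_cases)
  obtain A' B' C' E' where r': "r = block_mat A' B' C' E'" by (rule block_cases)
  have p0: "(of_nat p :: complex) \<noteq> 0" using p_pos by simp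
  have C': "C' = 0" and int_mat: "int_mat A'" "int_mat B'" "int_mat E'" and sr: "sim (of_nat p) r" using r by (auto simp: hrep_def r')
  have OMb: "int_mat A" "int_mat B" "dvd_mat N C" "int_mat E" and sb: "sim 1 b" using b by (auto simp: GammaN_def b')
  define d where "d = scale_mat (1 / of_nat p) (hecke_mat ** b ** adjJ r)"
  have gb: "hecke_mat ** b = block_mat A B (scale_mat (of_nat p) C) (scale_mat (of_nat p) E)"
    by (simp add: hecke_mat_def b' block_mult mat_mult_left)
  have "hecke_mat ** b ** adjJ r = block_mat (A ** ct E') (B ** ct A' - A ** ct B')
      (scale_mat (of_nat p) (C ** ct E')) (scale_mat (of_nat p) (E ** ct A' - C ** ct B'))"
    unfolding gb by (simp add: r' adjJ_def C' block_mult mult_minus_right mult_minus_left scale_mult_left scale_diff)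
  then have d: "d = block_mat (scale_mat (1 / of_nat p) (A ** ct E')) (scale_mat (1 / of_nat p) (B ** ct A' - A ** ct B'))
      (C ** ct E') (E ** ct A' - C ** ct B')"
    using p0 by (simp add: d_def block_scale)
  have "sim (of_nat p * 1 * of_nat p) (hecke_mat ** b ** adjJ r)"
    by (intro sim_mult sim_hecke_mat sb sim_adjJ sr) (use p0 in auto)
  then have "sim (1 / of_nat p * (1 / of_nat p) * (of_nat p * 1 * of_nat p)) d"
    unfolding d_def by (rule sim_scale) auto
  then have sd: "sim 1 d" using p0 by simp
  have "dvd_mat p (- (A ** ct B' - B ** ct A'))"
    using c by (intro dvd_mat_minus) (simp add: compat_def b' r')
  then have i2: "dvd_mat p (B ** ct A' - A ** ct B')" by simp
  have "d \<in> GammaN N" using sd c int_mat OMb i2 unfolding d GammaN_block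
    by (auto simp: compat_def b' r' intro!: dvd_mat_scaleE p_pos int_mat_diff int_mat_mult dest: dvd_mat_int_mat)
  moreover have "d ** r = hecke_mat ** b"
    using adjJ_mult[OF sr] p0 by (simp add: d_def scale_mult_left scale_mult_right mat_mult_right flip: matrix_mul_assoc)
  ultimately show ?thesis using that by metis
qed

lemma factor_compat:
  assumes "hrep r" "hrep r'" "\<sigma> \<in> GammaN N" "r' = \<sigma> ** r"
  shows "compat r' r"
proof -
  obtain A B C E where r': "r' = block_mat A B C E" by (rule block_cases)
  obtain A' B' C' E' where r: "r = block_mat A' B' C' E'" by (rule block_cases)
  have C': "C' = 0" and sr: "sim (of_nat p) r" using assms by (auto simp: hrep_def r)
  have "r' ** adjJ r = \<sigma> ** (r ** adjJ r)" by (simp add: assms(4) matrix_mul_assoc)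
  also have "\<dots> = scale_mat (of_nat p) \<sigma>" using mult_adjJ[OF sr] p_pos by (simp add: mat_mult_right)
  finally have eq: "r' ** adjJ r = scale_mat (of_nat p) \<sigma>" .
  obtain X Y Z W where d: "\<sigma> = block_mat X Y Z W" by (rule block_cases)
  have int_mat: "int_mat X" "int_mat Y" using assms(3) by (auto simp: GammaN_def d)
  have "A ** ct E' = scale_mat (of_nat p) X"
    "B ** ct A' - A ** ct B' = scale_mat (of_nat p) Y"
    using eq by (simp_all add: r r' d adjJ_def block_mult block_scale C' mult_minus_right)
  then have "dvd_mat p (A ** ct E')" "dvd_mat p (B ** ct A' - A ** ct B')"
    using int_mat dvd_mat_scale by metis+
  then show ?thesis using dvd_mat_minus[of p "B ** ct A' - A ** ct B'"] by (simp add: compat_def r r')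
qed

text \<open>Over \<open>\<O>/p\<close>: if \<open>a b*\<close> is hermitian for two column vectors with \<open>a \<noteq> 0\<close>, then \<open>b\<close> is a rational multiple of \<open>a\<close>. The
factor is the real number \<open>\<beta>\<alpha>*\<close> divided by the norm of \<open>\<alpha>\<close>.\<close>

lemma isotropic_line:
  assumes O: "\<alpha> \<in> \<O>" "\<gamma> \<in> \<O>" "\<beta> \<in> \<O>" "\<phi> \<in> \<O>" and ne: "\<alpha> \<notin> I p"
    and h1: "\<alpha> * cnj \<beta> - \<beta> * cnj \<alpha> \<in> I p" and h2: "\<alpha> * cnj \<phi> - \<beta> * cnj \<gamma> \<in> I p"
  obtains b :: int where "0 \<le> b" "b < int p" "of_int b * \<alpha> - \<beta> \<in> I p" "of_int b * \<gamma> - \<phi> \<in> I p"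
proof -
  have "\<beta> * cnj \<alpha> - cnj (\<beta> * cnj \<alpha>) = - (\<alpha> * cnj \<beta> - \<beta> * cnj \<alpha>)" by simp
  then have "\<beta> * cnj \<alpha> - cnj (\<beta> * cnj \<alpha>) \<in> I p" using h1 by (simp only: I_minus)
  then obtain m :: int where m: "\<beta> * cnj \<alpha> - of_int m \<in> I p" using real_mod_p[of "\<beta> * cnj \<alpha>"] O by blast
  define n where "n = nrm \<alpha>"
  have n: "of_int n = \<alpha> * cnj \<alpha>" unfolding n_def using O(1) by (rule of_int_nrm)
  have pn: "\<not> int p dvd n" unfolding n_def using O(1) ne dvd_nrm by blast
  have nI: "of_int n \<notin> I p" using pn by (simp add: int_in_I)
  obtain u v where uv: "u * n + v * int p = 1"
    using int_coprime_p[OF pn] bezout_int[of n "int p"] by (auto simp: coprime_iff_gcd_eq_1)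
  \<comment> \<open>\<open>m\<close> is \<open>\<beta>\<alpha>*\<close> modulo \<open>p\<close> and \<open>u\<close> inverts the norm of \<open>\<alpha>\<close>\<close>
  define b where "b = (m * u) mod int p"
  have "int p dvd m * u - b" by (simp add: b_def minus_mod_eq_mult_div)
  then have "int p dvd n * (m * u - b) + int p * (v * m)" by simp
  also have "n * (m * u - b) + int p * (v * m) = (u * n + v * int p) * m - n * b" by (simp add: algebra_simps)
  finally have "int p dvd m - n * b" by (simp add: uv)
  then have nb: "of_int (m - n * b) \<in> I p" by (simp only: int_in_I)
  have "of_int n * (of_int b * \<alpha> - \<beta>) = - (\<alpha> * (\<beta> * cnj \<alpha> - of_int m)) - \<alpha> * of_int (m - n * b)"
    by (simp add: n algebra_simps)
  moreover have "- (\<alpha> * (\<beta> * cnj \<alpha> - of_int m)) - \<alpha> * of_int (m - n * b) \<in> I p"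
    by (intro I_diff I_minus I_mult1 O m nb)
  ultimately have "of_int n * (of_int b * \<alpha> - \<beta>) \<in> I p" by (simp only:)
  then have 1: "of_int b * \<alpha> - \<beta> \<in> I p" using nI O mult_in_I[of "of_int n" "of_int b * \<alpha> - \<beta>"] by simp
  have "of_int n * (of_int b * \<gamma> - \<phi>) = - \<gamma> * of_int (m - n * b) - \<gamma> * cnj (\<beta> * cnj \<alpha> - of_int m) - \<alpha> * cnj (\<alpha> * cnj \<phi> - \<beta> * cnj \<gamma>)"
    by (simp add: n algebra_simps)
  moreover have "- \<gamma> * of_int (m - n * b) - \<gamma> * cnj (\<beta> * cnj \<alpha> - of_int m) - \<alpha> * cnj (\<alpha> * cnj \<phi> - \<beta> * cnj \<gamma>) \<in> I p"
    by (intro I_diff I_minus I_mult1 I_cnj O O_minus m nb h2)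
  ultimately have "of_int n * (of_int b * \<gamma> - \<phi>) \<in> I p" by (simp only:)
  then have 2: "of_int b * \<gamma> - \<phi> \<in> I p" using nI O mult_in_I[of "of_int n" "of_int b * \<gamma> - \<phi>"] by simp
  show ?thesis using that[of b] 1 2 p_pos by (simp add: b_def)
qed

lemma real_mod_p_range:
  assumes "y \<in> \<O>" "y - cnj y \<in> I p"
  obtains a :: int where "0 \<le> a" "a < int p" "of_int a - y \<in> I p"
proof -
  obtain a where a: "y - of_int a \<in> I p" using real_mod_p[OF assms] by blast
  have "of_int (a mod int p - a) \<in> I p" unfolding int_in_I by (rule mod_eq_dvd_iff[THEN iffD1]) simp
  then have "of_int (a mod int p - a) - (y - of_int a) \<in> I p" using a by (rule I_diff)
  then have "of_int (a mod int p) - y \<in> I p" by simp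
  then show ?thesis using p_pos by (intro that[of "a mod int p"]) auto
qed

text \<open>If \<open>A\<close> is invertible modulo \<open>p\<close>, the symmetry of \<open>A B*\<close> makes \<open>A\<inverse>B\<close> hermitian modulo \<open>p\<close>. If \<open>A\<close> is singular, move
its kernel into the second coordinate by some \<open>U\<close>; then the first columns of the new \<open>A\<close> and \<open>B\<close> are proportional by
\<open>isotropic_line\<close>, unless \<open>A\<close> vanishes modulo \<open>p\<close>.\<close>

lemma compat_exists:
  assumes b: "b \<in> GammaN N"
  obtains i where "i \<in> rep_idx" "compat b (coset_rep i)"
proof -
  obtain A B C E where b': "b = block_mat A B C E" by (rule block_cases)
  have OMb: "int_mat A" "int_mat B" "int_mat E" and sb: "sim 1 b" using b by (auto simp: GammaN_def b')
  have AB: "A ** ct B = B ** ct A" using sim_rows(1)[of 1 A B C E] sb b' by simp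
  obtain a1 a2 a3 a4 where A: "A = m2 a1 a2 a3 a4" by (rule m2_cases)
  have a: "a1 \<in> \<O>" "a2 \<in> \<O>" "a3 \<in> \<O>" "a4 \<in> \<O>" using OMb by (auto simp: A)
  define \<Delta> where "\<Delta> = a1 * a4 - a2 * a3"
  have dO: "\<Delta> \<in> \<O>" using a by (auto simp: \<Delta>_def)
  show ?thesis
  proof (cases "\<Delta> \<in> I p")
    case False
    obtain e where e: "e \<in> \<O>" "\<Delta> * e - 1 \<in> I p" using inverse_mod_p[OF dO False] by blast
    define Ad where "Ad = m2 a4 (- a2) (- a3) a1"
    have Ad: "A ** Ad = mat \<Delta>" "Ad ** A = mat \<Delta>" "int_mat Ad"
      using a by (simp_all add: A Ad_def m2_simps m2_mat \<Delta>_def algebra_simps)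
    \<comment> \<open>\<open>S\<close> is \<open>A\<inverse>B\<close> modulo \<open>p\<close>; \<open>X\<close> below measures its failure to be hermitian\<close>
    define S where "S = scale_mat e (Ad ** B)"
    have OMS: "int_mat S" using e(1) Ad(3) OMb int_mat_mult[of Ad B] by (simp add: S_def int_mat_def scale_mat_def)
    have "A ** S - B = scale_mat (\<Delta> * e - 1) B"
      by (simp add: S_def scale_mult_right matrix_mul_assoc Ad mat_mult_left mult.commute)
        (simp add: scale_mat_def vec_eq_iff algebra_simps)
    moreover have "dvd_mat p (scale_mat (\<Delta> * e - 1) B)" using e(2) OMb by (auto simp: dvd_mat_def int_mat_def scale_mat_def)
    ultimately have AS: "dvd_mat p (A ** S - B)" by simp
    define X where "X = S - ct S"
    have OMX: "int_mat X" unfolding X_def using OMS by auto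
    have "A ** X ** ct A = (A ** S - B) ** ct A - A ** ct (A ** S - B)"
      using AB by (simp add: X_def mult_diff_left mult_diff_right ct_diff ct_mult matrix_mul_assoc)
    moreover have "dvd_mat p ((A ** S - B) ** ct A - A ** ct (A ** S - B))"
      by (rule dvd_mat_diff[OF dvd_mat_mult2[OF AS int_mat_ct[OF OMb(1)]] dvd_mat_mult1[OF OMb(1) dvd_mat_ct[OF AS]]])
    ultimately have AXA: "dvd_mat p (A ** X ** ct A)" by simp
    have "dvd_mat p (Ad ** (A ** X ** ct A) ** ct Ad)"
      by (rule dvd_mat_mult2[OF dvd_mat_mult1[OF Ad(3) AXA] int_mat_ct[OF Ad(3)]])
    also have "Ad ** (A ** X ** ct A) ** ct Ad = (Ad ** A) ** X ** ct (Ad ** A)"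
      by (simp add: ct_mult matrix_mul_assoc)
    also have "\<dots> = scale_mat (\<Delta> * cnj \<Delta>) X"
      by (simp add: Ad mat_mult_left mat_mult_right mult.commute)
    finally have "dvd_mat p (scale_mat (\<Delta> * cnj \<Delta>) X)" .
    moreover have "\<Delta> * cnj \<Delta> \<notin> I p" using False dO mult_in_I[of \<Delta> "cnj \<Delta>"] by simp
    ultimately have X: "dvd_mat p X" using OMX dO mult_in_I[of "\<Delta> * cnj \<Delta>"]
      by (auto simp: dvd_mat_def int_mat_def scale_mat_def)
    obtain s1 s2 s3 s4 where S: "S = m2 s1 s2 s3 s4" by (rule m2_cases)
    have s: "s1 \<in> \<O>" "s2 \<in> \<O>" "s3 \<in> \<O>" "s4 \<in> \<O>" using OMS by (auto simp: S)
    have sI: "s1 - cnj s1 \<in> I p" "s2 - cnj s3 \<in> I p" "s4 - cnj s4 \<in> I p" using X by (auto simp: X_def S m2_simps)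
    obtain c1 where c1: "0 \<le> c1" "c1 < int p" "of_int c1 - s1 \<in> I p" using real_mod_p_range[OF s(1) sI(1)] by blast
    obtain c4 where c4: "0 \<le> c4" "c4 < int p" "of_int c4 - s4 \<in> I p" using real_mod_p_range[OF s(4) sI(3)] by blast
    obtain x where x: "x \<in> residues" "s2 - x \<in> I p" using residues_rep[OF s(2)] by blast
    define S' where "S' = m2 (of_int c1) x (cnj x) (of_int c4)"
    have "S' \<in> Herm" using c1 c4 x unfolding Herm_def S'_def by (intro image_eqI[of _ _ "((c1, c4), x)"]) auto
    have x2: "x - s2 \<in> I p" using I_minus[OF x(2)] by simp
    have "cnj x - s3 = cnj (s2 - cnj s3) - cnj (s2 - x)" by simp
    also have "\<dots> \<in> I p" by (intro I_diff I_cnj sI x)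
    finally have x3: "cnj x - s3 \<in> I p" .
    have "dvd_mat p (S' - S)" using c1 c4 x2 x3 by (simp add: S'_def S m2_simps)
    then have "dvd_mat p (A ** (S' - S) + (A ** S - B))" using AS OMb by (intro dvd_mat_add dvd_mat_mult1)
    also have "A ** (S' - S) + (A ** S - B) = A ** S' - B" by (simp add: mult_diff_right)
    finally have "dvd_mat p (A ** S' - B)" .
    moreover have "ct S' = S'" by (simp add: S'_def m2_ct)
    ultimately have "compat b (coset_rep (Inl S'))" using OMb dvd_mat_scale
      by (simp add: compat_def b' mat_mult_right)
    then show ?thesis using that[of "Inl S'"] \<open>S' \<in> Herm\<close> by (auto simp: rep_idx_def)
  next
    case True
    have "\<exists>u\<in>lines. (A ** ct (Uo u)) $ 1 $ 2 \<in> I p \<and> (A ** ct (Uo u)) $ 2 $ 2 \<in> I p"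
    proof -
      \<comment> \<open>if a row \<open>(c, d)\<close> has \<open>c\<close> invertible, its kernel vector \<open>(x*, 1)\<close> also kills a proportional row\<close>
      have solve: "\<exists>x\<in>residues. c * cnj x + d \<in> I p \<and> c' * cnj x + d' \<in> I p"
        if c: "c \<in> \<O>" "d \<in> \<O>" "c' \<in> \<O>" "d' \<in> \<O>" "c \<notin> I p" "c * d' - d * c' \<in> I p" for c d c' d'
      proof -
        obtain e where e: "e \<in> \<O>" "c * e - 1 \<in> I p" using inverse_mod_p[OF c(1,5)] by blast
        obtain x where x: "x \<in> residues" "- cnj (e * d) - x \<in> I p" using residues_rep[of "- cnj (e * d)"] e c by auto
        have xO: "x \<in> \<O>" using x residues_O by blast
        have x': "cnj (- cnj (e * d) - x) \<in> I p" using x by (intro I_cnj)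
        have "c * cnj x + d = - c * cnj (- cnj (e * d) - x) - d * (c * e - 1)" by (simp add: algebra_simps)
        also have "\<dots> \<in> I p" by (rule I_diff[OF I_mult1[OF O_minus[OF c(1)] x'] I_mult1[OF c(2) e(2)]])
        finally have 1: "c * cnj x + d \<in> I p" .
        have "c * (c' * cnj x + d') = c' * (c * cnj x + d) + (c * d' - d * c')" by (simp add: algebra_simps)
        also have "\<dots> \<in> I p" by (rule I_add[OF I_mult1[OF c(3) 1] c(6)])
        finally have "c' * cnj x + d' \<in> I p" using c xO mult_in_I[of c "c' * cnj x + d'"] by simp
        then show ?thesis using 1 x by blast
      qed
      consider "a1 \<in> I p" "a3 \<in> I p" | "a1 \<notin> I p" | "a3 \<notin> I p" by blast
      then show ?thesis
      proof cases
        case 1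
        then show ?thesis by (intro bexI[of _ None]) (auto simp: lines_def Uo_def A m2_simps)
      next
        case 2
        obtain x where "x \<in> residues" "a1 * cnj x + a2 \<in> I p" "a3 * cnj x + a4 \<in> I p"
          using solve[of a1 a2 a3 a4] 2 a True by (auto simp: \<Delta>_def)
        then show ?thesis by (intro bexI[of _ "Some x"]) (auto simp: lines_def Uo_def A m2_simps)
      next
        case 3
        have "a3 * a2 - a4 * a1 = - \<Delta>" by (simp add: \<Delta>_def)
        then have "a3 * a2 - a4 * a1 \<in> I p" using True by (simp only: I_minus)
        then obtain x where "x \<in> residues" "a3 * cnj x + a4 \<in> I p" "a1 * cnj x + a2 \<in> I p"
          using solve[of a3 a4 a1 a2] 3 a by auto
        then show ?thesis by (intro bexI[of _ "Some x"]) (auto simp: lines_def Uo_def A m2_simps)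
      qed
    qed
    then obtain u where u: "u \<in> lines" and uI: "(A ** ct (Uo u)) $ 1 $ 2 \<in> I p" "(A ** ct (Uo u)) $ 2 $ 2 \<in> I p"
      by blast
    define A' where "A' = A ** ct (Uo u)"
    define B' where "B' = B ** ct (Uc u)"
    have OM': "int_mat A'" "int_mat B'" using OMb Uo_O[OF u] Uc_O[OF u] by (auto simp: A'_def B'_def)
    have AB': "A' ** ct B' = B' ** ct A'"
    proof -
      have "A' ** ct B' = A ** (ct (Uo u) ** Uc u) ** ct B"
        by (simp add: A'_def B'_def ct_mult matrix_mul_assoc)
      moreover have "B' ** ct A' = B ** (ct (Uc u) ** Uo u) ** ct A"
        by (simp add: A'_def B'_def ct_mult matrix_mul_assoc)
      ultimately show ?thesis using AB by (simp add: Uo_Uc)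
    qed
    obtain \<alpha> \<epsilon> \<gamma> \<zeta> where Ae: "A' = m2 \<alpha> \<epsilon> \<gamma> \<zeta>" by (rule m2_cases)
    obtain \<beta> \<eta> \<phi> \<theta> where Be: "B' = m2 \<beta> \<eta> \<phi> \<theta>" by (rule m2_cases)
    have O: "\<alpha> \<in> \<O>" "\<gamma> \<in> \<O>" "\<beta> \<in> \<O>" "\<phi> \<in> \<O>" "\<eta> \<in> \<O>" "\<theta> \<in> \<O>" "\<epsilon> \<in> \<O>" "\<zeta> \<in> \<O>" using OM' by (auto simp: Ae Be)
    have ez: "\<epsilon> \<in> I p" "\<zeta> \<in> I p" using uI unfolding A'_def[symmetric] Ae by simp_all
    have compat: "compat b (coset_rep (Inr (Inl (u, c))))" if "of_int c * \<alpha> - \<beta> \<in> I p" "of_int c * \<gamma> - \<phi> \<in> I p" for c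
    proof -
      have "A ** ct (m2 (of_nat p) 0 0 1 ** Uo u) = A' ** m2 (of_nat p) 0 0 1"
        by (simp add: ct_mult A'_def matrix_mul_assoc m2_ct)
      also have "\<dots> = m2 (of_nat p * \<alpha>) \<epsilon> (of_nat p * \<gamma>) \<zeta>" by (simp add: Ae m2_simps mult.commute)
      finally have 1: "dvd_mat p (A ** ct (m2 (of_nat p) 0 0 1 ** Uo u))" using ez O by simp
      have "A ** ct (m2 (of_int c) 0 0 0 ** Uo u) - B ** ct (m2 1 0 0 (of_nat p) ** Uc u) =
        A' ** m2 (of_int c) 0 0 0 - B' ** m2 1 0 0 (of_nat p)"
        by (simp add: ct_mult A'_def B'_def matrix_mul_assoc m2_ct)
      also have "\<dots> = m2 (of_int c * \<alpha> - \<beta>) (of_nat p * (- \<eta>)) (of_int c * \<gamma> - \<phi>) (of_nat p * (- \<theta>))"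
        by (simp add: Ae Be m2_simps mult.commute)
      finally have "dvd_mat p (A ** ct (m2 (of_int c) 0 0 0 ** Uo u) - B ** ct (m2 1 0 0 (of_nat p) ** Uc u))"
        using that O by simp
      then show ?thesis using 1 by (simp add: compat_def b')
    qed
    have h11: "\<alpha> * cnj \<beta> - \<beta> * cnj \<alpha> \<in> I p" and h12: "\<alpha> * cnj \<phi> - \<beta> * cnj \<gamma> \<in> I p"
      and h22: "\<gamma> * cnj \<phi> - \<phi> * cnj \<gamma> \<in> I p" and h21: "\<gamma> * cnj \<beta> - \<phi> * cnj \<alpha> \<in> I p"
    proof -
      have e: "\<alpha> * cnj \<beta> - \<beta> * cnj \<alpha> = \<eta> * cnj \<epsilon> - \<epsilon> * cnj \<eta>" "\<alpha> * cnj \<phi> - \<beta> * cnj \<gamma> = \<eta> * cnj \<zeta> - \<epsilon> * cnj \<theta>"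
        "\<gamma> * cnj \<phi> - \<phi> * cnj \<gamma> = \<theta> * cnj \<zeta> - \<zeta> * cnj \<theta>" "\<gamma> * cnj \<beta> - \<phi> * cnj \<alpha> = \<theta> * cnj \<epsilon> - \<zeta> * cnj \<eta>"
        using AB' unfolding Ae Be m2_ct m2_mult m2_eq_iff by (simp_all add: diff_eq_eq eq_diff_eq algebra_simps)
      show "\<alpha> * cnj \<beta> - \<beta> * cnj \<alpha> \<in> I p" "\<alpha> * cnj \<phi> - \<beta> * cnj \<gamma> \<in> I p"
        "\<gamma> * cnj \<phi> - \<phi> * cnj \<gamma> \<in> I p" "\<gamma> * cnj \<beta> - \<phi> * cnj \<alpha> \<in> I p"
        unfolding e by (intro I_diff I_mult1 I_mult2 I_cnj O_cnj O ez)+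
    qed
    consider "\<alpha> \<notin> I p" | "\<gamma> \<notin> I p" | "\<alpha> \<in> I p" "\<gamma> \<in> I p" by blast
    then show ?thesis
    proof cases
      case 1
      obtain c where c: "0 \<le> c" "c < int p" "of_int c * \<alpha> - \<beta> \<in> I p" "of_int c * \<gamma> - \<phi> \<in> I p"
        using isotropic_line[OF O(1-4) 1 h11 h12] by blast
      then show ?thesis using compat[OF c(3,4)] u by (intro that[of "Inr (Inl (u, c))"]) (auto simp: rep_idx_def)
    next
      case 2
      obtain c where c: "0 \<le> c" "c < int p" "of_int c * \<gamma> - \<phi> \<in> I p" "of_int c * \<alpha> - \<beta> \<in> I p"
        using isotropic_line[OF O(2,1,4,3) 2 h22 h21] by blast
      then show ?thesis using compat[OF c(4,3)] u by (intro that[of "Inr (Inl (u, c))"]) (auto simp: rep_idx_def)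
    next
      case 3
      then have "dvd_mat p (A' ** Uc u)" using ez Uc_O[OF u] by (intro dvd_mat_mult2) (simp_all add: Ae)
      also have "A' ** Uc u = A" by (simp add: A'_def Uo_Uc flip: matrix_mul_assoc)
      finally have "compat b (coset_rep (Inr (Inr ())))" using dvd_mat_scale[of B p] OMb dvd_mat_minus[of p "scale_mat (of_nat p) B"]
        by (simp add: compat_def b' mat_mult_right)
      then show ?thesis by (intro that[of "Inr (Inr ())"]) (auto simp: rep_idx_def)
    qed
  qed
qed

lemma bezout_pN: obtains d y where "int p * d - int N * y = 1"
proof -
  have "coprime (int p) (int N)" using p_prime p_ndvd_N prime_imp_coprime[of p N] by simp
  then obtain u v where "u * int p + v * int N = 1"
    using bezout_int[of "int p" "int N"] by (auto simp: coprime_iff_gcd_eq_1)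
  then show ?thesis by (intro that[of u "- v"]) (simp add: algebra_simps)
qed

text \<open>The group elements are built from \<open>p d - N y = 1\<close>: the matrix with rows \<open>(p, y)\<close> and \<open>(N, d)\<close> in \<open>SL\<^sub>2(\<int>)\<close>, embedded
diagonally in one or in both coordinates, has an upper left block that degenerates modulo \<open>p\<close> in the required way.\<close>

lemma rep_compat_exists:
  assumes "i \<in> rep_idx"
  obtains b where "b \<in> GammaN N" "compat b (coset_rep i)"
proof -
  obtain d y where dy: "int p * d - int N * y = 1" by (rule bezout_pN)
  have dyc: "of_nat p * of_int d - of_nat N * of_int y = (1 :: complex)"
    using arg_cong[OF dy, of "of_int :: int \<Rightarrow> complex"] by simp
  have NI: "of_nat N \<in> I N" using I_of_nat[of 1 N] by simp
  have pI: "of_nat p \<in> I p" using I_of_nat[of 1 p] by simp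
  consider S where "i = Inl S" "S \<in> Herm" | u b where "i = Inr (Inl (u, b))" "u \<in> lines" | "i = Inr (Inr ())"
    using assms by (auto simp: rep_idx_def)
  then show ?thesis
  proof cases
    case 1
    then have S: "int_mat S" "ct S = S" by (auto simp: Herm_def m2_ct residues_O)
    have "block_mat (mat 1) S 0 (mat 1) \<in> GammaN N" using S by (simp add: GammaN_block sim_block)
    moreover have "compat (block_mat (mat 1) S 0 (mat 1)) (coset_rep i)"
      using S pI by (simp add: 1 compat_def) (simp add: m2_mat)
    ultimately show ?thesis by (rule that)
  next
    case 2
    let ?A = "m2 1 0 0 (of_nat p)" and ?B = "m2 (of_int b) 0 0 (of_int y)" and ?C = "m2 0 0 0 (of_nat N)" and ?E = "m2 1 0 0 (of_int d)"
    let ?b = "block_mat ?A ?B ?C ?E ** block_mat (Uc u) 0 0 (Uo u)"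
    have "block_mat ?A ?B ?C ?E \<in> GammaN N"
      using dyc NI by (simp add: GammaN_block sim_block m2_simps m2_mat)
    then have "?b \<in> GammaN N" using mU_GammaN[OF 2(2)] by (rule GammaN_mult)
    moreover have "compat ?b (coset_rep i)"
    proof -
      have "?A ** Uc u ** ct (m2 (of_nat p) 0 0 1 ** Uo u) = ?A ** (Uc u ** ct (Uo u)) ** ct (m2 (of_nat p) 0 0 1)"
        by (simp add: ct_mult matrix_mul_assoc)
      then have 1: "dvd_mat p (?A ** Uc u ** ct (m2 (of_nat p) 0 0 1 ** Uo u))"
        using pI by (simp add: Uo_Uc m2_simps)
      have "?A ** Uc u ** ct (m2 (of_int b) 0 0 0 ** Uo u) - ?B ** Uo u ** ct (m2 1 0 0 (of_nat p) ** Uc u)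
        = ?A ** (Uc u ** ct (Uo u)) ** ct (m2 (of_int b) 0 0 0) - ?B ** (Uo u ** ct (Uc u)) ** ct ?A"
        by (simp add: ct_mult matrix_mul_assoc)
      also have "\<dots> = m2 0 0 0 (of_nat p * of_int (- y))" by (simp add: Uo_Uc m2_simps)
      finally show ?thesis using 1 by (simp add: compat_def 2 block_mult del: of_int_minus mult_minus_right)
    qed
    ultimately show ?thesis by (rule that)
  next
    case 3
    let ?b = "block_mat (mat (of_nat p)) (mat (of_int y)) (mat (of_nat N)) (mat (of_int d))"
    have "?b \<in> GammaN N" using dyc NI by (simp add: GammaN_block sim_block m2_mat m2_simps mult.commute)
    moreover have "compat ?b (coset_rep i)"
      using pI by (simp add: compat_def 3) (auto simp: m2_mat m2_simps m2_zero)
    ultimately show ?thesis by (rule that)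
  qed
qed

lemma double_coset_iff: "h \<in> double_coset (GammaN N) hecke_mat \<longleftrightarrow> (\<exists>i\<in>rep_idx. \<exists>\<sigma>\<in>GammaN N. h = \<sigma> ** coset_rep i)"
proof
  assume "h \<in> double_coset (GammaN N) hecke_mat"
  then obtain a b where ab: "a \<in> GammaN N" "b \<in> GammaN N" "h = a ** hecke_mat ** b" by (auto simp: double_coset_def)
  obtain i where i: "i \<in> rep_idx" "compat b (coset_rep i)" using compat_exists[OF ab(2)] by blast
  obtain \<sigma> where "\<sigma> \<in> GammaN N" "hecke_mat ** b = \<sigma> ** coset_rep i" using compat_factor[OF ab(2) hrep_rep[OF i(1)] i(2)] by blast
  then have "h = (a ** \<sigma>) ** coset_rep i" "a ** \<sigma> \<in> GammaN N" using ab GammaN_mult by (simp_all flip: matrix_mul_assoc)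
  then show "\<exists>i\<in>rep_idx. \<exists>\<sigma>\<in>GammaN N. h = \<sigma> ** coset_rep i" using i by blast
next
  assume "\<exists>i\<in>rep_idx. \<exists>\<sigma>\<in>GammaN N. h = \<sigma> ** coset_rep i"
  then obtain i \<sigma> where i: "i \<in> rep_idx" "\<sigma> \<in> GammaN N" "h = \<sigma> ** coset_rep i" by blast
  obtain b where b: "b \<in> GammaN N" "compat b (coset_rep i)" using rep_compat_exists[OF i(1)] by blast
  obtain \<epsilon> where e: "\<epsilon> \<in> GammaN N" "hecke_mat ** b = \<epsilon> ** coset_rep i" using compat_factor[OF b(1) hrep_rep[OF i(1)] b(2)] by blast
  have "adjJ \<epsilon> ** hecke_mat ** b = (adjJ \<epsilon> ** \<epsilon>) ** coset_rep i" using e(2) by (simp flip: matrix_mul_assoc)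
  then have "coset_rep i = adjJ \<epsilon> ** hecke_mat ** b" using GammaN_adjJ(2)[OF e(1)] by simp
  then have "h = (\<sigma> ** adjJ \<epsilon>) ** hecke_mat ** b" using i by (simp add: matrix_mul_assoc)
  moreover have "\<sigma> ** adjJ \<epsilon> \<in> GammaN N" using i e GammaN_mult GammaN_adjJ by blast
  ultimately show "h \<in> double_coset (GammaN N) hecke_mat" using b unfolding double_coset_def by blast
qed

lemma range_cong: "0 \<le> a \<Longrightarrow> a < int p \<Longrightarrow> 0 \<le> b \<Longrightarrow> b < int p \<Longrightarrow> of_int a - of_int b \<in> I p \<Longrightarrow> a = b"
proof -
  assume r: "0 \<le> a" "a < int p" "0 \<le> b" "b < int p" and "of_int a - of_int b \<in> I p"
  then have "of_int (a - b) \<in> I p" by simp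
  then have "a mod int p = b mod int p" unfolding int_in_I by (simp add: mod_eq_dvd_iff)
  then show "a = b" using r by simp
qed

text \<open>Two representatives in one coset are compatible in both orders; between different families one of the two orders already
exhibits a unit where a multiple of \<open>p\<close> is needed.\<close>

lemma rep_compat_eq:
  assumes i: "i \<in> rep_idx" and j: "j \<in> rep_idx" and c: "compat (coset_rep i) (coset_rep j)" "compat (coset_rep j) (coset_rep i)"
  shows "i = j"
proof -
  have n1: "1 \<notin> I p" "- 1 \<notin> I p" using one_notin I_minus[of "- 1" p] by auto
  have 01: False if "S \<in> Herm" "u \<in> lines" "compat (coset_rep (Inl S)) (coset_rep (Inr (Inl (u, b))))" for S u b
  proof -
    have "dvd_mat p (ct (m2 (of_nat p) 0 0 1 ** Uo u))" using that by (simp add: compat_def)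
    then show False using n1 by (cases u) (simp_all add: Uo_def m2_simps)
  qed
  have 02: False if "compat (coset_rep (Inl S)) (coset_rep (Inr (Inr ())))" for S
    using that n1 by (simp add: compat_def) (simp add: m2_mat)
  have 12: False if "compat (coset_rep (Inr (Inl (u, b)))) (coset_rep (Inr (Inr ())))" for u b
  proof -
    have "dvd_mat p (m2 1 0 0 (of_nat p) ** Uc u)" using that by (simp add: compat_def)
    then show False using n1 by (cases u) (simp_all add: Uc_def m2_simps)
  qed
  consider S where "i = Inl S" "S \<in> Herm" | u b where "i = Inr (Inl (u, b))" "u \<in> lines" "0 \<le> b" "b < int p" | "i = Inr (Inr ())"
    using i by (auto simp: rep_idx_def)
  note ci = this
  consider S where "j = Inl S" "S \<in> Herm" | u b where "j = Inr (Inl (u, b))" "u \<in> lines" "0 \<le> b" "b < int p" | "j = Inr (Inr ())"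
    using j by (auto simp: rep_idx_def)
  note cj = this
  show ?thesis
  proof (cases rule: ci)
    case (1 S)
    note i1 = 1
    show ?thesis
    proof (cases rule: cj)
      case (1 S')
      obtain a b x where S: "S = m2 (of_int a) x (cnj x) (of_int b)" "0 \<le> a" "a < int p" "0 \<le> b" "b < int p" "x \<in> residues"
        using i1 by (auto simp: Herm_def)
      obtain a' b' x' where S': "S' = m2 (of_int a') x' (cnj x') (of_int b')" "0 \<le> a'" "a' < int p" "0 \<le> b'" "b' < int p" "x' \<in> residues"
        using 1 by (auto simp: Herm_def)
      have "dvd_mat p (ct S' - S)" using c(1) by (simp add: compat_def i1 1)
      then have "of_int a' - of_int a \<in> I p" "of_int b' - of_int b \<in> I p" "x' - x \<in> I p"
        by (simp_all add: S(1) S'(1) m2_simps)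
      then have "a' = a" "b' = b" "x' = x" using range_cong S S' residues_unique by blast+
      then show ?thesis by (simp add: i1 1 S(1) S'(1))
    qed (use c i1 01 02 in auto)
  next
    case (2 u b)
    note i2 = 2
    show ?thesis
    proof (cases rule: cj)
      case (2 u' b')
      have "dvd_mat p (m2 1 0 0 (of_nat p) ** Uc u ** ct (m2 (of_nat p) 0 0 1 ** Uo u'))"
        using c(1) by (simp add: compat_def i2 2)
      then have e12: "(m2 1 0 0 (of_nat p) ** Uc u ** ct (m2 (of_nat p) 0 0 1 ** Uo u')) $ 1 $ 2 \<in> I p"
        by (simp add: dvd_mat_def)
      have uu: "u = u'"
      proof (cases u; cases u')
        fix x x' assume u: "u = Some x" "u' = Some x'"
        then have "cnj (x' - x) \<in> I p" using e12 by (simp add: Uo_def Uc_def m2_simps)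
        then have "x' - x \<in> I p" by (simp only: I_cnj_iff)
        then show ?thesis using residues_unique[of x' x] i2 2 u by (auto simp: lines_def)
      qed (use e12 n1 in \<open>auto simp: Uo_def Uc_def m2_simps\<close>)
      have "m2 1 0 0 (of_nat p) ** Uc u ** ct (m2 (of_int b') 0 0 0 ** Uo u) - m2 (of_int b) 0 0 0 ** Uo u ** ct (m2 1 0 0 (of_nat p) ** Uc u)
        = m2 1 0 0 (of_nat p) ** (Uc u ** ct (Uo u)) ** ct (m2 (of_int b') 0 0 0) - m2 (of_int b) 0 0 0 ** (Uo u ** ct (Uc u)) ** ct (m2 1 0 0 (of_nat p))"
        by (simp add: ct_mult matrix_mul_assoc)
      also have "\<dots> = m2 (of_int b' - of_int b) 0 0 0" by (simp add: Uo_Uc m2_simps)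
      finally have "dvd_mat p (m2 (of_int b' - of_int b) 0 0 0)"
        using c(1) by (simp add: compat_def i2 2 uu)
      then have "b' = b" using range_cong i2 2 by simp
      then show ?thesis using uu by (simp add: i2 2)
    qed (use c i2 01 12 in auto)
  next
    case 3
    show ?thesis
      by (cases rule: cj) (use c 3 02 12 in auto)
  qed
qed

lemma rep_inj:
  assumes "i \<in> rep_idx" "j \<in> rep_idx" "\<sigma> \<in> GammaN N" "coset_rep i = \<sigma> ** coset_rep j"
  shows "i = j"
proof -
  have "coset_rep j = adjJ \<sigma> ** coset_rep i"
    using assms(4) GammaN_adjJ(2)[OF assms(3)] by (simp add: matrix_mul_assoc)
  then have "compat (coset_rep j) (coset_rep i)"
    using factor_compat[of "coset_rep i" "coset_rep j" "adjJ \<sigma>"] hrep_rep assms GammaN_adjJ by blast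
  moreover have "compat (coset_rep i) (coset_rep j)"
    using factor_compat[of "coset_rep j" "coset_rep i" \<sigma>] hrep_rep assms by blast
  ultimately show ?thesis using rep_compat_eq assms by blast
qed

definition coset :: "mat2 + complex option \<times> int + unit \<Rightarrow> mat4 set" where
  "coset i = {a ** coset_rep i | a. a \<in> GammaN N}"

lemma cosets_eq: "cosets_in_double_coset (GammaN N) hecke_mat = coset ` rep_idx"
proof -
  have co: "{a ** (\<sigma> ** coset_rep i) | a. a \<in> GammaN N} = coset i" if "\<sigma> \<in> GammaN N" for \<sigma> i
  proof (intro equalityI subsetI)
    fix x assume "x \<in> {a ** (\<sigma> ** coset_rep i) | a. a \<in> GammaN N}"
    then obtain a where "a \<in> GammaN N" "x = (a ** \<sigma>) ** coset_rep i" by (auto simp: matrix_mul_assoc)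
    then show "x \<in> coset i" using that GammaN_mult unfolding coset_def by blast
  next
    fix x assume "x \<in> coset i"
    then obtain a where a: "a \<in> GammaN N" "x = a ** coset_rep i" by (auto simp: coset_def)
    have "x = (a ** adjJ \<sigma>) ** (\<sigma> ** coset_rep i)"
    proof -
      have "(a ** adjJ \<sigma>) ** (\<sigma> ** coset_rep i) = a ** (adjJ \<sigma> ** \<sigma>) ** coset_rep i" by (simp add: matrix_mul_assoc)
      then show ?thesis using a GammaN_adjJ(2)[OF that] by simp
    qed
    moreover have "a ** adjJ \<sigma> \<in> GammaN N" using a that GammaN_mult GammaN_adjJ by blast
    ultimately show "x \<in> {a ** (\<sigma> ** coset_rep i) | a. a \<in> GammaN N}" by blast
  qed
  show ?thesis
  proof (intro equalityI subsetI)
    fix X assume "X \<in> cosets_in_double_coset (GammaN N) hecke_mat"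
    then obtain h where h: "h \<in> double_coset (GammaN N) hecke_mat" "X = {a ** h | a. a \<in> GammaN N}" by (auto simp: cosets_in_double_coset_def)
    then obtain i \<sigma> where "i \<in> rep_idx" "\<sigma> \<in> GammaN N" "h = \<sigma> ** coset_rep i" using double_coset_iff by blast
    then show "X \<in> coset ` rep_idx" using co h by blast
  next
    fix X assume "X \<in> coset ` rep_idx"
    then obtain i where i: "i \<in> rep_idx" "X = coset i" by blast
    have "coset_rep i = mat 1 ** coset_rep i" by simp
    then have "coset_rep i \<in> double_coset (GammaN N) hecke_mat" using double_coset_iff i GammaN_one by blast
    moreover have "X = {a ** coset_rep i | a. a \<in> GammaN N}" using i by (simp add: coset_def)
    ultimately show "X \<in> cosets_in_double_coset (GammaN N) hecke_mat" unfolding cosets_in_double_coset_def by blast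
  qed
qed

lemma coset_inj: "inj_on coset rep_idx"
proof (rule inj_onI)
  fix i j assume ij: "i \<in> rep_idx" "j \<in> rep_idx" "coset i = coset j"
  have "coset_rep i = mat 1 ** coset_rep i" by simp
  then have "coset_rep i \<in> coset i" unfolding coset_def using GammaN_one by blast
  then obtain \<sigma> where "\<sigma> \<in> GammaN N" "coset_rep i = \<sigma> ** coset_rep j" using ij by (auto simp: coset_def)
  then show "i = j" using rep_inj ij by blast
qed

lemma sim_real: "g \<in> GammaN N \<Longrightarrow> sim (of_real 1) g" "i \<in> rep_idx \<Longrightarrow> sim (of_real (real p)) (coset_rep i)"
  using hrep_rep by (auto simp: GammaN_def hrep_def)

context
  fixes F :: "mat2 \<Rightarrow> complex" and k :: int
  assumes inv: "\<And>g Z. g \<in> GammaN N \<Longrightarrow> Z \<in> H2 \<Longrightarrow> slash k F g Z = F Z"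
begin

lemma slash_GammaN_rep:
  assumes "\<sigma> \<in> GammaN N" "i \<in> rep_idx" "Z \<in> H2"
  shows "slash k F (\<sigma> ** coset_rep i) Z = slash k F (coset_rep i) Z"
proof -
  have p: "real p > 0" using p_pos by simp
  have "slash k F (\<sigma> ** coset_rep i) Z = slash k (slash k F \<sigma>) (coset_rep i) Z"
    using slash_slash[OF sim_real(1)[OF assms(1)] _ sim_real(2)[OF assms(2)] p assms(3)] by simp
  also have "\<dots> = slash k F (coset_rep i) Z"
    using inv[OF assms(1) moebius_in_H2[OF sim_real(2)[OF assms(2)] p assms(3)]] by (simp add: slash_def)
  finally show ?thesis .
qed

lemma sum_cosets:
  assumes "Z \<in> H2"
  shows "(\<Sum>X\<in>cosets_in_double_coset (GammaN N) hecke_mat. slash k F (SOME h. h \<in> X) Z) = (\<Sum>i\<in>rep_idx. slash k F (coset_rep i) Z)"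
proof -
  have "slash k F (SOME h. h \<in> coset i) Z = slash k F (coset_rep i) Z" if "i \<in> rep_idx" for i
  proof -
    have "(SOME h. h \<in> coset i) \<in> coset i"
      by (rule someI[of _ "mat 1 ** coset_rep i"]) (use GammaN_one in \<open>auto simp: coset_def simp del: matrix_mul_lid\<close>)
    then obtain \<sigma> where "\<sigma> \<in> GammaN N" "(SOME h. h \<in> coset i) = \<sigma> ** coset_rep i" by (auto simp: coset_def)
    then show ?thesis using slash_GammaN_rep that assms by simp
  qed
  then show ?thesis unfolding cosets_eq sum.reindex[OF coset_inj] by simp
qed

text \<open>Right multiplication by a group element permutes the left cosets in the double coset.\<close>

lemma sum_reps_invariant:
  assumes g: "g \<in> GammaN N" and Z: "Z \<in> H2"
  shows "slash k (\<lambda>Z. \<Sum>i\<in>rep_idx. slash k F (coset_rep i) Z) g Z = (\<Sum>i\<in>rep_idx. slash k F (coset_rep i) Z)"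
proof -
  have p: "real p > 0" using p_pos by simp
  have ex: "\<exists>j. j \<in> rep_idx \<and> (\<exists>\<sigma>\<in>GammaN N. coset_rep i ** g = \<sigma> ** coset_rep j)" if "i \<in> rep_idx" for i
  proof -
    have "coset_rep i = mat 1 ** coset_rep i" by simp
    then have "coset_rep i \<in> double_coset (GammaN N) hecke_mat" using that GammaN_one double_coset_iff by blast
    then obtain a b where ab: "a \<in> GammaN N" "b \<in> GammaN N" "coset_rep i = a ** hecke_mat ** b" by (auto simp: double_coset_def)
    then have "coset_rep i ** g = a ** hecke_mat ** (b ** g)" by (simp add: matrix_mul_assoc)
    then have "coset_rep i ** g \<in> double_coset (GammaN N) hecke_mat" using ab g GammaN_mult unfolding double_coset_def by blast
    then show ?thesis using double_coset_iff by blast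
  qed
  define \<pi> where "\<pi> i = (SOME j. j \<in> rep_idx \<and> (\<exists>\<sigma>\<in>GammaN N. coset_rep i ** g = \<sigma> ** coset_rep j))" for i
  have pi: "\<pi> i \<in> rep_idx \<and> (\<exists>\<sigma>\<in>GammaN N. coset_rep i ** g = \<sigma> ** coset_rep (\<pi> i))" if "i \<in> rep_idx" for i
    unfolding \<pi>_def using ex[OF that] by (rule someI_ex)
  have inj: "inj_on \<pi> rep_idx"
  proof (rule inj_onI)
    fix i j assume ij: "i \<in> rep_idx" "j \<in> rep_idx" "\<pi> i = \<pi> j"
    obtain \<sigma> where d: "\<sigma> \<in> GammaN N" "coset_rep i ** g = \<sigma> ** coset_rep (\<pi> i)" using pi ij by blast
    obtain \<epsilon> where e: "\<epsilon> \<in> GammaN N" "coset_rep j ** g = \<epsilon> ** coset_rep (\<pi> i)" using pi ij by metis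
    have A: "adjJ \<epsilon> ** (coset_rep j ** g) = coset_rep (\<pi> i)" using GammaN_adjJ(2)[OF e(1)] by (simp add: e(2) matrix_mul_assoc)
    have "coset_rep i ** g = \<sigma> ** (adjJ \<epsilon> ** (coset_rep j ** g))" unfolding A by (rule d(2))
    then have "coset_rep i ** g = (\<sigma> ** adjJ \<epsilon> ** coset_rep j) ** g" by (simp add: matrix_mul_assoc)
    then have "coset_rep i ** (g ** adjJ g) = (\<sigma> ** adjJ \<epsilon> ** coset_rep j) ** (g ** adjJ g)" by (simp add: matrix_mul_assoc)
    then have "coset_rep i = (\<sigma> ** adjJ \<epsilon>) ** coset_rep j" using GammaN_adjJ(3)[OF g] by simp
    moreover have "\<sigma> ** adjJ \<epsilon> \<in> GammaN N" using d e GammaN_mult GammaN_adjJ by blast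
    ultimately show "i = j" using rep_inj ij by blast
  qed
  have surj: "\<pi> ` rep_idx = rep_idx"
    by (rule endo_inj_surj) (use pi inj finite_rep_idx in auto)
  have "slash k (\<lambda>Z. \<Sum>i\<in>rep_idx. slash k F (coset_rep i) Z) g Z = (\<Sum>i\<in>rep_idx. slash k (slash k F (coset_rep i)) g Z)"
    by (simp add: slash_def sum_distrib_left)
  also have "\<dots> = (\<Sum>i\<in>rep_idx. slash k F (coset_rep (\<pi> i)) Z)"
  proof (rule sum.cong[OF refl])
    fix i assume i: "i \<in> rep_idx"
    have "slash k (slash k F (coset_rep i)) g Z = slash k F (coset_rep i ** g) Z"
      using slash_slash[OF sim_real(2)[OF i] p sim_real(1)[OF g] _ Z] by simp
    also obtain \<sigma> where "\<sigma> \<in> GammaN N" "coset_rep i ** g = \<sigma> ** coset_rep (\<pi> i)" using pi i by blast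
    then have "slash k F (coset_rep i ** g) Z = slash k F (coset_rep (\<pi> i)) Z" using slash_GammaN_rep pi i Z by simp
    finally show "slash k (slash k F (coset_rep i)) g Z = slash k F (coset_rep (\<pi> i)) Z" .
  qed
  also have "\<dots> = (\<Sum>i\<in>\<pi> ` rep_idx. slash k F (coset_rep i) Z)" by (simp add: sum.reindex[OF inj])
  finally show ?thesis by (simp add: surj)
qed

end

end

section \<open>Fourier coefficients of the image\<close>

lemma has_sum_sum:
  fixes f :: "'b \<Rightarrow> 'a \<Rightarrow> complex"
  assumes "finite B" "\<And>b. b \<in> B \<Longrightarrow> (f b has_sum s b) A"
  shows "((\<lambda>x. \<Sum>b\<in>B. f b x) has_sum (\<Sum>b\<in>B. s b)) A"
  using assms by (induction B) (auto intro: has_sum_add)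

lemma sum_mult_sum:
  fixes A :: "'p \<Rightarrow> complex" and B :: "'q \<Rightarrow> complex"
  shows "(\<Sum>a\<in>P. A a) * (\<Sum>b\<in>Q. B b) = (\<Sum>x\<in>P \<times> Q. A (fst x) * B (snd x))"
  by (simp only: sum_product sum.cartesian_product case_prod_unfold)

lemma trace_mult_commute: "trace (A ** B) = trace (B ** (A :: mat2))"
proof -
  obtain a b c d where A: "A = m2 a b c d" by (rule m2_cases)
  obtain a' b' c' d' where B: "B = m2 a' b' c' d'" by (rule m2_cases)
  show ?thesis by (simp add: A B m2_simps algebra_simps)
qed

lemma trace_scale: "trace (scale_mat c A) = c * trace (A :: mat2)"
  by (simp add: trace_def scale_mat_def sum_2 algebra_simps)

lemma trace_add: "trace (A + B) = trace A + trace (B :: mat2)"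
  by (simp add: trace_def sum_2)

lemma det_mat2: "det (mat x :: mat2) = x * x"
  by (simp add: m2_mat m2_det)

definition chi :: "mat2 \<Rightarrow> mat2 \<Rightarrow> complex" where
  "chi T Z = exp (2 * of_real pi * \<i> * trace (T ** Z))"

context imag_quad
begin

text \<open>The elements of \<open>S\<^sub>2\<close> in coordinates; dividing by \<open>\<delta>\<close> turns the off-diagonal condition into integrality of \<open>s\<close>.\<close>

definition hmat :: "int \<Rightarrow> complex \<Rightarrow> int \<Rightarrow> mat2" where
  "hmat l s m = m2 (of_int l) (s / \<delta>) (cnj (s / \<delta>)) (of_int m)"

definition S :: "mat2 set" where
  "S = {hmat l s m | l s m. s \<in> \<O>}"

lemma hmat_eq_iff [simp]: "hmat l s m = hmat l' s' m' \<longleftrightarrow> l = l' \<and> s = s' \<and> m = m'"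
  by (auto simp: hmat_def)

lemma hmat_S [simp]: "hmat l s m \<in> S \<longleftrightarrow> s \<in> \<O>"
  by (auto simp: S_def)

lemma S_E: assumes "T \<in> S" obtains l s m where "T = hmat l s m" "s \<in> \<O>"
  using assms by (auto simp: S_def)

lemma scale_hmat: "scale_mat (of_nat q) (hmat l s m) = hmat (int q * l) (of_nat q * s) (int q * m)"
  by (simp add: hmat_def m2_scale)

lemma scale_inv_S:
  assumes "s \<in> \<O>" "q > 0"
  shows "scale_mat (1 / of_nat q) (hmat l s m) \<in> S \<longleftrightarrow> int q dvd l \<and> s \<in> I q \<and> int q dvd m"
proof
  assume "scale_mat (1 / of_nat q) (hmat l s m) \<in> S"
  then obtain l' s' m' where h: "scale_mat (1 / of_nat q) (hmat l s m) = hmat l' s' m'" "s' \<in> \<O>" by (rule S_E)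
  have "hmat l s m = scale_mat (of_nat q) (scale_mat (1 / of_nat q) (hmat l s m))" using assms(2) by simp
  also have "\<dots> = hmat (int q * l') (of_nat q * s') (int q * m')" unfolding h(1) scale_hmat ..
  finally show "int q dvd l \<and> s \<in> I q \<and> int q dvd m" using h(2) by simp
next
  assume *: "int q dvd l \<and> s \<in> I q \<and> int q dvd m"
  then obtain l' s' m' where h: "l = int q * l'" "s = of_nat q * s'" "m = int q * m'" "s' \<in> \<O>"
    by (auto simp: I_def elim!: dvdE)
  have "scale_mat (1 / of_nat q) (hmat l s m) = scale_mat (1 / of_nat q) (scale_mat (of_nat q) (hmat l' s' m'))"
    unfolding scale_hmat h ..
  also have "\<dots> = hmat l' s' m'" using assms(2) by simp
  finally show "scale_mat (1 / of_nat q) (hmat l s m) \<in> S" using h by simp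
qed

end

context hecke_setup
begin

lemma p_ne [simp]: "p \<noteq> 0" "0 < p"
  using p_pos by simp_all

text \<open>Orthogonality of the additive characters modulo \<open>p\<close>.\<close>

lemma root_sum:
  "(\<Sum>b\<in>{0..<int p}. exp (2 * of_real pi * \<i> * (of_int l * of_int b / of_nat p))) = (if int p dvd l then of_nat p else 0)"
proof -
  define z where "z = exp (2 * of_real pi * \<i> * (of_int l / of_nat p))"
  have pw: "exp (2 * of_real pi * \<i> * (of_int l * of_nat b / of_nat p)) = z ^ b" for b
    unfolding z_def exp_of_nat_mult[symmetric] by (simp add: field_simps)
  have "(\<Sum>b\<in>{0..<int p}. exp (2 * of_real pi * \<i> * (of_int l * of_int b / of_nat p))) = (\<Sum>b<p. z ^ b)"
    by (rule sum.reindex_bij_witness[of _ int nat]) (auto simp: pw[symmetric])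
  also have "\<dots> = (if int p dvd l then of_nat p else 0)"
  proof (cases "int p dvd l")
    case True
    then obtain j where "l = int p * j" by blast
    then have "z = exp (2 * of_int j * of_real pi * \<i>)" by (simp add: z_def mult_ac)
    then have "z = 1" using exp_integer_2pi[of "of_int j"] by (simp add: mult_ac)
    then show ?thesis using True by simp
  next
    case False
    have "z \<noteq> 1"
    proof
      assume "z = 1"
      then obtain n :: int where "Im (2 * of_real pi * \<i> * (of_int l / of_nat p)) = of_int (2 * n) * pi"
        unfolding z_def exp_eq_1 by blast
      then have "real_of_int l = of_int n * real p" using p_pos by (simp add: field_simps Im_divide_of_nat)
      then have "real_of_int l = of_int (n * int p)" by simp
      then have "l = n * int p" by (simp only: of_int_eq_iff)
      then show False using False by simp
    qed
    moreover have "z ^ p = 1"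
    proof -
      have "z ^ p = exp (2 * of_int l * of_real pi * \<i>)" using pw[of p] by (simp add: mult_ac)
      then show ?thesis using exp_integer_2pi[of "of_int l"] by (simp add: mult_ac)
    qed
    ultimately show ?thesis using False geometric_sum[of z p] by simp
  qed
  finally show ?thesis .
qed

text \<open>Common mechanism for the three families: summing over the representatives with fixed diagonal blocks kills all indices \<open>T\<close>
for which \<open>low T\<close> is not integral, and the remaining series is reindexed by \<open>low T\<close>, with inverse \<open>lift\<close>.\<close>

lemma reindexed_has_sum:
  fixes c :: "mat2 \<Rightarrow> complex"
  assumes B: "finite B"
    and c: "\<And>Z. Z \<in> H2 \<Longrightarrow> ((\<lambda>T. c T * chi T Z) has_sum F Z) S"
    and W: "\<And>b. b \<in> B \<Longrightarrow> W b \<in> H2"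
    and inv1: "\<And>T. lift (low T) = T" and inv2: "\<And>T. low (lift T) = T"
    and char: "\<And>T. T \<in> S \<Longrightarrow> (\<Sum>b\<in>B. chi T (W b)) = (if low T \<in> S then n * chi (low T) Z else 0)"
  shows "((\<lambda>T. n * (if lift T \<in> S then c (lift T) else 0) * chi T Z) has_sum (\<Sum>b\<in>B. F (W b))) S"
proof -
  have "((\<lambda>T. \<Sum>b\<in>B. c T * chi T (W b)) has_sum (\<Sum>b\<in>B. F (W b))) S"
    by (rule has_sum_sum[OF B c[OF W]])
  then have "((\<lambda>T. c T * (if low T \<in> S then n * chi (low T) Z else 0)) has_sum (\<Sum>b\<in>B. F (W b))) S"
    by (rule has_sum_cong[THEN iffD1, rotated]) (simp flip: sum_distrib_left add: char)
  then have "((\<lambda>T. c T * (n * chi (low T) Z)) has_sum (\<Sum>b\<in>B. F (W b))) {T \<in> S. low T \<in> S}"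
    by (rule has_sum_cong_neutral[THEN iffD1, rotated -1]) auto
  then have "((\<lambda>T. n * c (lift T) * chi T Z) has_sum (\<Sum>b\<in>B. F (W b))) {T \<in> S. lift T \<in> S}"
    by (rule has_sum_reindex_bij_witness[where i = lift and j = low, THEN iffD1, rotated -1])
      (auto simp: inv1 inv2 mult_ac)
  then show ?thesis
    by (rule has_sum_cong_neutral[THEN iffD1, rotated -1]) auto
qed

text \<open>This is the index \<open>T\<^sub>U\<close> of the introduction. It is defined for every matrix, integral or not, so that \<open>low u\<close> below is its
inverse without side conditions.\<close>

definition lift :: "complex option \<Rightarrow> mat2 \<Rightarrow> mat2" where
  "lift u T = scale_mat (1 / of_nat p) (m2 (of_nat p) 0 0 1 ** (Uo u ** T ** ct (Uo u)) ** m2 (of_nat p) 0 0 1)"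

definition low :: "complex option \<Rightarrow> mat2 \<Rightarrow> mat2" where
  "low u T = ct (Uc u) ** scale_mat (of_nat p) (m2 (1 / of_nat p) 0 0 1 ** T ** m2 (1 / of_nat p) 0 0 1) ** Uc u"

lemma diag_p_inv: "m2 (of_nat p) 0 0 1 ** m2 (1 / of_nat p) 0 0 1 = mat 1" "m2 (1 / of_nat p) 0 0 1 ** m2 (of_nat p) 0 0 1 = mat 1"
  by (simp_all add: m2_simps m2_mat)

lemma lift_low: "lift u (low u T) = T"
proof -
  let ?P = "m2 (of_nat p) 0 0 1" and ?Q = "m2 (1 / of_nat p) 0 0 1"
  have "Uo u ** low u T ** ct (Uo u) = (Uo u ** ct (Uc u)) ** scale_mat (of_nat p) (?Q ** T ** ?Q) ** (Uc u ** ct (Uo u))"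
    unfolding low_def by (simp add: matrix_mul_assoc)
  also have "\<dots> = scale_mat (of_nat p) (?Q ** T ** ?Q)" by (simp add: Uo_Uc)
  finally have "lift u (low u T) = (?P ** ?Q) ** T ** (?Q ** ?P)"
    unfolding lift_def by (simp add: scale_mult_left scale_mult_right matrix_mul_assoc)
  then show ?thesis by (simp add: diag_p_inv)
qed

lemma low_lift: "low u (lift u T) = T"
proof -
  let ?P = "m2 (of_nat p) 0 0 1" and ?Q = "m2 (1 / of_nat p) 0 0 1"
  have "scale_mat (of_nat p) (?Q ** lift u T ** ?Q) = (?Q ** ?P) ** (Uo u ** T ** ct (Uo u)) ** (?P ** ?Q)"
    unfolding lift_def by (simp add: scale_mult_left scale_mult_right matrix_mul_assoc)
  also have "\<dots> = Uo u ** T ** ct (Uo u)" by (simp add: diag_p_inv)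
  finally have "low u (lift u T) = (ct (Uc u) ** Uo u) ** T ** (ct (Uo u) ** Uc u)"
    unfolding low_def by (simp add: matrix_mul_assoc)
  then show ?thesis by (simp add: Uo_Uc)
qed

text \<open>The three coordinates of \<open>U T U*\<close> for \<open>U = Uo u\<close>, see \<open>act_hmat\<close>.\<close>

definition aL :: "complex option \<Rightarrow> int \<Rightarrow> complex \<Rightarrow> int \<Rightarrow> int" where
  "aL u l s m = (case u of None \<Rightarrow> m | Some x \<Rightarrow> l)"
definition aS :: "complex option \<Rightarrow> int \<Rightarrow> complex \<Rightarrow> int \<Rightarrow> complex" where
  "aS u l s m = (case u of None \<Rightarrow> cnj s | Some x \<Rightarrow> s + of_int l * cnj x * \<delta>)"
definition aM :: "complex option \<Rightarrow> int \<Rightarrow> complex \<Rightarrow> int \<Rightarrow> int" where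
  "aM u l s m = (case u of None \<Rightarrow> l | Some x \<Rightarrow> l * nrm x + trd (s * x) + m)"

lemma act_hmat_gen:
  assumes "x \<in> \<O>" "s \<in> \<O>"
  shows "m2 1 0 x 1 ** hmat l s m ** ct (m2 1 0 x 1) = hmat l (s + of_int l * cnj x * \<delta>) (l * nrm x + trd (s * x) + m)"
  using assms by (simp add: hmat_def m2_simps of_int_nrm of_int_trd) (simp add: field_simps)

lemma act_hmat:
  assumes "u \<in> lines" "s \<in> \<O>"
  shows "Uo u ** hmat l s m ** ct (Uo u) = hmat (aL u l s m) (aS u l s m) (aM u l s m)"
proof (cases u)
  case None
  then show ?thesis by (simp add: Uo_def hmat_def m2_simps aL_def aS_def aM_def)
next
  case (Some x)
  then have "x \<in> \<O>" using assms residues_O by (auto simp: lines_def)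
  then show ?thesis using act_hmat_gen[OF _ assms(2)] by (simp add: Some Uo_def aL_def aS_def aM_def)
qed

lemma aS_O: "u \<in> lines \<Longrightarrow> s \<in> \<O> \<Longrightarrow> aS u l s m \<in> \<O>"
  using residues_O by (auto simp: aS_def lines_def)

lemma coact_S:
  assumes "u \<in> lines" "T \<in> S"
  shows "ct (Uc u) ** T ** Uc u \<in> S"
proof -
  obtain l s m where T: "T = hmat l s m" "s \<in> \<O>" using assms(2) by (rule S_E)
  show ?thesis
  proof (cases u)
    case None
    have "ct (Uc u) ** T ** Uc u = hmat m (cnj s) l"
      by (simp add: None T Uc_def hmat_def m2_simps)
    then show ?thesis using T by simp
  next
    case (Some x)
    then have x: "x \<in> \<O>" using assms residues_O by (auto simp: lines_def)
    have "ct (Uc u) ** T ** Uc u = m2 1 0 (- x) 1 ** hmat l s m ** ct (m2 1 0 (- x) 1)"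
      by (simp add: Some Uc_def T m2_ct)
    then show ?thesis using act_hmat_gen[of "- x" s l m] x T by simp
  qed
qed

lemma lift_S:
  assumes "u \<in> lines" "s \<in> \<O>"
  shows "lift u (hmat l s m) \<in> S \<longleftrightarrow> int p dvd aM u l s m"
    and "aM u l s m = int p * m' \<Longrightarrow> lift u (hmat l s m) = hmat (int p * aL u l s m) (aS u l s m) m'"
proof -
  have eq: "lift u (hmat l s m) = m2 (of_nat p * of_int (aL u l s m)) (aS u l s m / \<delta>) (cnj (aS u l s m / \<delta>)) (of_int (aM u l s m) / of_nat p)"
    unfolding lift_def act_hmat[OF assms] by (simp add: hmat_def m2_simps)
  then show 2: "lift u (hmat l s m) = hmat (int p * aL u l s m) (aS u l s m) m'" if "aM u l s m = int p * m'" for m'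
    using that by (simp add: hmat_def)
  show "lift u (hmat l s m) \<in> S \<longleftrightarrow> int p dvd aM u l s m"
  proof
    assume "lift u (hmat l s m) \<in> S"
    then obtain l' s' m' where "lift u (hmat l s m) = hmat l' s' m'" by (rule S_E)
    then have "of_int (aM u l s m) / of_nat p = (of_int m' :: complex)" unfolding eq by (simp add: hmat_def)
    then have "(of_int (aM u l s m) :: complex) = of_int (int p * m')" by (simp add: field_simps)
    then have "aM u l s m = int p * m'" by (simp only: of_int_eq_iff)
    then show "int p dvd aM u l s m" by simp
  next
    assume "int p dvd aM u l s m"
    then obtain m' where "aM u l s m = int p * m'" by blast
    then show "lift u (hmat l s m) \<in> S" using 2 aS_O assms by simp
  qed
qed

lemma low_S:
  assumes "u \<in> lines" "s \<in> \<O>"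
  shows "low u (hmat l s m) \<in> S \<longleftrightarrow> int p dvd l"
proof -
  have eq: "scale_mat (of_nat p) (m2 (1 / of_nat p) 0 0 1 ** hmat l s m ** m2 (1 / of_nat p) 0 0 1)
     = m2 (of_int l / of_nat p) (s / \<delta>) (cnj (s / \<delta>)) (of_nat p * of_int m)"
    by (simp add: hmat_def m2_simps)
  show ?thesis
  proof
    assume "low u (hmat l s m) \<in> S"
    then obtain l' s' m' where l': "low u (hmat l s m) = hmat l' s' m'" "s' \<in> \<O>" by (rule S_E)
    have "int p dvd aM u l' s' m'"
      using lift_S(1)[OF assms(1) l'(2), of l' m'] lift_low[of u "hmat l s m"] l' assms by simp
    then obtain m'' where "aM u l' s' m' = int p * m''" by blast
    then have "lift u (hmat l' s' m') = hmat (int p * aL u l' s' m') (aS u l' s' m') m''" by (rule lift_S(2)[OF assms(1) l'(2)])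
    then have "hmat l s m = hmat (int p * aL u l' s' m') (aS u l' s' m') m''" using lift_low[of u "hmat l s m"] l' by simp
    then show "int p dvd l" by simp
  next
    assume "int p dvd l"
    then obtain l1 where "l = int p * l1" by blast
    then have "m2 (of_int l / of_nat p) (s / \<delta>) (cnj (s / \<delta>)) (of_nat p * of_int m) = hmat l1 s (int p * m)"
      by (simp add: hmat_def)
    then show "low u (hmat l s m) \<in> S" unfolding low_def eq using coact_S[OF assms(1)] assms(2) by simp
  qed
qed

definition hecke_coeff :: "int \<Rightarrow> (mat2 \<Rightarrow> complex) \<Rightarrow> mat2 \<Rightarrow> complex" where
  "hecke_coeff k c T = of_nat p powi (4 - 2 * k) * c (scale_mat (of_nat p) T)
     + of_nat p powi (1 - k) * (\<Sum>u\<in>lines. if lift u T \<in> S then c (lift u T) else 0)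
     + (if scale_mat (1 / of_nat p) T \<in> S then c (scale_mat (1 / of_nat p) T) else 0)"

context
  fixes F :: "mat2 \<Rightarrow> complex" and c :: "mat2 \<Rightarrow> complex" and k :: int
  assumes c: "\<And>Z. Z \<in> H2 \<Longrightarrow> ((\<lambda>T. c T * chi T Z) has_sum F Z) S"
begin

lemma slash_rep:
  assumes "i \<in> rep_idx" "Z \<in> H2" "W ** block_D (coset_rep i) = block_A (coset_rep i) ** Z + block_B (coset_rep i)"
  shows "slash k F (coset_rep i) Z = det (block_D (coset_rep i)) powi (- k) * F W" "W \<in> H2"
proof -
  have p: "real p > 0" using p_pos by simp
  have aut: "automorphy (coset_rep i) Z = block_D (coset_rep i)"
    using hrep_rep[OF assms(1)] by (simp add: automorphy_def hrep_def)
  have "invertible (automorphy (coset_rep i) Z)"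
    by (rule automorphy_invertible[OF sim_real(2)[OF assms(1)] p assms(2)])
  then have m: "moebius (coset_rep i) Z = W" by (rule moebius_eqI) (use assms(3) aut in simp)
  then show "slash k F (coset_rep i) Z = det (block_D (coset_rep i)) powi (- k) * F W"
    by (simp add: slash_def aut)
  show "W \<in> H2" unfolding m[symmetric] by (rule moebius_in_H2[OF sim_real(2)[OF assms(1)] p assms(2)])
qed

text \<open>The sum over hermitian translations factors into four character sums, one for each coordinate. They detect divisibility
of \<open>l\<close>, \<open>m\<close> and both coordinates of \<open>s\<close>, that is, of \<open>T\<close>.\<close>

lemma fourier_type0:
  assumes Z: "Z \<in> H2"
  shows "((\<lambda>T. of_nat p powi (4 - 2 * k) * c (scale_mat (of_nat p) T) * chi T Z) has_sum (\<Sum>B\<in>Herm. slash k F (coset_rep (Inl B)) Z)) S"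
proof -
  define W where "W B = scale_mat (1 / of_nat p) (Z + B)" for B
  have W: "slash k F (coset_rep (Inl B)) Z = of_nat p powi (- 2 * k) * F (W B) \<and> W B \<in> H2" if "B \<in> Herm" for B
  proof -
    have i: "Inl B \<in> rep_idx" using that by (auto simp: rep_idx_def)
    have "W B ** block_D (coset_rep (Inl B)) = block_A (coset_rep (Inl B)) ** Z + block_B (coset_rep (Inl B))"
      by (simp add: W_def mat_mult_right)
    moreover have "det (mat (of_nat p) :: mat2) powi (- k) = of_nat p powi (- 2 * k)"
      using power_int_mult[of "of_nat p :: complex" 2 "- k"] by (simp add: det_mat2 power2_eq_square)
    ultimately show ?thesis using slash_rep[OF i Z] by simp
  qed
  have char: "(\<Sum>B\<in>Herm. chi T (W B)) = (if scale_mat (1 / of_nat p) T \<in> S then of_nat p ^ 4 * chi (scale_mat (1 / of_nat p) T) Z else 0)"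
    if T: "T \<in> S" for T
  proof -
    obtain l s m where Tm: "T = hmat l s m" and s: "s \<in> \<O>" using T by (rule S_E)
    obtain e f where ef: "s = of_int e + of_int f * \<omega>" using s by (rule O_E)
    define X where "X j b = exp (2 * of_real pi * \<i> * (of_int j * of_int b / of_nat p))" for j b :: int
    have trw: "trd (s * cnj (of_int a + of_int b * \<omega>)) = f * a + - e * b" for a b
    proof -
      have w: "\<omega> * cnj \<omega> = of_int \<nu>" by (simp add: cnj_omega right_diff_distrib omega_sq mult.commute)
      have "s * cnj (of_int a + of_int b * \<omega>) = of_int a * s + of_int b * of_int e * cnj \<omega> + of_int b * of_int f * (\<omega> * cnj \<omega>)"
        by (simp add: ef algebra_simps)
      also have "\<dots> = of_int (a * e + b * e * \<tau> + b * f * \<nu>) + of_int (a * f - b * e) * \<omega>"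
        unfolding w by (simp add: ef cnj_omega algebra_simps)
      finally have eq: "s * cnj (of_int a + of_int b * \<omega>) = of_int (a * e + b * e * \<tau> + b * f * \<nu>) + of_int (a * f - b * e) * \<omega>" .
      show ?thesis unfolding eq trd_coord by (simp add: algebra_simps)
    qed
    have one: "chi T (W (m2 (of_int a) (of_int x + of_int y * \<omega>) (cnj (of_int x + of_int y * \<omega>)) (of_int d)))
       = chi (scale_mat (1 / of_nat p) T) Z * (X l a * X m d * (X f x * X (- e) y))" for a d x y
    proof -
      let ?x = "of_int x + of_int y * \<omega>"
      have "s * cnj ?x / \<delta> + cnj (s * cnj ?x / \<delta>) = of_int (f * x + - e * y)"
      proof -
        have "s * cnj ?x \<in> \<O>" using s by (intro O_mult O_cnj O_coord)
        from of_int_trd[OF this] show ?thesis unfolding trw by (rule sym)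
      qed
      then have t: "s / \<delta> * cnj ?x + cnj (s / \<delta>) * ?x = of_int (f * x + - e * y)"
        by simp
      have "trace (T ** m2 (of_int a) ?x (cnj ?x) (of_int d)) = of_int l * of_int a + of_int m * of_int d + (s / \<delta> * cnj ?x + cnj (s / \<delta>) * ?x)"
        unfolding Tm hmat_def m2_mult m2_trace by (simp only: algebra_simps)
      then have "trace (T ** m2 (of_int a) ?x (cnj ?x) (of_int d)) = of_int l * of_int a + of_int m * of_int d + (of_int f * of_int x + of_int (- e) * of_int y)"
        unfolding t by simp
      then have tr: "trace (T ** W (m2 (of_int a) ?x (cnj ?x) (of_int d))) = trace (scale_mat (1 / of_nat p) T ** Z)
          + of_int l * of_int a / of_nat p + of_int m * of_int d / of_nat p + (of_int f * of_int x / of_nat p + of_int (- e) * of_int y / of_nat p)"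
        unfolding W_def scale_mult_right scale_mult_left trace_scale mult_add_right trace_add
        by (simp add: add_divide_distrib diff_divide_distrib)
      show ?thesis by (simp only: chi_def X_def tr distrib_left exp_add mult.assoc)
    qed
    have "(\<Sum>B\<in>Herm. chi T (W B)) = (\<Sum>((a, d), (x, y))\<in>({0..<int p} \<times> {0..<int p}) \<times> ({0..<int p} \<times> {0..<int p}).
        chi (scale_mat (1 / of_nat p) T) Z * (X l a * X m d * (X f x * X (- e) y)))"
    proof -
      have H: "Herm = (\<lambda>((a, d), (x, y)). m2 (of_int a) (of_int x + of_int y * \<omega>) (cnj (of_int x + of_int y * \<omega>)) (of_int d)) `
        (({0..<int p} \<times> {0..<int p}) \<times> ({0..<int p} \<times> {0..<int p}))"
        unfolding Herm_def residues_def by (force simp: image_iff)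
      have inj: "inj_on (\<lambda>((a, d), (x, y)). m2 (of_int a) (of_int x + of_int y * \<omega>) (cnj (of_int x + of_int y * \<omega>)) (of_int d))
        (({0..<int p} \<times> {0..<int p}) \<times> ({0..<int p} \<times> {0..<int p}))"
        by (auto simp: inj_on_def dest: coord_unique)
      show ?thesis unfolding H sum.reindex[OF inj] by (intro sum.cong refl) (simp only: comp_def case_prod_unfold one)
    qed
    also have "\<dots> = chi (scale_mat (1 / of_nat p) T) Z * (((\<Sum>a\<in>{0..<int p}. X l a) * (\<Sum>d\<in>{0..<int p}. X m d)) * ((\<Sum>x\<in>{0..<int p}. X f x) * (\<Sum>y\<in>{0..<int p}. X (- e) y)))"
    proof -
      show ?thesis unfolding sum_mult_sum unfolding sum_distrib_left by (intro sum.cong refl) (simp only: case_prod_unfold)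
    qed
    also have "\<dots> = (if int p dvd l \<and> int p dvd m \<and> int p dvd f \<and> int p dvd e then of_nat p ^ 4 * chi (scale_mat (1 / of_nat p) T) Z else 0)"
      unfolding X_def root_sum by (auto simp: power4_eq_xxxx)
    also have "int p dvd l \<and> int p dvd m \<and> int p dvd f \<and> int p dvd e \<longleftrightarrow> scale_mat (1 / of_nat p) T \<in> S"
      unfolding Tm scale_inv_S[OF s p_pos] unfolding ef coord_in_I by blast
    finally show ?thesis .
  qed
  have "((\<lambda>T. of_nat p ^ 4 * (if scale_mat (of_nat p) T \<in> S then c (scale_mat (of_nat p) T) else 0) * chi T Z) has_sum (\<Sum>B\<in>Herm. F (W B))) S"
    by (rule reindexed_has_sum[where low = "scale_mat (1 / of_nat p)"]) (use c W char in \<open>auto simp: Herm_def\<close>)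
  then have "((\<lambda>T. of_nat p powi (- 2 * k) * (of_nat p ^ 4 * (if scale_mat (of_nat p) T \<in> S then c (scale_mat (of_nat p) T) else 0) * chi T Z)) has_sum of_nat p powi (- 2 * k) * (\<Sum>B\<in>Herm. F (W B))) S"
    by (rule has_sum_cmult_right)
  also have "of_nat p powi (- 2 * k) * (\<Sum>B\<in>Herm. F (W B)) = (\<Sum>B\<in>Herm. slash k F (coset_rep (Inl B)) Z)"
    unfolding sum_distrib_left using W by (intro sum.cong refl) simp
  finally show ?thesis
  proof (rule has_sum_cong[THEN iffD1, rotated])
    fix T assume "T \<in> S"
    then have "scale_mat (of_nat p) T \<in> S" by (auto elim!: S_E simp: scale_hmat)
    moreover have "of_nat p powi (- 2 * k) * of_nat p ^ 4 = (of_nat p powi (4 - 2 * k) :: complex)"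
      using power_int_add[of "of_nat p :: complex" "- 2 * k" 4] by (simp add: algebra_simps)
    ultimately show "of_nat p powi (- 2 * k) * (of_nat p ^ 4 * (if scale_mat (of_nat p) T \<in> S then c (scale_mat (of_nat p) T) else 0) * chi T Z)
      = of_nat p powi (4 - 2 * k) * c (scale_mat (of_nat p) T) * chi T Z" by (simp flip: mult.assoc)
  qed
qed

text \<open>In the coordinates \<open>Y = Uc Z Uc*\<close> the representative maps \<open>Z\<close> to \<open>diag(1,p) Y diag(1/p,1)\<close> plus a translation in the first
diagonal entry only, so the character sum detects divisibility of \<open>l\<close> alone.\<close>

lemma fourier_type1:
  assumes Z: "Z \<in> H2" and u: "u \<in> lines"
  shows "((\<lambda>T. of_nat p powi (1 - k) * (if lift u T \<in> S then c (lift u T) else 0) * chi T Z) has_sum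
    (\<Sum>b\<in>{0..<int p}. slash k F (coset_rep (Inr (Inl (u, b)))) Z)) S"
proof -
  let ?Q = "m2 (1 / of_nat p) 0 0 1"
  define Y where "Y = Uc u ** Z ** ct (Uc u)"
  define W where "W b = m2 1 0 0 (of_nat p) ** Y ** ?Q + m2 (of_int b / of_nat p) 0 0 0" for b :: int
  have det1: "det (Uo u) = 1" by (cases u) (simp_all add: Uo_def m2_det)
  have W: "slash k F (coset_rep (Inr (Inl (u, b)))) Z = of_nat p powi (- k) * F (W b) \<and> W b \<in> H2" if "b \<in> {0..<int p}" for b
  proof -
    have i: "Inr (Inl (u, b)) \<in> rep_idx" using that u by (auto simp: rep_idx_def)
    have "W b ** (m2 (of_nat p) 0 0 1 ** Uo u) = m2 1 0 0 (of_nat p) ** Uc u ** Z ** ct (Uc u) ** (?Q ** m2 (of_nat p) 0 0 1) ** Uo u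
       + (m2 (of_int b / of_nat p) 0 0 0 ** m2 (of_nat p) 0 0 1) ** Uo u"
      by (simp add: W_def Y_def mult_add_left matrix_mul_assoc)
    also have "\<dots> = m2 1 0 0 (of_nat p) ** Uc u ** Z ** (ct (Uc u) ** Uo u) + m2 (of_int b) 0 0 0 ** Uo u"
      unfolding diag_p_inv by (simp add: m2_mult matrix_mul_assoc)
    also have "\<dots> = m2 1 0 0 (of_nat p) ** Uc u ** Z + m2 (of_int b) 0 0 0 ** Uo u" by (simp add: Uo_Uc)
    finally have "W b ** block_D (coset_rep (Inr (Inl (u, b)))) = block_A (coset_rep (Inr (Inl (u, b)))) ** Z + block_B (coset_rep (Inr (Inl (u, b))))" by simp
    then show ?thesis using slash_rep[OF i Z] by (simp add: det_mul m2_det det1)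
  qed
  have char: "(\<Sum>b\<in>{0..<int p}. chi T (W b)) = (if low u T \<in> S then of_nat p * chi (low u T) Z else 0)"
    if T: "T \<in> S" for T
  proof -
    obtain l s m where Tm: "T = hmat l s m" and s: "s \<in> \<O>" using T by (rule S_E)
    have "trace (low u T ** Z) = trace (scale_mat (of_nat p) (?Q ** T ** ?Q) ** Y)"
    proof -
      have "trace (low u T ** Z) = trace (ct (Uc u) ** (scale_mat (of_nat p) (?Q ** T ** ?Q) ** Uc u ** Z))"
        by (simp add: low_def matrix_mul_assoc)
      also have "\<dots> = trace (scale_mat (of_nat p) (?Q ** T ** ?Q) ** Uc u ** Z ** ct (Uc u))" by (rule trace_mult_commute)
      finally show ?thesis by (simp add: Y_def matrix_mul_assoc)
    qed
    also have "\<dots> = trace (T ** (scale_mat (of_nat p) ?Q ** Y ** ?Q))"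
    proof -
      have "trace (scale_mat (of_nat p) (?Q ** T ** ?Q) ** Y) = trace (scale_mat (of_nat p) ?Q ** (T ** ?Q ** Y))"
        by (simp add: scale_mult_left matrix_mul_assoc)
      also have "\<dots> = trace (T ** ?Q ** Y ** scale_mat (of_nat p) ?Q)" by (rule trace_mult_commute)
      also have "\<dots> = trace (T ** (?Q ** (Y ** scale_mat (of_nat p) ?Q)))" by (simp add: matrix_mul_assoc)
      also have "\<dots> = trace (T ** (scale_mat (of_nat p) ?Q ** Y ** ?Q))"
        by (simp add: scale_mult_left scale_mult_right matrix_mul_assoc)
      finally show ?thesis .
    qed
    also have "scale_mat (of_nat p) ?Q = m2 1 0 0 (of_nat p)" by (simp add: m2_scale)
    finally have "trace (T ** W b) = trace (low u T ** Z) + of_int l * of_int b / of_nat p" for b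
      by (simp add: W_def mult_add_right trace_add) (simp add: Tm hmat_def m2_simps)
    then have "(\<Sum>b\<in>{0..<int p}. chi T (W b)) = (\<Sum>b\<in>{0..<int p}. chi (low u T) Z * exp (2 * of_real pi * \<i> * (of_int l * of_int b / of_nat p)))"
      unfolding chi_def by (simp add: distrib_left exp_add)
    also have "\<dots> = chi (low u T) Z * (if int p dvd l then of_nat p else 0)"
      unfolding sum_distrib_left[symmetric] root_sum ..
    finally show ?thesis using low_S[OF u s, of l m] by (simp add: Tm mult.commute)
  qed
  have "((\<lambda>T. of_nat p * (if lift u T \<in> S then c (lift u T) else 0) * chi T Z) has_sum (\<Sum>b\<in>{0..<int p}. F (W b))) S"
    by (rule reindexed_has_sum[where low = "low u"]) (use c W char lift_low low_lift in auto)
  then have "((\<lambda>T. of_nat p powi (- k) * (of_nat p * (if lift u T \<in> S then c (lift u T) else 0) * chi T Z)) has_sum of_nat p powi (- k) * (\<Sum>b\<in>{0..<int p}. F (W b))) S"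
    by (rule has_sum_cmult_right)
  also have "of_nat p powi (- k) * (\<Sum>b\<in>{0..<int p}. F (W b)) = (\<Sum>b\<in>{0..<int p}. slash k F (coset_rep (Inr (Inl (u, b)))) Z)"
    unfolding sum_distrib_left using W by (intro sum.cong refl) simp
  also have "(of_nat p powi (- k) * of_nat p :: complex) = of_nat p powi (1 - k)"
    using power_int_add[of "of_nat p :: complex" "- k" 1] by simp
  then have "(\<lambda>T. of_nat p powi (- k) * (of_nat p * (if lift u T \<in> S then c (lift u T) else 0) * chi T Z)) =
      (\<lambda>T. of_nat p powi (1 - k) * (if lift u T \<in> S then c (lift u T) else 0) * chi T Z)"
    by (simp flip: mult.assoc)
  finally show ?thesis .
qed

lemma fourier_type2:
  assumes Z: "Z \<in> H2"
  shows "((\<lambda>T. (if scale_mat (1 / of_nat p) T \<in> S then c (scale_mat (1 / of_nat p) T) else 0) * chi T Z) has_sum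
    slash k F (coset_rep (Inr (Inr ()))) Z) S"
proof -
  define W where "W = (\<lambda>_ :: unit. scale_mat (of_nat p) Z)"
  have i: "Inr (Inr ()) \<in> rep_idx" by (auto simp: rep_idx_def)
  have "W () ** block_D (coset_rep (Inr (Inr ()))) = block_A (coset_rep (Inr (Inr ()))) ** Z + block_B (coset_rep (Inr (Inr ())))"
    by (simp add: W_def mat_mult_left)
  then have W: "slash k F (coset_rep (Inr (Inr ()))) Z = F (W ()) \<and> W () \<in> H2"
    using slash_rep[OF i Z] by simp
  have char: "(\<Sum>b\<in>{()}. chi T (W b)) = (if scale_mat (of_nat p) T \<in> S then 1 * chi (scale_mat (of_nat p) T) Z else 0)"
    if T: "T \<in> S" for T
    using that by (auto elim!: S_E simp: scale_hmat) (simp add: chi_def W_def scale_mult_right flip: scale_hmat scale_mult_left)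
  have "((\<lambda>T. 1 * (if scale_mat (1 / of_nat p) T \<in> S then c (scale_mat (1 / of_nat p) T) else 0) * chi T Z) has_sum (\<Sum>b\<in>{()}. F (W b))) S"
    by (rule reindexed_has_sum[where low = "scale_mat (of_nat p)"]) (use c W char in auto)
  then show ?thesis using W by simp
qed

lemma fourier_hecke:
  assumes Z: "Z \<in> H2"
  shows "((\<lambda>T. hecke_coeff k c T * chi T Z) has_sum (\<Sum>i\<in>rep_idx. slash k F (coset_rep i) Z)) S"
proof -
  have fU: "finite lines" by (simp add: lines_def)
  have "((\<lambda>T. \<Sum>u\<in>lines. of_nat p powi (1 - k) * (if lift u T \<in> S then c (lift u T) else 0) * chi T Z) has_sum
    (\<Sum>u\<in>lines. \<Sum>b\<in>{0..<int p}. slash k F (coset_rep (Inr (Inl (u, b)))) Z)) S"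
    by (rule has_sum_sum[OF fU fourier_type1[OF Z]])
  from has_sum_add[OF has_sum_add[OF fourier_type0[OF Z] this] fourier_type2[OF Z]]
  have "((\<lambda>T. hecke_coeff k c T * chi T Z) has_sum (\<Sum>B\<in>Herm. slash k F (coset_rep (Inl B)) Z) +
     (\<Sum>u\<in>lines. \<Sum>b\<in>{0..<int p}. slash k F (coset_rep (Inr (Inl (u, b)))) Z) + slash k F (coset_rep (Inr (Inr ()))) Z) S"
    by (rule has_sum_cong[THEN iffD1, rotated])
      (simp only: hecke_coeff_def sum_distrib_left sum_distrib_right distrib_right)
  also have "(\<Sum>B\<in>Herm. slash k F (coset_rep (Inl B)) Z) +
     (\<Sum>u\<in>lines. \<Sum>b\<in>{0..<int p}. slash k F (coset_rep (Inr (Inl (u, b)))) Z) + slash k F (coset_rep (Inr (Inr ()))) Z = (\<Sum>i\<in>rep_idx. slash k F (coset_rep i) Z)"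
    unfolding rep_idx_def using fU
    by (simp add: sum.Plus Herm_def sum.cartesian_product add.assoc comp_def case_prod_unfold del: coset_rep.simps)
  finally show ?thesis .
qed

end
end

section \<open>Contents and counting of neighbouring forms\<close>

lemma psd_congruence:
  assumes "pos_semidef_hermitian T" "r \<ge> 0"
  shows "pos_semidef_hermitian (scale_mat (of_real r) (ct M ** T ** (M :: mat2)))"
  using assms unfolding pos_semidef_hermitian_def
  by (simp add: ct_scale ct_mult matrix_mul_assoc herm_form_scale herm_form_congruence)

text \<open>Test the form on \<open>(-b, a)\<close>; when \<open>a = 0\<close>, the vectors \<open>(-tb, 1)\<close> with large \<open>t\<close> force \<open>b = 0\<close>.\<close>

lemma psd_det_nonneg:
  assumes "pos_semidef_hermitian (m2 (of_real a) b (cnj b) (of_real d))"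
  shows "0 \<le> a * d - (cmod b)\<^sup>2"
proof -
  define Y where "Y = m2 (of_real a) b (cnj b) (of_real d)"
  have pos: "0 \<le> Re (herm_form Y v)" for v using assms by (simp add: pos_semidef_hermitian_def Y_def)
  have a: "0 \<le> a" using pos[of "vector [1, 0]"] by (simp add: Y_def Re_herm_form_m2)
  show ?thesis
  proof (cases "a = 0")
    case False
    have "0 \<le> a * Re (herm_form Y (vector [- b, of_real a]))" using a pos by simp
    also have "\<dots> = (a * d - (cmod b)\<^sup>2) * a\<^sup>2"
      unfolding Y_def Re_herm_form_complete_square by simp
    finally show ?thesis using a False by (simp add: zero_le_mult_iff)
  next
    case True
    have le: "0 \<le> d - 2 * t * (cmod b)\<^sup>2" for t
    proof -
      have "0 \<le> Re (herm_form Y (vector [- of_real t * b, 1]))" by (rule pos)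
      also have "\<dots> = d - 2 * t * (cmod b)\<^sup>2"
        unfolding Y_def Re_herm_form_m2 True cmod_power2 by (simp add: algebra_simps power2_eq_square)
      finally show ?thesis .
    qed
    have "b = 0"
    proof (rule ccontr)
      assume "b \<noteq> 0"
      then have "0 < (cmod b)\<^sup>2" by simp
      then have "d - 2 * ((d + 1) / (2 * (cmod b)\<^sup>2)) * (cmod b)\<^sup>2 = - 1" by (simp add: field_simps)
      then show False using le[of "(d + 1) / (2 * (cmod b)\<^sup>2)"] by simp
    qed
    then show ?thesis using True by simp
  qed
qed

context imag_quad
begin

text \<open>The integer \<open>D det T\<close>.\<close>

definition Ddet :: "int \<Rightarrow> complex \<Rightarrow> int \<Rightarrow> int" where
  "Ddet l s m = int D * l * m - nrm s"

definition dvd_hmat :: "nat \<Rightarrow> int \<Rightarrow> complex \<Rightarrow> int \<Rightarrow> bool" where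
  "dvd_hmat q l s m \<longleftrightarrow> int q dvd l \<and> s \<in> I q \<and> int q dvd m"

lemma det_hmat: "s \<in> \<O> \<Longrightarrow> of_nat D * det (hmat l s m) = of_int (Ddet l s m)"
proof -
  assume s: "s \<in> \<O>"
  have d: "of_nat D = - (\<delta> * \<delta>)" by (simp add: delta_sq)
  show ?thesis using s by (simp add: hmat_def m2_det Ddet_def of_int_nrm d field_simps)
qed

lemma Ddet_nonneg:
  assumes "s \<in> \<O>" "pos_semidef_hermitian (hmat l s m)"
  shows "0 \<le> Ddet l s m"
proof -
  have "0 \<le> real_of_int l * real_of_int m - (cmod (s / \<delta>))\<^sup>2"
    using assms(2) psd_det_nonneg[of "real_of_int l" "s / \<delta>" "real_of_int m"] by (simp add: hmat_def)
  then have "0 \<le> real D * (real_of_int l * real_of_int m - (cmod (s / \<delta>))\<^sup>2)" by simp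
  also have "\<dots> = real_of_int (Ddet l s m)"
  proof -
    have "of_real (real D * (real_of_int l * real_of_int m - (cmod (s / \<delta>))\<^sup>2)) = of_nat D * det (hmat l s m)"
    proof -
      have "of_real ((cmod (s / \<delta>))\<^sup>2) = s / \<delta> * cnj (s / \<delta>)" by (rule complex_norm_square)
      then show ?thesis by (simp add: hmat_def m2_det del: complex_cnj_divide)
    qed
    also have "\<dots> = of_real (real_of_int (Ddet l s m))" using det_hmat[OF assms(1)] by simp
    finally show ?thesis by (simp only: of_real_eq_iff)
  qed
  finally show ?thesis by simp
qed

lemma hmat_zero: "hmat l s m = 0 \<longleftrightarrow> l = 0 \<and> s = 0 \<and> m = 0"
  by (auto simp: hmat_def m2_zero)

text \<open>The content is the greatest common divisor of \<open>l\<close>, \<open>m\<close> and the two coordinates of \<open>s\<close>.\<close>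

lemma content_exists:
  assumes s: "s \<in> \<O>" and nz: "\<not> (l = 0 \<and> s = 0 \<and> m = 0)"
  obtains g where "g > 0" "\<And>q. dvd_hmat q l s m \<longleftrightarrow> q dvd g"
proof -
  obtain e f where ef: "s = of_int e + of_int f * \<omega>" using s by (rule O_E)
  define g where "g = gcd (gcd l m) (gcd e f)"
  have "g \<noteq> 0" using nz by (auto simp: g_def ef)
  then have hecke_mat: "nat g > 0" by (simp add: g_def)
  have "dvd_hmat q l s m \<longleftrightarrow> q dvd nat g" for q
  proof -
    have "dvd_hmat q l s m \<longleftrightarrow> int q dvd g" unfolding dvd_hmat_def ef coord_in_I g_def by auto
    also have "\<dots> \<longleftrightarrow> int q dvd int (nat g)" using hecke_mat by simp
    finally show ?thesis by (simp only: int_dvd_int_iff)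
  qed
  then show ?thesis using hecke_mat that by blast
qed

lemma dvd_hmat_sq: 
  assumes "dvd_hmat q l s m" "s \<in> \<O>" shows "int q ^ 2 dvd Ddet l s m"
proof -
  obtain l' s' m' where h: "l = int q * l'" "s = of_nat q * s'" "m = int q * m'" "s' \<in> \<O>"
    using assms(1) by (auto simp: dvd_hmat_def I_def elim!: dvdE)
  have "nrm s = int q * int q * nrm s'"
    using nrm_mult[of "of_int (int q)" s'] nrm_int[of "int q"] h by simp
  then have "Ddet l s m = int q ^ 2 * Ddet l' s' m'"
    by (simp add: Ddet_def h power2_eq_square algebra_simps)
  then show ?thesis by simp
qed

lemma Ddet_scale: "s \<in> \<O> \<Longrightarrow> Ddet (int q * l) (of_nat q * s) (int q * m) = int q ^ 2 * Ddet l s m"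
  using nrm_mult[of "of_int (int q)" s] nrm_int[of "int q"]
  by (simp add: Ddet_def power2_eq_square algebra_simps)

text \<open>The summation range in the Maass relation: divisors of the content that are prime to the level.\<close>

definition divs :: "nat \<Rightarrow> int \<Rightarrow> complex \<Rightarrow> int \<Rightarrow> nat set" where
  "divs N l s m = {d. d > 0 \<and> dvd_hmat d l s m \<and> coprime d N}"

definition maass_sum :: "int \<Rightarrow> nat \<Rightarrow> (nat \<Rightarrow> complex) \<Rightarrow> int \<Rightarrow> complex \<Rightarrow> int \<Rightarrow> complex" where
  "maass_sum k N \<alpha> l s m = (\<Sum>d\<in>divs N l s m. of_nat d powi (k - 1) * \<alpha> (nat (Ddet l s m div (int d)\<^sup>2)))"

lemma dvd_hmat_iff_S: "s \<in> \<O> \<Longrightarrow> q > 0 \<Longrightarrow> scale_mat (1 / of_nat q) (hmat l s m) \<in> S \<longleftrightarrow> dvd_hmat q l s m"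
  unfolding dvd_hmat_def by (rule scale_inv_S)

lemma dvd_hmat_scale:
  assumes "n > 0" "s \<in> \<O>"
  shows "dvd_hmat (n * q) (int n * l) (of_nat n * s) (int n * m) \<longleftrightarrow> dvd_hmat q l s m"
  using assms by (simp add: dvd_hmat_def I_scale_iff)

lemma dvd_hmat_scale_coprime:
  assumes "s \<in> \<O>" "coprime q n"
  shows "dvd_hmat q (int n * l) (of_nat n * s) (int n * m) \<longleftrightarrow> dvd_hmat q l s m"
proof
  assume "dvd_hmat q (int n * l) (of_nat n * s) (int n * m)"
  then show "dvd_hmat q l s m" using I_cancel[of n s q] assms
    by (auto simp: dvd_hmat_def coprime_dvd_mult_right_iff)
next
  assume "dvd_hmat q l s m"
  then show "dvd_hmat q (int n * l) (of_nat n * s) (int n * m)" using I_mult1[of "of_nat n" s q] by (auto simp: dvd_hmat_def)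
qed

end

context hecke_setup
begin

text \<open>Both \<open>U\<close> and its inverse are integral, so \<open>T\<close> and \<open>U T U*\<close> have the same content.\<close>

lemma dvd_hmat_act:
  assumes "u \<in> lines" "s \<in> \<O>" "q > 0"
  shows "dvd_hmat q (aL u l s m) (aS u l s m) (aM u l s m) \<longleftrightarrow> dvd_hmat q l s m"
proof
  assume "dvd_hmat q l s m"
  then have "scale_mat (1 / of_nat q) (hmat l s m) \<in> S" by (simp only: dvd_hmat_iff_S[OF assms(2,3)])
  then obtain l' s' m' where h: "scale_mat (1 / of_nat q) (hmat l s m) = hmat l' s' m'" "s' \<in> \<O>" by (rule S_E)
  have "scale_mat (1 / of_nat q) (hmat (aL u l s m) (aS u l s m) (aM u l s m)) = Uo u ** scale_mat (1 / of_nat q) (hmat l s m) ** ct (Uo u)"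
    unfolding act_hmat[OF assms(1,2), symmetric] by (simp add: scale_mult_left scale_mult_right)
  also have "\<dots> \<in> S" unfolding h(1) act_hmat[OF assms(1) h(2)] using aS_O[OF assms(1) h(2)] by simp
  finally show "dvd_hmat q (aL u l s m) (aS u l s m) (aM u l s m)"
    by (simp only: dvd_hmat_iff_S[OF aS_O[OF assms(1,2)] assms(3)])
next
  assume "dvd_hmat q (aL u l s m) (aS u l s m) (aM u l s m)"
  then have "scale_mat (1 / of_nat q) (hmat (aL u l s m) (aS u l s m) (aM u l s m)) \<in> S"
    by (simp only: dvd_hmat_iff_S[OF aS_O[OF assms(1,2)] assms(3)])
  then have "ct (Uc u) ** scale_mat (1 / of_nat q) (hmat (aL u l s m) (aS u l s m) (aM u l s m)) ** Uc u \<in> S"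
    by (rule coact_S[OF assms(1)])
  also have "ct (Uc u) ** scale_mat (1 / of_nat q) (hmat (aL u l s m) (aS u l s m) (aM u l s m)) ** Uc u
     = scale_mat (1 / of_nat q) ((ct (Uc u) ** Uo u) ** hmat l s m ** (ct (Uo u) ** Uc u))"
    unfolding act_hmat[OF assms(1,2), symmetric] by (simp add: scale_mult_left scale_mult_right matrix_mul_assoc)
  also have "\<dots> = scale_mat (1 / of_nat q) (hmat l s m)" by (simp add: Uo_Uc)
  finally show "dvd_hmat q l s m" by (simp only: dvd_hmat_iff_S[OF assms(2,3)])
qed

lemma Ddet_act:
  assumes "u \<in> lines" "s \<in> \<O>"
  shows "Ddet (aL u l s m) (aS u l s m) (aM u l s m) = Ddet l s m"
proof -
  have d1: "det (Uo u) = 1" "det (ct (Uo u)) = 1"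
    by (cases u; simp add: Uo_def m2_det m2_ct)+
  have "(of_int (Ddet (aL u l s m) (aS u l s m) (aM u l s m)) :: complex) = of_nat D * det (Uo u ** hmat l s m ** ct (Uo u))"
    unfolding act_hmat[OF assms] using det_hmat aS_O assms by simp
  also have "\<dots> = of_int (Ddet l s m)" using det_hmat[OF assms(2)] by (simp add: det_mul d1)
  finally show ?thesis by (simp only: of_int_eq_iff)
qed

lemma act_scale:
  assumes "u \<in> lines" "s \<in> \<O>"
  shows "aL u (int n * l) (of_nat n * s) (int n * m) = int n * aL u l s m"
    "aS u (int n * l) (of_nat n * s) (int n * m) = of_nat n * aS u l s m"
    "aM u (int n * l) (of_nat n * s) (int n * m) = int n * aM u l s m"
proof -
  have tr: "trd (of_nat n * s * x) = int n * trd (s * x)" if "x \<in> \<O>" for x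
    using trd_of_nat_mult[of "s * x" n] that assms(2) by (simp add: mult.assoc)
  show "aL u (int n * l) (of_nat n * s) (int n * m) = int n * aL u l s m"
    "aS u (int n * l) (of_nat n * s) (int n * m) = of_nat n * aS u l s m"
    "aM u (int n * l) (of_nat n * s) (int n * m) = int n * aM u l s m"
    using assms(1) residues_O tr by (auto simp: aL_def aS_def aM_def lines_def algebra_simps)
qed

lemma finite_lines: "finite lines" by (simp add: lines_def)

lemma card_lines: "card lines = p * p + 1"
  unfolding lines_def by (subst card_insert_disjoint) (auto simp: card_image card_residues)

lemma card_isotropic_lines:
  assumes "s \<in> \<O>" "\<not> dvd_hmat p l s m"
  shows "card {u \<in> lines. int p dvd aM u l s m} = (if int p dvd Ddet l s m then 1 else p + 1)"
proof -
  have "{u \<in> lines. int p dvd aM u l s m} = (if int p dvd l then {None} else {}) \<union> Some ` {x \<in> residues. int p dvd l * nrm x + trd (s * x) + m}"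
    by (auto simp: lines_def aM_def)
  then have "card {u \<in> lines. int p dvd aM u l s m} = card (if int p dvd l then {None :: complex option} else {}) + card (Some ` {x \<in> residues. int p dvd l * nrm x + trd (s * x) + m})"
    by (simp only:) (rule card_Un_disjoint, auto)
  also have "\<dots> = card {x \<in> residues. int p dvd l * nrm x + trd (s * x) + m} + (if int p dvd l then 1 else 0)"
    by (simp add: card_image)
  finally show ?thesis using card_isotropic[OF assms(1), of l m] assms(2) by (simp add: dvd_hmat_def Ddet_def)
qed

text \<open>If \<open>p\<^sup>2\<close> divides \<open>n = D det T\<close>, the form has exactly one isotropic point modulo \<open>p\<close>. There \<open>nrm s' = D l' m' - n\<close> is
divisible by \<open>p\<close>, hence so is \<open>s'\<close>, hence \<open>p\<^sup>2\<close> divides \<open>D l' m'\<close>; primitivity makes \<open>l'\<close> a unit, so \<open>p\<^sup>2\<close>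
divides \<open>m'\<close>. The converse is read off from \<open>n = D l' m' - nrm s'\<close>.\<close>

lemma card_deep_lines:
  assumes s: "s \<in> \<O>" and prim: "\<not> dvd_hmat p l s m"
  shows "card {u \<in> lines. aS u l s m \<in> I p \<and> int p ^ 2 dvd aM u l s m} = (if int p ^ 2 dvd Ddet l s m then 1 else 0)"
proof (cases "int p ^ 2 dvd Ddet l s m")
  case True
  then have pn: "int p dvd Ddet l s m" using dvd_trans[of "int p" "int p ^ 2"] by simp
  have "{u \<in> lines. aS u l s m \<in> I p \<and> int p ^ 2 dvd aM u l s m} = {u \<in> lines. int p dvd aM u l s m}"
  proof (intro Collect_cong conj_cong refl iffI)
    fix u assume "aS u l s m \<in> I p \<and> int p ^ 2 dvd aM u l s m"
    then show "int p dvd aM u l s m" using dvd_trans[of "int p" "int p ^ 2"] by simp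
  next
    fix u assume u: "u \<in> lines" and pm: "int p dvd aM u l s m"
    define l' s' m' where "l' = aL u l s m" and "s' = aS u l s m" and "m' = aM u l s m"
    have s': "s' \<in> \<O>" unfolding s'_def using aS_O u s by blast
    have n: "Ddet l' s' m' = Ddet l s m" unfolding l'_def s'_def m'_def by (rule Ddet_act[OF u s])
    have ns: "nrm s' = int D * l' * m' - Ddet l s m" unfolding n[symmetric] by (simp add: Ddet_def)
    have pm': "int p dvd m'" using pm by (simp add: m'_def)
    then have "int p dvd nrm s'" unfolding ns using pn by (intro dvd_diff) auto
    then have sI: "s' \<in> I p" using dvd_nrm s' by blast
    then obtain s1 where s1: "s' = of_nat p * s1" "s1 \<in> \<O>" by (auto simp: I_def)
    have "nrm s' = int p ^ 2 * nrm s1"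
      using nrm_mult[of "of_int (int p)" s1] nrm_int[of "int p"] s1 by (simp add: power2_eq_square)
    then have "int p ^ 2 dvd nrm s' + Ddet l s m" using True by simp
    also have "nrm s' + Ddet l s m = int D * l' * m'" using ns by simp
    finally have "int p ^ 2 dvd int D * l' * m'" .
    moreover have "\<not> int p dvd l'"
      using prim dvd_hmat_act[OF u s p_pos, of l m] sI pm' unfolding dvd_hmat_def[of p "aL u l s m"] l'_def s'_def m'_def by blast
    then have "\<not> int p dvd int D * l'" using p_not_dvd_D p_dvd_mult by blast
    then have "coprime (int D * l') (int p)" by (rule int_coprime_p)
    then have "coprime (int p ^ 2) (int D * l')"
      by (simp only: coprime_power_left_iff coprime_commute[of "int p"] simp_thms)
    ultimately have "int p ^ 2 dvd m'" by (simp add: coprime_dvd_mult_right_iff)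
    then show "aS u l s m \<in> I p \<and> int p ^ 2 dvd aM u l s m" using sI by (simp add: s'_def m'_def)
  qed
  then show ?thesis using card_isotropic_lines[OF s prim] pn True by simp
next
  case False
  have "{u \<in> lines. aS u l s m \<in> I p \<and> int p ^ 2 dvd aM u l s m} = {}"
  proof -
    have False if u: "u \<in> lines" and sI: "aS u l s m \<in> I p" and pm: "int p ^ 2 dvd aM u l s m" for u
    proof -
      obtain s1 where s1: "aS u l s m = of_nat p * s1" "s1 \<in> \<O>" using sI by (auto simp: I_def)
      have "nrm (aS u l s m) = int p ^ 2 * nrm s1"
        using nrm_mult[of "of_int (int p)" s1] nrm_int[of "int p"] s1 by (simp add: power2_eq_square)
      then have "int p ^ 2 dvd Ddet (aL u l s m) (aS u l s m) (aM u l s m)"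
        unfolding Ddet_def using pm by simp
      then show False using False Ddet_act[OF u s] by simp
    qed
    then show ?thesis by blast
  qed
  then show ?thesis using False by (simp only: card.empty if_False)
qed

text \<open>This set is unchanged when \<open>T\<close> is replaced by \<open>pT\<close>, \<open>T/p\<close> or \<open>T\<^sub>U\<close>.\<close>

definition pfree_divs :: "int \<Rightarrow> complex \<Rightarrow> int \<Rightarrow> nat set" where
  "pfree_divs l s m = {d \<in> divs N l s m. \<not> p dvd d}"

lemma coprime_p_pow: "\<not> p dvd d \<Longrightarrow> coprime (p ^ i) d"
  using p_prime by (simp add: prime_imp_coprime)

text \<open>Separates the power of \<open>p\<close> in each divisor. The set \<open>V\<close> is a parameter because it is shared by all indices that occur.\<close>

lemma sum_divs:
  assumes s: "s \<in> \<O>" and nz: "\<not> (l = 0 \<and> s = 0 \<and> m = 0)" and M: "\<not> dvd_hmat (p ^ M) l s m"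
    and V: "pfree_divs l s m = V"
  shows "(\<Sum>d\<in>divs N l s m. f d) = (\<Sum>i<M. if dvd_hmat (p ^ i) l s m then \<Sum>d\<in>V. f (p ^ i * d) else (0::complex))"
proof -
  obtain g where g: "g > 0" "\<And>q. dvd_hmat q l s m \<longleftrightarrow> q dvd g" using content_exists[OF s nz] by blast
  have fin: "finite (divs N l s m)"
    by (rule finite_subset[of _ "{d. d dvd g}"]) (use g in \<open>auto simp: divs_def\<close>)
  then have finV: "finite V" by (simp add: V[symmetric] pfree_divs_def)
  define A where "A = {i \<in> {..<M}. dvd_hmat (p ^ i) l s m}"
  have bij: "bij_betw (\<lambda>(i, d). p ^ i * d) (A \<times> V) (divs N l s m)"
  proof (rule bij_betwI')
      fix x y assume "x \<in> A \<times> V" "y \<in> A \<times> V"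
      then obtain i d j e where xy: "x = (i, d)" "y = (j, e)" "\<not> p dvd d" "\<not> p dvd e"
        by (auto simp: V[symmetric] pfree_divs_def)
      have "i = j \<and> d = e" if "p ^ i * d = p ^ j * e"
      proof -
        have m0: "multiplicity p d = 0" "multiplicity p e = 0" using xy by (auto intro: not_dvd_imp_multiplicity_0)
        have "d \<noteq> 0" "e \<noteq> 0" using xy by (auto intro!: Nat.gr0I)
        then have "multiplicity p (p ^ i * d) = i" "multiplicity p (p ^ j * e) = j"
          using p_prime m0 by (simp_all add: prime_elem_multiplicity_mult_distrib)
        then have "i = j" using that by simp
        then show ?thesis using that by simp
      qed
      then show "((case x of (i, d) \<Rightarrow> p ^ i * d) = (case y of (i, d) \<Rightarrow> p ^ i * d)) \<longleftrightarrow> x = y"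
        using xy by auto
    next
      fix x assume "x \<in> A \<times> V"
      then obtain i d where x: "x = (i, d)" "p ^ i dvd g" "d dvd g" "d > 0" "coprime d N" "\<not> p dvd d"
        using g by (auto simp: A_def V[symmetric] pfree_divs_def divs_def)
      have "p ^ i * d dvd g" using x coprime_p_pow by (simp add: divides_mult)
      moreover have "coprime p N" using p_prime p_ndvd_N prime_imp_coprime by blast
      ultimately show "(case x of (i, d) \<Rightarrow> p ^ i * d) \<in> divs N l s m"
        using x g by (simp add: divs_def)
    next
      fix d assume d: "d \<in> divs N l s m"
      then have d0: "d > 0" "d dvd g" "coprime d N" using g by (auto simp: divs_def)
      obtain e where e: "d = p ^ multiplicity p d * e" "\<not> p dvd e"
      proof (rule multiplicity_decompose'[of d p])
        show "d \<noteq> 0" "\<not> is_unit p" using d0 p_gt_1 by simp_all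
      qed
      define i where "i = multiplicity p d"
      have e': "d = p ^ i * e" using e by (simp add: i_def)
      have pi: "p ^ i dvd g" using e' d0 by (metis dvd_mult_left)
      have "i < M"
      proof (rule ccontr)
        assume "\<not> i < M"
        then have "p ^ M dvd g" using pi by (meson dvd_trans le_imp_power_dvd not_less)
        then show False using M g by simp
      qed
      moreover have "e dvd g" "e > 0" "coprime e N"
        using e' d0 by (auto intro: dvd_trans Nat.gr0I simp: dvd_mult_right)
      ultimately have "(i, e) \<in> A \<times> V" using pi g e by (simp add: A_def V[symmetric] pfree_divs_def divs_def)
      then show "\<exists>x\<in>A \<times> V. d = (case x of (i, d) \<Rightarrow> p ^ i * d)" using e' by (intro bexI[of _ "(i, e)"]) auto
    qed
  have "(\<Sum>d\<in>divs N l s m. f d) = (\<Sum>(i, d)\<in>A \<times> V. f (p ^ i * d))"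
    using sum.reindex_bij_betw[OF bij, of f] by (simp add: case_prod_unfold)
  also have "\<dots> = (\<Sum>i\<in>A. \<Sum>d\<in>V. f (p ^ i * d))" by (simp add: sum.cartesian_product)
  also have "\<dots> = (\<Sum>i<M. if dvd_hmat (p ^ i) l s m then \<Sum>d\<in>V. f (p ^ i * d) else 0)"
    unfolding A_def by (rule sum.inter_filter) simp
  finally show ?thesis .
qed

end

section \<open>The Maass relation for the image\<close>

context hecke_setup
begin

text \<open>The effect of the Hecke operator on the function \<open>\<alpha>\<close> of a Maass form.\<close>

definition hecke_alpha :: "int \<Rightarrow> (nat \<Rightarrow> complex) \<Rightarrow> nat \<Rightarrow> complex" where
  "hecke_alpha k \<alpha> m = of_nat p powi (4 - 2 * k) * \<alpha> (p\<^sup>2 * m)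
     + of_nat p powi (1 - k) * (of_nat p ^ 2 + 1 + (if p dvd m then 0 else of_nat p)) * \<alpha> m
     + (if p\<^sup>2 dvd m then \<alpha> (m div p\<^sup>2) else 0)"

lemma pfree_divs_cong:
  assumes "\<And>d. d > 0 \<Longrightarrow> \<not> p dvd d \<Longrightarrow> dvd_hmat d l s m \<longleftrightarrow> dvd_hmat d l' s' m'"
  shows "pfree_divs l s m = pfree_divs l' s' m'"
  using assms by (auto simp: pfree_divs_def divs_def)

lemma lift_psd:
  assumes "pos_semidef_hermitian T"
  shows "pos_semidef_hermitian (lift u T)"
proof -
  have "lift u T = scale_mat (of_real (1 / real p)) (ct (ct (Uo u) ** m2 (of_nat p) 0 0 1) ** T ** (ct (Uo u) ** m2 (of_nat p) 0 0 1))"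
    by (simp add: lift_def ct_mult m2_ct matrix_mul_assoc)
  also have "pos_semidef_hermitian \<dots>" by (rule psd_congruence[OF assms]) simp
  finally show ?thesis .
qed

lemma scale_psd:
  assumes "pos_semidef_hermitian (T :: mat2)" "r \<ge> 0"
  shows "pos_semidef_hermitian (scale_mat (of_real r) T)"
  using psd_congruence[OF assms, of "mat 1"] by simp

lemma pow_mult_powi: "of_nat (p * x) powi (k - 1) = of_nat p powi (k - 1) * (of_nat x powi (k - 1) :: complex)"
  by (simp add: power_int_mult_distrib)

text \<open>Let \<open>A\<^sub>i\<close> be the part of the Maass sum of \<open>T\<close> from divisors with exact power \<open>p\<^sup>i\<close>, extended to all \<open>i\<close>, and
\<open>X\<^sub>i\<close> the corresponding part for \<open>pT\<close>. Then \<open>X\<^sub>i\<^sub>+\<^sub>1 = p\<^bsup>k-1\<^esup> A\<^sub>i\<close>, and with \<open>e\<close> the exponent of \<open>p\<close> in the content of \<open>T\<close>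
the three contributions are \<open>X\<^sub>0 + \<dots> + X\<^sub>e\<^sub>+\<^sub>1\<close> from \<open>pT\<close>, \<open>p\<^bsup>1-k\<^esup> (A\<^sub>1 + \<dots> + A\<^sub>e)\<close> from \<open>T/p\<close>, and from the \<open>T\<^sub>U\<close> the \<open>A\<^sub>i\<close>
weighted by the number of \<open>U\<close> with \<open>p\<^sup>i\<close> dividing \<open>T\<^sub>U\<close>. On the other side, \<open>\<alpha>'\<close> contributes \<open>X\<^sub>i\<close>, \<open>A\<^sub>i\<close> and
\<open>A\<^sub>i\<^sub>+\<^sub>1\<close> for \<open>i \<le> e\<close>; the coefficients agree term by term.\<close>

lemma hecke_coeff_maass:
  assumes H: "\<And>l s m. s \<in> \<O> \<Longrightarrow> pos_semidef_hermitian (hmat l s m) \<Longrightarrow> hmat l s m \<noteq> 0 \<Longrightarrow> c (hmat l s m) = maass_sum k N \<alpha> l s m"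
    and s: "s \<in> \<O>" and psd: "pos_semidef_hermitian (hmat l s m)" and nz0: "hmat l s m \<noteq> 0"
  shows "hecke_coeff k c (hmat l s m) = maass_sum k N (hecke_alpha k \<alpha>) l s m"
proof -
  let ?T = "hmat l s m"
  define P where "P = (of_nat p powi (k - 1) :: complex)"
  define R where "R = (of_nat p powi (1 - k) :: complex)"
  have PR: "P * R = 1" "R * P = 1"
    unfolding P_def R_def by (simp_all flip: power_int_add)
  have QP: "of_nat p powi (4 - 2 * k) * P = R * of_nat p ^ 2"
  proof -
    have "of_nat p powi (4 - 2 * k) * P = (of_nat p powi (3 - k) :: complex)"
      unfolding P_def by (simp flip: power_int_add)
    also have "\<dots> = R * of_nat p powi 2" unfolding R_def by (simp only: power_int_add[symmetric] p_ne of_nat_eq_0_iff simp_thms) simp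
    finally show ?thesis by simp
  qed
  have nz: "\<not> (l = 0 \<and> s = 0 \<and> m = 0)" using nz0 hmat_zero by blast
  obtain g where g: "g > 0" "\<And>q. dvd_hmat q l s m \<longleftrightarrow> q dvd g" using content_exists[OF s nz] by blast
  define e where "e = multiplicity p g"
  have dvpow: "dvd_hmat (p ^ i) l s m \<longleftrightarrow> i \<le> e" for i
    unfolding g(2) e_def using power_dvd_iff_le_multiplicity[of g p i] g(1) p_gt_1 by simp
  obtain l0 s0 m0 where T0: "l = int (p ^ e) * l0" "s = of_nat (p ^ e) * s0" "m = int (p ^ e) * m0" "s0 \<in> \<O>"
    using dvpow[of e] by (auto simp: dvd_hmat_def I_def elim!: dvdE)
  have pe: "p ^ e > 0" by simp
  have dvT: "dvd_hmat (p ^ e * q) l s m \<longleftrightarrow> dvd_hmat q l0 s0 m0" for q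
    unfolding T0 using dvd_hmat_scale[OF pe T0(4)] by simp
  have prim: "\<not> dvd_hmat p l0 s0 m0" using dvT[of p] dvpow[of "Suc e"] by (simp add: mult.commute)
  define V where "V = pfree_divs l s m"
  have Vd: "d > 0 \<and> \<not> p dvd d \<and> dvd_hmat d l s m" if "d \<in> V" for d
    using that by (auto simp: V_def pfree_divs_def divs_def)
  define nt where "nt = nat (Ddet l s m)"
  have nt: "int nt = Ddet l s m" using Ddet_nonneg[OF s psd] by (simp add: nt_def)
  have natdiv: "nat (Ddet l s m div (int d)\<^sup>2) = nt div d\<^sup>2" for d
    unfolding nt[symmetric] by (metis nat_int of_nat_power zdiv_int)
  define A where "A i = (\<Sum>d\<in>V. of_nat (p ^ i * d) powi (k - 1) * \<alpha> (nt div (p ^ i * d)\<^sup>2))" for i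
  define X where "X i = (\<Sum>d\<in>V. of_nat (p ^ i * d) powi (k - 1) * \<alpha> (p\<^sup>2 * nt div (p ^ i * d)\<^sup>2))" for i
  have p2: "p\<^sup>2 > 0" by simp

  have C1: "c (scale_mat (of_nat p) ?T) = (\<Sum>i<e+2. X i)"
  proof -
    have psd': "pos_semidef_hermitian (hmat (int p * l) (of_nat p * s) (int p * m))"
      using scale_psd[OF psd, of "real p"] by (simp add: scale_hmat)
    have nz': "hmat (int p * l) (of_nat p * s) (int p * m) \<noteq> 0" using nz by (simp add: hmat_zero)
    have "c (scale_mat (of_nat p) ?T) = maass_sum k N \<alpha> (int p * l) (of_nat p * s) (int p * m)"
      unfolding scale_hmat by (rule H[OF _ psd' nz']) (use s in auto)
    also have "\<dots> = (\<Sum>i<e+2. if dvd_hmat (p ^ i) (int p * l) (of_nat p * s) (int p * m) then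
       \<Sum>d\<in>V. of_nat (p ^ i * d) powi (k - 1) * \<alpha> (nat (Ddet (int p * l) (of_nat p * s) (int p * m) div (int (p ^ i * d))\<^sup>2)) else 0)"
      unfolding maass_sum_def
    proof (rule sum_divs)
      show "\<not> dvd_hmat (p ^ (e + 2)) (int p * l) (of_nat p * s) (int p * m)"
        using dvd_hmat_scale[of p s "p ^ (e + 1)" l m] dvpow[of "e + 1"] s by simp
      show "pfree_divs (int p * l) (of_nat p * s) (int p * m) = V"
        unfolding V_def
      proof (rule pfree_divs_cong)
        fix d assume "\<not> p dvd d"
        then have "coprime d p" using coprime_p_pow[of d 1] by (simp add: coprime_commute)
        then show "dvd_hmat d (int p * l) (of_nat p * s) (int p * m) \<longleftrightarrow> dvd_hmat d l s m" by (rule dvd_hmat_scale_coprime[OF s])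
      qed
    qed (use s nz in auto)
    also have "\<dots> = (\<Sum>i<e+2. X i)"
    proof (rule sum.cong[OF refl])
      fix i assume "i \<in> {..<e+2}"
      have "dvd_hmat (p ^ i) (int p * l) (of_nat p * s) (int p * m)"
      proof (cases i)
        case 0
        then show ?thesis using s by (simp add: dvd_hmat_def)
      next
        case (Suc j)
        then show ?thesis using dvd_hmat_scale[of p s "p ^ j" l m] dvpow[of j] s \<open>i \<in> {..<e+2}\<close> by simp
      qed
      moreover have "nat (Ddet (int p * l) (of_nat p * s) (int p * m) div (int x)\<^sup>2) = p\<^sup>2 * nt div x\<^sup>2" for x
        unfolding Ddet_scale[OF s] nt[symmetric]
        by (metis nat_int of_nat_mult of_nat_power zdiv_int)
      ultimately show "(if dvd_hmat (p ^ i) (int p * l) (of_nat p * s) (int p * m) then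
       \<Sum>d\<in>V. of_nat (p ^ i * d) powi (k - 1) * \<alpha> (nat (Ddet (int p * l) (of_nat p * s) (int p * m) div (int (p ^ i * d))\<^sup>2)) else 0) = X i"
        by (simp only: X_def if_True)
    qed
    finally show ?thesis .
  qed

  have C2: "(if scale_mat (1 / of_nat p) ?T \<in> S then c (scale_mat (1 / of_nat p) ?T) else 0) = R * (\<Sum>i<e. A (Suc i))"
  proof (cases "scale_mat (1 / of_nat p) ?T \<in> S")
    case False
    then have "\<not> dvd_hmat (p ^ 1) l s m" using dvd_hmat_iff_S[OF s p_pos] by simp
    then have "e = 0" using dvpow[of 1] by simp
    then show ?thesis using False by simp
  next
    case True
    then obtain l1 s1 m1 where h: "scale_mat (1 / of_nat p) ?T = hmat l1 s1 m1" "s1 \<in> \<O>" by (rule S_E)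
    have "?T = scale_mat (of_nat p) (scale_mat (1 / of_nat p) ?T)" by simp
    also have "\<dots> = hmat (int p * l1) (of_nat p * s1) (int p * m1)" unfolding h(1) scale_hmat ..
    finally have T1: "l = int p * l1" "s = of_nat p * s1" "m = int p * m1" by simp_all
    have psd': "pos_semidef_hermitian (hmat l1 s1 m1)"
      using scale_psd[OF psd, of "1 / real p"] h by simp
    have nz1: "\<not> (l1 = 0 \<and> s1 = 0 \<and> m1 = 0)" using nz T1 by simp
    have nz': "hmat l1 s1 m1 \<noteq> 0" using nz1 by (simp add: hmat_zero)
    define nt1 where "nt1 = nat (Ddet l1 s1 m1)"
    have nt1: "int nt1 = Ddet l1 s1 m1" using Ddet_nonneg[OF h(2) psd'] by (simp add: nt1_def)
    have "int nt = int (p\<^sup>2 * nt1)" unfolding nt T1 Ddet_scale[OF h(2)] nt1[symmetric] by simp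
    then have ntt: "nt = p\<^sup>2 * nt1" by (simp only: of_nat_eq_iff)
    have dv1: "dvd_hmat (p ^ i) l1 s1 m1 \<longleftrightarrow> dvd_hmat (p ^ Suc i) l s m" for i
      using dvd_hmat_scale[OF p_pos h(2), of "p ^ i" l1 m1] by (simp add: T1)
    have "c (hmat l1 s1 m1) = maass_sum k N \<alpha> l1 s1 m1"
      by (rule H[OF h(2) psd' nz'])
    also have "\<dots> = (\<Sum>i<e. if dvd_hmat (p ^ i) l1 s1 m1 then
       \<Sum>d\<in>V. of_nat (p ^ i * d) powi (k - 1) * \<alpha> (nat (Ddet l1 s1 m1 div (int (p ^ i * d))\<^sup>2)) else 0)"
      unfolding maass_sum_def
    proof (rule sum_divs[OF h(2) nz1])
      show "\<not> dvd_hmat (p ^ e) l1 s1 m1" unfolding dv1 dvpow by simp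
      show "pfree_divs l1 s1 m1 = V"
        unfolding V_def T1
      proof (rule pfree_divs_cong)
        fix d assume "\<not> p dvd d"
        then have "coprime d p" using coprime_p_pow[of d 1] by (simp add: coprime_commute)
        then show "dvd_hmat d l1 s1 m1 \<longleftrightarrow> dvd_hmat d (int p * l1) (of_nat p * s1) (int p * m1)" using dvd_hmat_scale_coprime[OF h(2)] by blast
      qed
    qed
    also have "\<dots> = (\<Sum>i<e. R * A (Suc i))"
    proof (rule sum.cong[OF refl])
      fix i assume "i \<in> {..<e}"
      then have "dvd_hmat (p ^ i) l1 s1 m1" unfolding dv1 dvpow by simp
      moreover have "(of_nat x powi (k - 1) * \<alpha> (nat (Ddet l1 s1 m1 div (int x)\<^sup>2)) :: complex) = R * (of_nat (p * x) powi (k - 1) * \<alpha> (nt div (p * x)\<^sup>2))" for x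
      proof -
        have "nat (Ddet l1 s1 m1 div (int x)\<^sup>2) = nt1 div x\<^sup>2"
          unfolding nt1[symmetric] by (metis nat_int of_nat_power zdiv_int)
        moreover have "nt div (p * x)\<^sup>2 = nt1 div x\<^sup>2"
          unfolding ntt power_mult_distrib using p2 by simp
        moreover have "R * (P * of_nat x powi (k - 1)) = (of_nat x powi (k - 1))" using PR by (simp flip: mult.assoc)
        ultimately show ?thesis unfolding pow_mult_powi P_def[symmetric] by (simp flip: mult.assoc)
      qed
      ultimately show "(if dvd_hmat (p ^ i) l1 s1 m1 then
         \<Sum>d\<in>V. of_nat (p ^ i * d) powi (k - 1) * \<alpha> (nat (Ddet l1 s1 m1 div (int (p ^ i * d))\<^sup>2)) else 0) = R * A (Suc i)"
        by (simp only: if_True A_def sum_distrib_left power_Suc mult.assoc)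
    qed
    finally show ?thesis using True by (simp add: h sum_distrib_left)
  qed

  have actT: "aL u l s m = int (p ^ e) * aL u l0 s0 m0" "aS u l s m = of_nat (p ^ e) * aS u l0 s0 m0" "aM u l s m = int (p ^ e) * aM u l0 s0 m0"
    if "u \<in> lines" for u
    unfolding T0(1-3) by (rule act_scale[OF that T0(4)])+
  \<comment> \<open>\<open>Q u i\<close> says that \<open>p\<^sup>i\<close> divides \<open>T\<^sub>U\<close>\<close>
  define Q where "Q u i \<longleftrightarrow> int (p ^ i) dvd int p * aL u l s m \<and> aS u l s m \<in> I (p ^ i) \<and> int p * int (p ^ i) dvd aM u l s m" for u i
  have C3: "(if lift u ?T \<in> S then c (lift u ?T) else 0) = (\<Sum>i<e+2. if Q u i then A i else 0)" if u: "u \<in> lines" for u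
  proof (cases "lift u ?T \<in> S")
    case False
    then have "\<not> int p dvd aM u l s m" using lift_S(1)[OF u s] by blast
    then have "\<not> Q u i" for i unfolding Q_def by (meson dvd_mult_left)
    then show ?thesis using False by simp
  next
    case True
    then have "int p dvd aM u l s m" using lift_S(1)[OF u s] by blast
    then obtain m' where m': "aM u l s m = int p * m'" by blast
    have L: "lift u ?T = hmat (int p * aL u l s m) (aS u l s m) m'" by (rule lift_S(2)[OF u s m'])
    have sO: "aS u l s m \<in> \<O>" by (rule aS_O[OF u s])
    have psd': "pos_semidef_hermitian (hmat (int p * aL u l s m) (aS u l s m) m')"
      unfolding L[symmetric] by (rule lift_psd[OF psd])
    have nz': "hmat (int p * aL u l s m) (aS u l s m) m' \<noteq> 0"
    proof
      assume "hmat (int p * aL u l s m) (aS u l s m) m' = 0"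
      then have "low u (lift u ?T) = low u 0" by (simp add: L)
      moreover have "low u 0 = 0" by (simp add: low_def) (simp add: scale_mat_def vec_eq_iff matrix_matrix_mult_def)
      ultimately show False using nz0 by (simp add: low_lift)
    qed
    then have nz'': "\<not> (int p * aL u l s m = 0 \<and> aS u l s m = 0 \<and> m' = 0)" by (simp add: hmat_zero)
    have nn': "Ddet (int p * aL u l s m) (aS u l s m) m' = Ddet l s m"
      using Ddet_act[OF u s, of l m] by (simp add: Ddet_def m' mult_ac)
    have dvQ: "dvd_hmat (p ^ i) (int p * aL u l s m) (aS u l s m) m' \<longleftrightarrow> Q u i" for i
      unfolding dvd_hmat_def Q_def m' by simp
    have "c (lift u ?T) = maass_sum k N \<alpha> (int p * aL u l s m) (aS u l s m) m'"
      unfolding L by (rule H[OF sO psd' nz'])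
    also have "\<dots> = (\<Sum>i<e+2. if dvd_hmat (p ^ i) (int p * aL u l s m) (aS u l s m) m' then
       \<Sum>d\<in>V. of_nat (p ^ i * d) powi (k - 1) * \<alpha> (nat (Ddet (int p * aL u l s m) (aS u l s m) m' div (int (p ^ i * d))\<^sup>2)) else 0)"
      unfolding maass_sum_def
    proof (rule sum_divs[OF sO nz''])
      show "\<not> dvd_hmat (p ^ (e + 2)) (int p * aL u l s m) (aS u l s m) m'"
      proof
        assume "dvd_hmat (p ^ (e + 2)) (int p * aL u l s m) (aS u l s m) m'"
        then have "Q u (e + 2)" by (simp only: dvQ)
        then have q: "int (p ^ (e + 2)) dvd int p * (int (p ^ e) * aL u l0 s0 m0)" "of_nat (p ^ e) * aS u l0 s0 m0 \<in> I (p ^ (e + 2))"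
          "int p * int (p ^ (e + 2)) dvd int (p ^ e) * aM u l0 s0 m0"
          unfolding Q_def actT[OF u] by blast+
        have "int (p * p ^ e) * int p dvd int (p * p ^ e) * aL u l0 s0 m0" using q(1) by (simp add: mult_ac)
        then have 1: "int p dvd aL u l0 s0 m0" by simp
        have "of_nat (p ^ e) * aS u l0 s0 m0 \<in> I (p ^ e * p)" using q(2) by (rule I_dvd) simp
        then have 2: "aS u l0 s0 m0 \<in> I p" by (simp only: I_scale_iff[OF pe])
        have "int (p ^ e) * int p dvd int (p ^ e) * aM u l0 s0 m0"
          by (rule dvd_trans[OF _ q(3)]) (simp add: mult_ac)
        then have 3: "int p dvd aM u l0 s0 m0" by simp
        have "dvd_hmat p (aL u l0 s0 m0) (aS u l0 s0 m0) (aM u l0 s0 m0)" using 1 2 3 by (simp add: dvd_hmat_def)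
        then show False using prim by (simp only: dvd_hmat_act[OF u T0(4) p_pos])
      qed
      show "pfree_divs (int p * aL u l s m) (aS u l s m) m' = V"
        unfolding V_def
      proof (rule pfree_divs_cong)
        fix d :: nat assume d: "d > 0" "\<not> p dvd d"
        then have "coprime d p" using coprime_p_pow[of d 1] by (simp add: coprime_commute)
        then have cp: "coprime (int d) (int p)" by simp
        have "dvd_hmat d (int p * aL u l s m) (aS u l s m) m' \<longleftrightarrow> dvd_hmat d (aL u l s m) (aS u l s m) (aM u l s m)"
          unfolding dvd_hmat_def m' by (simp only: coprime_dvd_mult_right_iff[OF cp])
        then show "dvd_hmat d (int p * aL u l s m) (aS u l s m) m' \<longleftrightarrow> dvd_hmat d l s m"
          by (simp only: dvd_hmat_act[OF u s d(1)])
      qed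
    qed
    also have "\<dots> = (\<Sum>i<e+2. if Q u i then A i else 0)"
      unfolding dvQ nn' natdiv A_def ..
    finally show ?thesis using True by simp
  qed

  have p_dvd_scale: "int (p ^ i) * int q dvd int (p ^ i) * a \<longleftrightarrow> int q dvd a" for i q a
    by simp
  have cardQ1: "card {u \<in> lines. Q u i} = p * p + 1" if "i < e" for i
  proof -
    have "Q u i" if u: "u \<in> lines" for u
    proof -
      have "p ^ Suc i dvd p ^ e" using \<open>i < e\<close> by (intro le_imp_power_dvd) simp
      then have "int (p ^ Suc i) dvd int (p ^ e)" by (simp only: int_dvd_int_iff)
      then have d: "int p * int (p ^ i) dvd int (p ^ e)" by (simp only: power_Suc of_nat_mult)
      have d0: "p ^ i dvd p ^ e" using \<open>i < e\<close> by (intro le_imp_power_dvd) simp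
      then have d': "int (p ^ i) dvd int (p ^ e)" by (simp only: int_dvd_int_iff)
      have "of_nat (p ^ e) * aS u l0 s0 m0 \<in> I (p ^ e)" using aS_O[OF u T0(4)] by (rule I_of_nat)
      then have "of_nat (p ^ e) * aS u l0 s0 m0 \<in> I (p ^ i)" using d0 by (rule I_dvd)
      then show ?thesis unfolding Q_def actT[OF u]
        using dvd_mult[OF dvd_mult2[OF d', of "aL u l0 s0 m0"], of "int p"] dvd_mult2[OF d, of "aM u l0 s0 m0"] by blast
    qed
    then have "{u \<in> lines. Q u i} = lines" by blast
    then show ?thesis using card_lines by simp
  qed
  have cardQ2: "card {u \<in> lines. Q u e} = (if int p dvd Ddet l0 s0 m0 then 1 else p + 1)"
  proof -
    have "Q u e \<longleftrightarrow> int p dvd aM u l0 s0 m0" if u: "u \<in> lines" for u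
    proof -
      have "of_nat (p ^ e) * aS u l0 s0 m0 \<in> I (p ^ e)" using aS_O[OF u T0(4)] by (rule I_of_nat)
      moreover have "int p * int (p ^ e) dvd int (p ^ e) * aM u l0 s0 m0 \<longleftrightarrow> int p dvd aM u l0 s0 m0"
        using p_dvd_scale[of e p "aM u l0 s0 m0"] by (simp only: mult.commute[of "int p"])
      ultimately show ?thesis unfolding Q_def actT[OF u] by simp
    qed
    then have "{u \<in> lines. Q u e} = {u \<in> lines. int p dvd aM u l0 s0 m0}" by blast
    then show ?thesis using card_isotropic_lines[OF T0(4) prim] by simp
  qed
  have cardQ3: "card {u \<in> lines. Q u (Suc e)} = (if int p ^ 2 dvd Ddet l0 s0 m0 then 1 else 0)"
  proof -
    have "Q u (Suc e) \<longleftrightarrow> aS u l0 s0 m0 \<in> I p \<and> int p ^ 2 dvd aM u l0 s0 m0" if u: "u \<in> lines" for u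
    proof -
      have "int (p ^ Suc e) dvd int p * (int (p ^ e) * aL u l0 s0 m0)" by simp
      moreover have "of_nat (p ^ e) * aS u l0 s0 m0 \<in> I (p ^ Suc e) \<longleftrightarrow> aS u l0 s0 m0 \<in> I p"
        using I_scale_iff[OF pe, of "aS u l0 s0 m0" p] by (simp add: mult.commute)
      moreover have "int p * int (p ^ Suc e) dvd int (p ^ e) * aM u l0 s0 m0 \<longleftrightarrow> int p ^ 2 dvd aM u l0 s0 m0"
        using p_dvd_scale[of e "p\<^sup>2" "aM u l0 s0 m0"] by (simp add: power2_eq_square mult_ac)
      ultimately show ?thesis unfolding Q_def actT[OF u] by simp
    qed
    then have "{u \<in> lines. Q u (Suc e)} = {u \<in> lines. aS u l0 s0 m0 \<in> I p \<and> int p ^ 2 dvd aM u l0 s0 m0}" by blast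
    then show ?thesis using card_deep_lines[OF T0(4) prim] by simp
  qed

  have C3': "(\<Sum>u\<in>lines. if lift u ?T \<in> S then c (lift u ?T) else 0) = (\<Sum>i<e+2. of_nat (card {u \<in> lines. Q u i}) * A i)"
  proof -
    have "(\<Sum>u\<in>lines. if lift u ?T \<in> S then c (lift u ?T) else 0) = (\<Sum>u\<in>lines. \<Sum>i<e+2. if Q u i then A i else 0)"
      by (rule sum.cong[OF refl C3])
    also have "\<dots> = (\<Sum>i<e+2. \<Sum>u\<in>lines. if Q u i then A i else 0)" by (rule sum.swap)
    also have "\<dots> = (\<Sum>i<e+2. of_nat (card {u \<in> lines. Q u i}) * A i)"
      using finite_lines by (intro sum.cong refl) (simp flip: sum.inter_filter)
    finally show ?thesis .
  qed

  have XA: "X (Suc e) = P * A e"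
  proof -
    have "of_nat (p ^ Suc e * d) powi (k - 1) * \<alpha> (p\<^sup>2 * nt div (p ^ Suc e * d)\<^sup>2) = P * (of_nat (p ^ e * d) powi (k - 1) * \<alpha> (nt div (p ^ e * d)\<^sup>2))" for d
    proof -
      have "p ^ Suc e * d = p * (p ^ e * d)" by simp
      moreover have "p\<^sup>2 * nt div (p * (p ^ e * d))\<^sup>2 = nt div (p ^ e * d)\<^sup>2"
        unfolding power_mult_distrib[of p "p ^ e * d"] using p2 by simp
      ultimately show ?thesis by (simp only: pow_mult_powi P_def mult.assoc)
    qed
    then show ?thesis unfolding X_def A_def sum_distrib_left by (intro sum.cong refl)
  qed

  \<comment> \<open>\<open>D det T / p\<^bsup>2i\<^esup>\<close>: divisible by \<open>p\<^sup>2\<close> for \<open>i < e\<close>, and equal to \<open>n\<^sub>0\<close> for \<open>i = e\<close>\<close>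
  define ni where "ni i = nt div (p ^ i)\<^sup>2" for i
  have C4: "maass_sum k N (hecke_alpha k \<alpha>) l s m = (\<Sum>i<e+1. of_nat p powi (4 - 2 * k) * X i
      + R * (of_nat p ^ 2 + 1 + (if p dvd ni i then 0 else of_nat p)) * A i + (if p\<^sup>2 dvd ni i then R * A (Suc i) else 0))"
  proof -
    have "maass_sum k N (hecke_alpha k \<alpha>) l s m = (\<Sum>i<e+1. if dvd_hmat (p ^ i) l s m then
       \<Sum>d\<in>V. of_nat (p ^ i * d) powi (k - 1) * hecke_alpha k \<alpha> (nat (Ddet l s m div (int (p ^ i * d))\<^sup>2)) else 0)"
      unfolding maass_sum_def by (rule sum_divs[OF s nz]) (use dvpow[of "e + 1"] in \<open>simp_all add: V_def\<close>)
    also have "\<dots> = (\<Sum>i<e+1. of_nat p powi (4 - 2 * k) * X i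
      + R * (of_nat p ^ 2 + 1 + (if p dvd ni i then 0 else of_nat p)) * A i + (if p\<^sup>2 dvd ni i then R * A (Suc i) else 0))"
    proof (rule sum.cong[OF refl])
      fix i assume i: "i \<in> {..<e+1}"
      have dvi: "dvd_hmat (p ^ i) l s m" using i dvpow by simp
      have summand: "of_nat (p ^ i * d) powi (k - 1) * hecke_alpha k \<alpha> (nt div (p ^ i * d)\<^sup>2) =
         of_nat p powi (4 - 2 * k) * (of_nat (p ^ i * d) powi (k - 1) * \<alpha> (p\<^sup>2 * nt div (p ^ i * d)\<^sup>2))
         + R * (of_nat p ^ 2 + 1 + (if p dvd ni i then 0 else of_nat p)) * (of_nat (p ^ i * d) powi (k - 1) * \<alpha> (nt div (p ^ i * d)\<^sup>2))
         + (if p\<^sup>2 dvd ni i then R * (of_nat (p ^ Suc i * d) powi (k - 1) * \<alpha> (nt div (p ^ Suc i * d)\<^sup>2)) else 0)" if d: "d \<in> V" for d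
      proof -
        define x where "x = p ^ i * d"
        have d0: "d > 0" "\<not> p dvd d" "dvd_hmat d l s m" using Vd[OF d] by auto
        have "x dvd g" unfolding x_def using dvi d0 g coprime_p_pow[of d i] by (simp add: divides_mult)
        then have "int x ^ 2 dvd Ddet l s m" using g dvd_hmat_sq s by blast
        then have "x\<^sup>2 dvd nt" unfolding nt[symmetric] by (metis int_dvd_int_iff of_nat_power)
        then obtain q where q: "nt = x\<^sup>2 * q" by blast
        have x0: "x\<^sup>2 > 0" using d0 by (simp add: x_def)
        have 1: "nt div x\<^sup>2 = q" using x0 by (simp add: q)
        have "p\<^sup>2 * nt = x\<^sup>2 * (p\<^sup>2 * q)" by (simp add: q)
        then have 2: "p\<^sup>2 * nt div x\<^sup>2 = p\<^sup>2 * q" using x0 by simp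
        have "nt = (p ^ i)\<^sup>2 * (d\<^sup>2 * q)" by (simp add: q x_def power_mult_distrib)
        then have ni: "ni i = d\<^sup>2 * q" unfolding ni_def by simp
        have "coprime p d" using coprime_p_pow[of d 1] d0 by simp
        then have 3: "p dvd ni i \<longleftrightarrow> p dvd q" "p\<^sup>2 dvd ni i \<longleftrightarrow> p\<^sup>2 dvd q"
          unfolding ni by (simp_all add: coprime_dvd_mult_right_iff)
        have 4: "nt div (p * x)\<^sup>2 = q div p\<^sup>2" if pq: "p\<^sup>2 dvd q"
        proof -
          obtain r where r: "q = p\<^sup>2 * r" using pq by blast
          have "nt = (p * x)\<^sup>2 * r" by (simp add: q r power_mult_distrib)
          then have "nt div (p * x)\<^sup>2 = r" using x0 p2 by (simp add: power_mult_distrib)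
          then show ?thesis by (simp add: r)
        qed
        have 5: "p ^ Suc i * d = p * x" by (simp add: x_def)
        have "R * (P * of_nat x powi (k - 1)) = (of_nat x powi (k - 1))" using PR by (simp flip: mult.assoc)
        then have 6: "R * (of_nat (p * x) powi (k - 1) * y) = of_nat x powi (k - 1) * y" for y :: complex
          unfolding pow_mult_powi P_def[symmetric] by (simp flip: mult.assoc)
        show ?thesis
          unfolding x_def[symmetric] 5 6 1 2 3 hecke_alpha_def R_def[symmetric]
          using 4 by (simp add: algebra_simps)
      qed
      have "(\<Sum>d\<in>V. of_nat (p ^ i * d) powi (k - 1) * hecke_alpha k \<alpha> (nt div (p ^ i * d)\<^sup>2)) =
        of_nat p powi (4 - 2 * k) * X i
        + R * (of_nat p ^ 2 + 1 + (if p dvd ni i then 0 else of_nat p)) * A i + (if p\<^sup>2 dvd ni i then R * A (Suc i) else 0)"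
        unfolding X_def A_def sum_distrib_left
        by (simp only: sum.cong[OF refl summand] sum.distrib) (cases "p\<^sup>2 dvd ni i"; simp only: if_True if_False sum.neutral_const)
      then show "(if dvd_hmat (p ^ i) l s m then
          \<Sum>d\<in>V. of_nat (p ^ i * d) powi (k - 1) * hecke_alpha k \<alpha> (nat (Ddet l s m div (int (p ^ i * d))\<^sup>2)) else 0) =
        of_nat p powi (4 - 2 * k) * X i
        + R * (of_nat p ^ 2 + 1 + (if p dvd ni i then 0 else of_nat p)) * A i + (if p\<^sup>2 dvd ni i then R * A (Suc i) else 0)"
        using dvi natdiv by (simp only: if_True)
    qed
    finally show ?thesis .
  qed

  have ni1: "p\<^sup>2 dvd ni i" "p dvd ni i" if "i < e" for i
  proof -
    have "dvd_hmat (p ^ Suc i) l s m" unfolding dvpow using that by simp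
    then have "int (p ^ Suc i) ^ 2 dvd Ddet l s m" using dvd_hmat_sq s by blast
    then have "(p ^ Suc i)\<^sup>2 dvd nt" unfolding nt[symmetric] by (metis int_dvd_int_iff of_nat_power)
    then obtain r where "nt = (p ^ Suc i)\<^sup>2 * r" by blast
    then have "nt = (p ^ i)\<^sup>2 * (p\<^sup>2 * r)" by (simp add: power_mult_distrib mult_ac)
    then have "ni i = p\<^sup>2 * r" unfolding ni_def by simp
    then show "p\<^sup>2 dvd ni i" "p dvd ni i" by (simp_all add: power2_eq_square)
  qed
  have ni2: "int (ni e) = Ddet l0 s0 m0"
  proof -
    have "int nt = int ((p ^ e)\<^sup>2) * Ddet l0 s0 m0" unfolding nt T0(1-3) Ddet_scale[OF T0(4)] by simp
    then have "int (nt div (p ^ e)\<^sup>2) = Ddet l0 s0 m0" unfolding zdiv_int by simp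
    then show ?thesis by (simp add: ni_def)
  qed
  have ni3: "p dvd ni e \<longleftrightarrow> int p dvd Ddet l0 s0 m0" "p\<^sup>2 dvd ni e \<longleftrightarrow> int p ^ 2 dvd Ddet l0 s0 m0"
    unfolding ni2[symmetric] by (simp_all flip: of_nat_power)

  define z y where "z = (if int p dvd Ddet l0 s0 m0 then 0 else of_nat p :: complex)" and "y = (if int p ^ 2 dvd Ddet l0 s0 m0 then 1 else 0 :: complex)"
  have "hecke_coeff k c ?T = of_nat p powi (4 - 2 * k) * (\<Sum>i<e+2. X i)
     + R * (\<Sum>i<e+2. of_nat (card {u \<in> lines. Q u i}) * A i) + R * (\<Sum>i<e. A (Suc i))"
    unfolding hecke_coeff_def C1 C2 C3' R_def ..
  also have "(\<Sum>i<e+2. X i) = (\<Sum>i<e. X i) + X e + P * A e" using XA by simp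
  also have "(\<Sum>i<e+2. of_nat (card {u \<in> lines. Q u i}) * A i) = (\<Sum>i<e. (of_nat p ^ 2 + 1) * A i) + (1 + z) * A e + y * A (Suc e)"
  proof -
    have "(\<Sum>i<e. of_nat (card {u \<in> lines. Q u i}) * A i) = (\<Sum>i<e. (of_nat p ^ 2 + 1) * A i)"
      using cardQ1 by (intro sum.cong refl) (simp add: power2_eq_square)
    then show ?thesis by (simp add: cardQ2 cardQ3 z_def y_def)
  qed
  also have "of_nat p powi (4 - 2 * k) * ((\<Sum>i<e. X i) + X e + P * A e)
     + R * ((\<Sum>i<e. (of_nat p ^ 2 + 1) * A i) + (1 + z) * A e + y * A (Suc e)) + R * (\<Sum>i<e. A (Suc i)) =
     (\<Sum>i<e. of_nat p powi (4 - 2 * k) * X i + R * (of_nat p ^ 2 + 1) * A i + R * A (Suc i))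
     + (of_nat p powi (4 - 2 * k) * X e + R * (of_nat p ^ 2 + 1 + z) * A e + y * (R * A (Suc e)))"
  proof -
    define Y where "Y = (of_nat p powi (4 - 2 * k) :: complex)"
    have 1: "Y * (P * A e) = R * of_nat p ^ 2 * A e" unfolding Y_def by (simp only: mult.assoc[symmetric] QP)
    have 2: "(\<Sum>i<e. Y * X i + R * (of_nat p ^ 2 + 1) * A i + R * A (Suc i)) =
      Y * (\<Sum>i<e. X i) + R * (of_nat p ^ 2 + 1) * (\<Sum>i<e. A i) + R * (\<Sum>i<e. A (Suc i))"
      by (simp only: sum.distrib sum_distrib_left)
    have 3: "(\<Sum>i<e. (of_nat p ^ 2 + 1) * A i) = (of_nat p ^ 2 + 1) * (\<Sum>i<e. A i)"
      by (simp only: sum_distrib_left)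
    show ?thesis unfolding Y_def[symmetric] 2 3 distrib_left[of Y] 1 by (simp add: algebra_simps)
  qed
  also have "\<dots> = maass_sum k N (hecke_alpha k \<alpha>) l s m"
    unfolding C4 using ni1 by (simp add: ni3 z_def y_def)
  finally show ?thesis .
qed

end

section \<open>Holomorphy and the conclusion\<close>

lemma holomorphic_sum:
  assumes "finite A" "\<And>i. i \<in> A \<Longrightarrow> holomorphic_on_H2 (f i)"
  shows "holomorphic_on_H2 (\<lambda>Z. \<Sum>i\<in>A. f i Z)"
  unfolding holomorphic_on_H2_def
proof
  fix Z :: mat2 assume "Z \<in> H2"
  then have "\<forall>i\<in>A. \<exists>L. (f i has_derivative L) (at Z) \<and> (\<forall>c W. L (scale_mat c W) = c * L W)"
    using assms(2) by (simp add: holomorphic_on_H2_def)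
  then obtain L where L: "\<And>i. i \<in> A \<Longrightarrow> (f i has_derivative L i) (at Z)"
    "\<And>i c W. i \<in> A \<Longrightarrow> L i (scale_mat c W) = c * L i W" by metis
  show "\<exists>L. ((\<lambda>Z. \<Sum>i\<in>A. f i Z) has_derivative L) (at Z) \<and> (\<forall>c W. L (scale_mat c W) = c * L W)"
  proof (intro exI[of _ "\<lambda>W. \<Sum>i\<in>A. L i W"] conjI allI)
    show "((\<lambda>Z. \<Sum>i\<in>A. f i Z) has_derivative (\<lambda>W. \<Sum>i\<in>A. L i W)) (at Z)"
      by (rule has_derivative_sum) (rule L)
    show "(\<Sum>i\<in>A. L i (scale_mat c W)) = c * (\<Sum>i\<in>A. L i W)" for c W
      by (simp add: L(2) sum_distrib_left)
  qed
qed

text \<open>The half space is open, so values outside it do not affect derivatives.\<close>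

lemma holomorphic_cong:
  assumes "holomorphic_on_H2 f" "\<And>Z. Z \<in> H2 \<Longrightarrow> f Z = g Z"
  shows "holomorphic_on_H2 g"
  unfolding holomorphic_on_H2_def
proof
  fix Z :: mat2 assume Z: "Z \<in> H2"
  then obtain L where L: "(f has_derivative L) (at Z)" "\<forall>c W. L (scale_mat c W) = c * L W"
    using assms(1) by (auto simp: holomorphic_on_H2_def)
  have "(g has_derivative L) (at Z)"
    by (rule has_derivative_transform_within_open[OF L(1) open_H2 Z assms(2)])
  then show "\<exists>L. (g has_derivative L) (at Z) \<and> (\<forall>c W. L (scale_mat c W) = c * L W)" using L(2) by blast
qed

context imag_quad
begin

lemma Gamma0_eq:
  assumes R: "ring_of_integers K = \<O>"
  shows "Gamma0 K N = GammaN N"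
proof -
  have I: "ideal_of_nat K n = I n" for n by (simp add: ideal_of_nat_def I_def R)
  have ent: "(\<forall>i j. g $ i $ j \<in> \<O>) \<longleftrightarrow> int_mat (block_A g) \<and> int_mat (block_B g) \<and> int_mat (block_C g) \<and> int_mat (block_D g)" for g :: mat4
    by (auto simp: int_mat_def all_plus block_A_def block_B_def block_C_def block_D_def)
  show ?thesis
  proof (intro equalityI subsetI)
    fix g assume "g \<in> Gamma0 K N"
    then show "g \<in> GammaN N"
      using ent[of g] by (auto simp: Gamma0_def U22_def GL4_def R I GammaN_def sim_def dvd_mat_def)
  next
    fix g assume g: "g \<in> GammaN N"
    have "\<forall>i j. g $ i $ j \<in> \<O>" "\<forall>i j. adjJ g $ i $ j \<in> \<O>"
      using g GammaN_adjJ(1)[OF g] dvd_mat_int_mat unfolding ent GammaN_def by blast+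
    then show "g \<in> Gamma0 K N" using g GammaN_adjJ(2,3)[OF g]
      by (auto simp: Gamma0_def U22_def GL4_def R I GammaN_def sim_def dvd_mat_def)
  qed
qed

lemma S2_eq:
  assumes R: "ring_of_integers K = \<O>"
  shows "S2 K D = S"
proof (intro equalityI subsetI)
  fix T assume "T \<in> S2 K D"
  then obtain l m s where "T $ 1 $ 1 = of_int l" "T $ 2 $ 2 = of_int m" "T $ 1 $ 2 = s / \<delta>" "s \<in> \<O>" "T $ 2 $ 1 = cnj (T $ 1 $ 2)"
    by (auto simp: S2_def inverse_different_def R \<delta>_def elim!: Ints_cases)
  moreover from this have "T = hmat l s m" by (subst m2_eta) (simp add: hmat_def)
  ultimately show "T \<in> S" by simp
next
  fix T assume "T \<in> S"
  then show "T \<in> S2 K D"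
    by (elim S_E) (auto simp: S2_def inverse_different_def R hmat_def simp flip: \<delta>_def)
qed

text \<open>The content is the largest divisor of the index, and its divisors are exactly the numbers dividing the index; the floor of
\<open>D det T / d\<^sup>2\<close> is integer division.\<close>

lemma maass_condition_eq:
  assumes R: "ring_of_integers K = \<O>" and s: "s \<in> \<O>" and nz: "hmat l s m \<noteq> 0"
  shows "(\<Sum>d | d > 0 \<and> d dvd herm_content K D (hmat l s m) \<and> coprime d N.
             of_nat d powi (k - 1) * \<alpha> (nat \<lfloor>Re (of_nat D * det (hmat l s m) / (of_nat d)\<^sup>2)\<rfloor>)) = maass_sum k N \<alpha> l s m"
proof -
  obtain g where g: "g > 0" "\<And>q. dvd_hmat q l s m \<longleftrightarrow> q dvd g"
    using content_exists[OF s] nz hmat_zero by metis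
  have "{q. q > 0 \<and> scale_mat (1 / of_nat q) (hmat l s m) \<in> S2 K D} = {q. q dvd g}"
    using g dvd_hmat_iff_S[OF s, of _ l m] by (auto simp: S2_eq[OF R] intro: Nat.gr0I)
  then have "herm_content K D (hmat l s m) = Max {q. q dvd g}" by (simp add: herm_content_def)
  also have "\<dots> = g" using g(1) by (intro Max_eqI) (auto dest: dvd_imp_le)
  finally have "{d. d > 0 \<and> d dvd herm_content K D (hmat l s m) \<and> coprime d N} = divs N l s m"
    using g by (auto simp: divs_def)
  moreover have "\<lfloor>Re (of_nat D * det (hmat l s m) / (of_nat d)\<^sup>2)\<rfloor> = Ddet l s m div (int d)\<^sup>2" for d
  proof -
    have "of_nat D * det (hmat l s m) / (of_nat d)\<^sup>2 = of_real (real_of_int (Ddet l s m) / real_of_int ((int d)\<^sup>2))"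
      unfolding det_hmat[OF s] by simp
    then have "Re (of_nat D * det (hmat l s m) / (of_nat d)\<^sup>2) = real_of_int (Ddet l s m) / real_of_int ((int d)\<^sup>2)"
      by (simp only: Re_complex_of_real)
    then show ?thesis by (simp only: floor_divide_of_int_eq)
  qed
  ultimately show ?thesis by (simp only: maass_sum_def)
qed

end

context hecke_setup
begin

lemma hecke_T_maass:
  assumes R: "ring_of_integers K = \<O>" and F: "F \<in> maass_space K D k N"
  shows "hecke_T K k N p F \<in> maass_space K D k N"
proof -
  define G where "G Z = (\<Sum>i\<in>rep_idx. slash k F (coset_rep i) Z)" for Z
  have hol: "holomorphic_on_H2 F" and inv: "\<And>g Z. g \<in> GammaN N \<Longrightarrow> Z \<in> H2 \<Longrightarrow> slash k F g Z = F Z"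
    using F by (auto simp: maass_space_def modular_forms_def Gamma0_eq[OF R])
  obtain c \<alpha> where c: "has_fourier_expansion K D F c"
    and al: "\<And>T. T \<in> S2 K D \<Longrightarrow> pos_semidef_hermitian T \<Longrightarrow> T \<noteq> 0 \<Longrightarrow>
      c T = (\<Sum>d | d > 0 \<and> d dvd herm_content K D T \<and> coprime d N.
             of_nat d powi (k - 1) * \<alpha> (nat \<lfloor>Re (of_nat D * det T / (of_nat d)\<^sup>2)\<rfloor>))"
    using F by (auto simp: maass_space_def)
  have HG: "hecke_T K k N p F Z = G Z" if "Z \<in> H2" for Z
    using sum_cosets[OF inv that] by (simp add: hecke_T_def Gamma0_eq[OF R] hecke_mat_def G_def)
  have holG: "holomorphic_on_H2 G"
    unfolding G_def
  proof (rule holomorphic_sum[OF finite_rep_idx])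
    fix i assume i: "i \<in> rep_idx"
    show "holomorphic_on_H2 (slash k F (coset_rep i))"
      by (rule holomorphic_slash_upper[OF hol sim_real(2)[OF i]]) (use hrep_rep[OF i] in \<open>auto simp: hrep_def\<close>)
  qed
  have "hecke_T K k N p F \<in> modular_forms K k N"
    unfolding modular_forms_def Gamma0_eq[OF R]
  proof (intro CollectI conjI ballI)
    show "holomorphic_on_H2 (hecke_T K k N p F)" by (rule holomorphic_cong[OF holG]) (simp add: HG)
    fix g Z assume g: "g \<in> GammaN N" and Z: "Z \<in> H2"
    have "moebius g Z \<in> H2" by (rule moebius_in_H2[OF sim_real(1)[OF g] _ Z]) simp
    then have "slash k (hecke_T K k N p F) g Z = slash k G g Z" by (simp add: slash_def HG)
    also have "\<dots> = G Z" unfolding G_def by (rule sum_reps_invariant[OF inv g Z])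
    finally show "slash k (hecke_T K k N p F) g Z = hecke_T K k N p F Z" using HG[OF Z] by simp
  qed
  moreover have "has_fourier_expansion K D (hecke_T K k N p F) (hecke_coeff k c)"
    unfolding has_fourier_expansion_def S2_eq[OF R]
  proof
    fix Z assume Z: "Z \<in> H2"
    have cF: "((\<lambda>T. c T * chi T Z) has_sum F Z) S" if "Z \<in> H2" for Z
      using c that by (simp add: has_fourier_expansion_def S2_eq[OF R] chi_def)
    show "((\<lambda>T. hecke_coeff k c T * exp (2 * of_real pi * \<i> * trace (T ** Z))) has_sum hecke_T K k N p F Z) S"
      using fourier_hecke[OF cF Z, of k] HG[OF Z] by (simp add: G_def chi_def)
  qed
  moreover have "\<forall>T\<in>S2 K D. pos_semidef_hermitian T \<and> T \<noteq> 0 \<longrightarrow>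
      hecke_coeff k c T = (\<Sum>d | d > 0 \<and> d dvd herm_content K D T \<and> coprime d N.
             of_nat d powi (k - 1) * hecke_alpha k \<alpha> (nat \<lfloor>Re (of_nat D * det T / (of_nat d)\<^sup>2)\<rfloor>))"
  proof (intro ballI impI)
    fix T assume "T \<in> S2 K D" and T: "pos_semidef_hermitian T \<and> T \<noteq> 0"
    then obtain l s m where Tm: "T = hmat l s m" and s: "s \<in> \<O>" unfolding S2_eq[OF R] by (blast elim: S_E)
    have H: "c (hmat l s m) = maass_sum k N \<alpha> l s m"
      if "s \<in> \<O>" "pos_semidef_hermitian (hmat l s m)" "hmat l s m \<noteq> 0" for l s m
      unfolding maass_condition_eq[OF R that(1,3), symmetric]
      by (rule al) (use that in \<open>simp_all add: S2_eq[OF R]\<close>)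
    show "hecke_coeff k c T = (\<Sum>d | d > 0 \<and> d dvd herm_content K D T \<and> coprime d N.
             of_nat d powi (k - 1) * hecke_alpha k \<alpha> (nat \<lfloor>Re (of_nat D * det T / (of_nat d)\<^sup>2)\<rfloor>))"
    proof -
      have T': "pos_semidef_hermitian (hmat l s m)" "hmat l s m \<noteq> 0" using T by (simp_all add: Tm)
      show ?thesis unfolding Tm maass_condition_eq[OF R s T'(2)] by (rule hecke_coeff_maass[OF H s T'])
    qed
  qed
  ultimately show ?thesis unfolding maass_space_def by blast
qed

end

theorem theorem6p4:
  fixes K :: "complex set" and D N p :: nat and k :: int and F :: "complex^2^2 \<Rightarrow> complex"
  assumes "imaginary_quadratic_field K"
    and "D > 0" and "has_discriminant K (- int D)"
    and "int (card (unit_group K)) dvd k"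
    and "N \<ge> 1"
    and "inert_prime K p" and "\<not> p dvd N"
    and "F \<in> maass_space K D k N"
  shows "hecke_T K k N p F \<in> maass_space K D k N"
proof -
  obtain \<omega> \<tau> \<nu> where quad: "imag_quad \<omega> \<tau> \<nu> D"
    and basis: "ring_of_integers K = {of_int a + of_int b * \<omega> | a b. True}"
    using ring_of_integers_basis[OF assms(1-3)] by blast
  interpret imag_quad \<omega> \<tau> \<nu> D by (rule quad)
  have R: "ring_of_integers K = \<O>" using basis by (simp add: \<O>_def)
  have I: "ideal_of_nat K p = I p" by (simp add: ideal_of_nat_def I_def R)
  interpret hecke_setup \<omega> \<tau> \<nu> D p N
    by unfold_locales (use assms(6,7) in \<open>auto simp: inert_prime_def R I\<close>)
  show ?thesis by (rule hecke_T_maass[OF R assms(8)])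
qed

end
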